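(* Let $L>0$, $\alpha>0$, and let $H$ be the dissipative Schrödinger operator on the tadpole graph $\mathcal R$. The generalized eigenfunctions of $iH$ associated to the eigenvalues in $i\Sigma_p^-(H)$ form a Riesz basis of $\mathcal H_p^-$, the closed subspace of $\mathcal H=L^2(\mathcal R)$ which they span.
   Context: Tadpole graph: $\mathcal R=\overline{R_1}\cup\overline{R_2}$, where $R_1$ is identified with $(0,+\infty)$ and $R_2$ is a closed path of length $L>0$, identified with $(0,L)$. $\mathcal H=L^2(R_1)\oplus L^2(R_2)$. $H(u_1,u_2)=(-u_1'',-u_2'')$ on the domain of all $(u_1,u_2)\in H^2(R_1)\oplus H^2(R_2)$ satisfying $u_1(0)=u_2(0)=u_2(L)$ and $u_1'(0^+)+u_2'(0^+)-u_2'(L^-)=i\alpha u_1(0)$, with $\alpha>0$. $\Sigma_p^-(H)=\left\{\lambda^2:\ \Re\lambda>0,\ \Im\lambda>0,\ e^{i\lambda L}=3-\frac{4\alpha}{\lambda+\alpha}\right\}$. A sequence $(\Psi_n)_{n\in\mathbb N}$ is a Riesz basis of a Hilbert space $V$ if there exist a Hilbert space $\tilde V$, an orthonormal basis $(e_n)_{n\in\mathbb N}$ of $\tilde V$ and an isomorphism $\Theta:\tilde V\to V$ with $\Theta e_n=\Psi_n$ for all $n\in\mathbb N$. The (generalized) eigenfunctions are taken normalized in $\mathcal H$.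
   Formalization: The Riesz basis is indexed by an at most countable set (possibly finite or empty) instead of ℕ: the eigenvalue condition forces |λ|² < α Re λ, so Σ_p^-(H) is finite, H_p^- is finite-dimensional and no sequence indexed by all of ℕ can be a Riesz basis of it. *)

theory Defs
  imports
    "HOL-Analysis.Analysis"
    "HOL-Algebra.Module"
    "HOL-Algebra.Algebraic_Closure_Type"
begin

section \<open>Complex Hilbert spaces with explicit carriers\<close>

abbreviation complex_field :: "complex ring" where
  "complex_field \<equiv> ring_of_type_algebra"

text \<open>
  The fields \<open>mult\<close> and \<open>one\<close>, inherited from the ring record, play no role in a module.
\<close>

record 'a inner_module = "(complex, 'a) module" +
  inner_prod :: "'a \<Rightarrow> 'a \<Rightarrow> complex"

text \<open>The inner product is linear in its first argument.\<close>

locale complex_inner_space = Module.module complex_field V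
  for V :: "('a, 'm) inner_module_scheme" (structure) +
  assumes inner_add_left:
      "\<lbrakk>x \<in> carrier V; y \<in> carrier V; z \<in> carrier V\<rbrakk> \<Longrightarrow>
        inner_prod V (x \<oplus> y) z = inner_prod V x z + inner_prod V y z"
    and inner_smult_left:
      "\<lbrakk>x \<in> carrier V; y \<in> carrier V\<rbrakk> \<Longrightarrow> inner_prod V (c \<odot> x) y = c * inner_prod V x y"
    and inner_commute:
      "\<lbrakk>x \<in> carrier V; y \<in> carrier V\<rbrakk> \<Longrightarrow> inner_prod V y x = cnj (inner_prod V x y)"
    and inner_ge_zero: "x \<in> carrier V \<Longrightarrow> 0 \<le> Re (inner_prod V x x)"
    and inner_definite: "\<lbrakk>x \<in> carrier V; inner_prod V x x = 0\<rbrakk> \<Longrightarrow> x = \<zero>"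

definition norm_of :: "('a, 'm) inner_module_scheme \<Rightarrow> 'a \<Rightarrow> real" where
  "norm_of V x = sqrt (Re (inner_prod V x x))"

text \<open>
  The value \<open>0\<close> outside the carrier is forced by the locale \<open>Metric_space\<close>, which asks for a
  symmetric and nonnegative function on the whole type.
\<close>

definition dist_of :: "('a, 'm) inner_module_scheme \<Rightarrow> 'a \<Rightarrow> 'a \<Rightarrow> real" where
  "dist_of V x y =
    (if x \<in> carrier V \<and> y \<in> carrier V then norm_of V (x \<ominus>\<^bsub>V\<^esub> y) else 0)"

locale complex_hilbert_space = complex_inner_space +
  assumes complete: "Metric_space.mcomplete (carrier V) (dist_of V)"

definition lin_span :: "('a, 'm) inner_module_scheme \<Rightarrow> 'a set \<Rightarrow> 'a set" where
  "lin_span V S =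
    {finsum V (\<lambda>x. c x \<odot>\<^bsub>V\<^esub> x) A | c A. finite A \<and> A \<subseteq> S}"

definition closed_span :: "('a, 'm) inner_module_scheme \<Rightarrow> 'a set \<Rightarrow> 'a set" where
  "closed_span V S =
    (Metric_space.mtopology (carrier V) (dist_of V)) closure_of (lin_span V S)"

definition lin_independent ::
    "('a, 'm) inner_module_scheme \<Rightarrow> 'i set \<Rightarrow> ('i \<Rightarrow> 'a) \<Rightarrow> bool" where
  "lin_independent V I \<Psi> \<longleftrightarrow>
    (\<forall>A c. finite A \<and> A \<subseteq> I \<and> finsum V (\<lambda>i. c i \<odot>\<^bsub>V\<^esub> \<Psi> i) A = \<zero>\<^bsub>V\<^esub>
      \<longrightarrow> (\<forall>i\<in>A. c i = 0))"

definition orthonormal_basis ::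
    "('a, 'm) inner_module_scheme \<Rightarrow> 'i set \<Rightarrow> ('i \<Rightarrow> 'a) \<Rightarrow> bool" where
  "orthonormal_basis V I e \<longleftrightarrow>
    e ` I \<subseteq> carrier V
    \<and> (\<forall>i\<in>I. \<forall>j\<in>I. inner_prod V (e i) (e j) = (if i = j then 1 else 0))
    \<and> closed_span V (e ` I) = carrier V"

definition hilbert_isomorphism ::
    "('a, 'm) inner_module_scheme \<Rightarrow> ('b, 'n) inner_module_scheme \<Rightarrow> ('a \<Rightarrow> 'b) \<Rightarrow> bool" where
  "hilbert_isomorphism V W \<Theta> \<longleftrightarrow>
    bij_betw \<Theta> (carrier V) (carrier W)
    \<and> (\<forall>x\<in>carrier V. \<forall>y\<in>carrier V. \<Theta> (x \<oplus>\<^bsub>V\<^esub> y) = \<Theta> x \<oplus>\<^bsub>W\<^esub> \<Theta> y)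
    \<and> (\<forall>c. \<forall>x\<in>carrier V. \<Theta> (c \<odot>\<^bsub>V\<^esub> x) = c \<odot>\<^bsub>W\<^esub> \<Theta> x)
    \<and> (\<exists>C. \<forall>x\<in>carrier V. norm_of W (\<Theta> x) \<le> C * norm_of V x)
    \<and> (\<exists>C. \<forall>x\<in>carrier V. norm_of V x \<le> C * norm_of W (\<Theta> x))"

text \<open>
  The index set is at most countable and may be finite, so that Riesz bases of
  finite-dimensional spaces are covered.  The elements of the auxiliary Hilbert space \<open>Vt\<close> have
  the same type as those of \<open>V\<close>, but its carrier and all its operations are arbitrary; this is no
  restriction, because the structure of any other auxiliary space can be transported to
  \<open>carrier V\<close> along \<open>\<Theta>\<close>.
\<close>

definition riesz_basis :: "'a inner_module \<Rightarrow> 'i set \<Rightarrow> ('i \<Rightarrow> 'a) \<Rightarrow> bool" where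
  "riesz_basis V I \<Psi> \<longleftrightarrow>
    complex_hilbert_space V \<and> countable I
    \<and> (\<exists>(Vt :: 'a inner_module) e \<Theta>.
          complex_hilbert_space Vt \<and> orthonormal_basis Vt I e
          \<and> hilbert_isomorphism Vt V \<Theta> \<and> (\<forall>i\<in>I. \<Theta> (e i) = \<Psi> i))"

section \<open>Root subspaces of an unbounded operator\<close>

text \<open>
  \<open>ker_power V D T \<mu> k\<close> is the kernel of the \<open>k\<close>-th power of \<open>T - \<mu>\<close>, where \<open>T\<close> has domain \<open>D\<close>
  and the powers have their natural domains.
\<close>

primrec ker_power ::
    "('a, 'm) inner_module_scheme \<Rightarrow> 'a set \<Rightarrow> ('a \<Rightarrow> 'a) \<Rightarrow> complex \<Rightarrow> nat \<Rightarrow> 'a set" where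
  "ker_power V D T \<mu> 0 = {\<zero>\<^bsub>V\<^esub>}"
| "ker_power V D T \<mu> (Suc k) = {u \<in> D. T u \<ominus>\<^bsub>V\<^esub> \<mu> \<odot>\<^bsub>V\<^esub> u \<in> ker_power V D T \<mu> k}"

definition root_space ::
    "('a, 'm) inner_module_scheme \<Rightarrow> 'a set \<Rightarrow> ('a \<Rightarrow> 'a) \<Rightarrow> complex \<Rightarrow> 'a set" where
  "root_space V D T \<mu> = (\<Union>k. ker_power V D T \<mu> k)"

text \<open>
  A system of normalized generalized eigenfunctions associated with the eigenvalues in \<open>\<Sigma>\<close>:
  a family of unit vectors which is made up of one basis of each root subspace.
\<close>

definition generalized_eigenfunctions ::
    "('a, 'm) inner_module_scheme \<Rightarrow> 'a set \<Rightarrow> ('a \<Rightarrow> 'a) \<Rightarrow> complex set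
      \<Rightarrow> 'i set \<Rightarrow> ('i \<Rightarrow> 'a) \<Rightarrow> bool" where
  "generalized_eigenfunctions V D T \<Sigma> I \<Psi> \<longleftrightarrow>
    (\<forall>i\<in>I. norm_of V (\<Psi> i) = 1 \<and> (\<exists>\<mu>\<in>\<Sigma>. \<Psi> i \<in> root_space V D T \<mu>))
    \<and> (\<forall>\<mu>\<in>\<Sigma>. lin_independent V {i \<in> I. \<Psi> i \<in> root_space V D T \<mu>} \<Psi>
          \<and> lin_span V (\<Psi> ` {i \<in> I. \<Psi> i \<in> root_space V D T \<mu>}) = root_space V D T \<mu>)"

section \<open>The space of square integrable functions\<close>

definition L2_fun :: "'a measure \<Rightarrow> ('a \<Rightarrow> complex) set" where
  "L2_fun M = {f \<in> borel_measurable M. integrable M (\<lambda>x. (cmod (f x))\<^sup>2)}"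

definition ae_class :: "'a measure \<Rightarrow> ('a \<Rightarrow> complex) \<Rightarrow> ('a \<Rightarrow> complex) set" where
  "ae_class M f = {g \<in> borel_measurable M. AE x in M. g x = f x}"

definition ae_rep :: "('a \<Rightarrow> complex) set \<Rightarrow> 'a \<Rightarrow> complex" where
  "ae_rep u = (SOME f. f \<in> u)"

definition L2_space :: "'a measure \<Rightarrow> ('a \<Rightarrow> complex) set inner_module" where
  "L2_space M = \<lparr>
     carrier = ae_class M ` L2_fun M,
     monoid.mult = undefined,
     one = undefined,
     ring.zero = ae_class M (\<lambda>x. 0),
     add = (\<lambda>u v. ae_class M (\<lambda>x. ae_rep u x + ae_rep v x)),
     smult = (\<lambda>c u. ae_class M (\<lambda>x. c * ae_rep u x)),
     inner_prod = (\<lambda>u v. LINT x|M. ae_rep u x * cnj (ae_rep v x)) \<rparr>"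

definition orthogonal_sum ::
    "'a inner_module \<Rightarrow> 'b inner_module \<Rightarrow> ('a \<times> 'b) inner_module" where
  "orthogonal_sum V W = \<lparr>
     carrier = carrier V \<times> carrier W,
     monoid.mult = undefined,
     one = undefined,
     ring.zero = (\<zero>\<^bsub>V\<^esub>, \<zero>\<^bsub>W\<^esub>),
     add = (\<lambda>u v. (fst u \<oplus>\<^bsub>V\<^esub> fst v, snd u \<oplus>\<^bsub>W\<^esub> snd v)),
     smult = (\<lambda>c u. (c \<odot>\<^bsub>V\<^esub> fst u, c \<odot>\<^bsub>W\<^esub> snd u)),
     inner_prod = (\<lambda>u v. inner_prod V (fst u) (fst v) + inner_prod W (snd u) (snd v)) \<rparr>"

section \<open>Sobolev spaces on an open interval\<close>

abbreviation L2_on :: "real set \<Rightarrow> (real \<Rightarrow> complex) set inner_module" where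
  "L2_on J \<equiv> L2_space (lebesgue_on J)"

definition test_function :: "real set \<Rightarrow> (real \<Rightarrow> complex) \<Rightarrow> bool" where
  "test_function J \<phi> \<longleftrightarrow>
    \<phi> C1_differentiable_on UNIV \<and> (\<exists>K. compact K \<and> K \<subseteq> J \<and> (\<forall>x. x \<notin> K \<longrightarrow> \<phi> x = 0))"

definition is_weak_derivative ::
    "real set \<Rightarrow> (real \<Rightarrow> complex) set \<Rightarrow> (real \<Rightarrow> complex) set \<Rightarrow> bool" where
  "is_weak_derivative J u v \<longleftrightarrow>
    u \<in> carrier (L2_on J) \<and> v \<in> carrier (L2_on J)
    \<and> (\<forall>\<phi>. test_function J \<phi> \<longrightarrow>
          (LINT x|lebesgue_on J. ae_rep u x * vector_derivative \<phi> (at x))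
            = - (LINT x|lebesgue_on J. ae_rep v x * \<phi> x))"

definition weak_derivative ::
    "real set \<Rightarrow> (real \<Rightarrow> complex) set \<Rightarrow> (real \<Rightarrow> complex) set" where
  "weak_derivative J u = (THE v. is_weak_derivative J u v)"

definition sobolev_H1 :: "real set \<Rightarrow> (real \<Rightarrow> complex) set set" where
  "sobolev_H1 J = {u. \<exists>v. is_weak_derivative J u v}"

definition sobolev_H2 :: "real set \<Rightarrow> (real \<Rightarrow> complex) set set" where
  "sobolev_H2 J = {u \<in> sobolev_H1 J. weak_derivative J u \<in> sobolev_H1 J}"

text \<open>
  Every class in \<open>sobolev_H1 J\<close> has exactly one continuous representative on the open interval
  \<open>J\<close>; the boundary value at an endpoint \<open>a\<close> is the one-sided limit of that representative.
\<close>

definition boundary_value :: "real set \<Rightarrow> real \<Rightarrow> (real \<Rightarrow> complex) set \<Rightarrow> complex" where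
  "boundary_value J a u = (THE c. \<exists>f\<in>u. continuous_on J f \<and> (f \<longlongrightarrow> c) (at a within J))"

section \<open>The dissipative Schroedinger operator on the tadpole graph\<close>

abbreviation halfline :: "real set" where
  "halfline \<equiv> {0<..}"

abbreviation loop :: "real \<Rightarrow> real set" where
  "loop L \<equiv> {0<..<L}"

type_synonym tadpole_fun = "(real \<Rightarrow> complex) set \<times> (real \<Rightarrow> complex) set"

definition tadpole_L2 :: "real \<Rightarrow> tadpole_fun inner_module" where
  "tadpole_L2 L = orthogonal_sum (L2_on halfline) (L2_on (loop L))"

definition tadpole_domain :: "real \<Rightarrow> real \<Rightarrow> tadpole_fun set" where
  "tadpole_domain L \<alpha> = {(u1, u2).
     u1 \<in> sobolev_H2 halfline \<and> u2 \<in> sobolev_H2 (loop L)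
     \<and> boundary_value halfline 0 u1 = boundary_value (loop L) 0 u2
     \<and> boundary_value (loop L) 0 u2 = boundary_value (loop L) L u2
     \<and> boundary_value halfline 0 (weak_derivative halfline u1)
          + boundary_value (loop L) 0 (weak_derivative (loop L) u2)
          - boundary_value (loop L) L (weak_derivative (loop L) u2)
        = \<i> * complex_of_real \<alpha> * boundary_value halfline 0 u1}"

definition tadpole_H :: "real \<Rightarrow> tadpole_fun \<Rightarrow> tadpole_fun" where
  "tadpole_H L u =
    (\<ominus>\<^bsub>L2_on halfline\<^esub> weak_derivative halfline (weak_derivative halfline (fst u)),
     \<ominus>\<^bsub>L2_on (loop L)\<^esub> weak_derivative (loop L) (weak_derivative (loop L) (snd u)))"

definition tadpole_iH :: "real \<Rightarrow> tadpole_fun \<Rightarrow> tadpole_fun" where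
  "tadpole_iH L u = \<i> \<odot>\<^bsub>tadpole_L2 L\<^esub> tadpole_H L u"

definition Sigma_p_minus :: "real \<Rightarrow> real \<Rightarrow> complex set" where
  "Sigma_p_minus L \<alpha> = {z\<^sup>2 | z :: complex. Re z > 0 \<and> Im z > 0
     \<and> exp (\<i> * z * complex_of_real L)
         = 3 - 4 * complex_of_real \<alpha> / (z + complex_of_real \<alpha>)}"

definition i_Sigma_p_minus :: "real \<Rightarrow> real \<Rightarrow> complex set" where
  "i_Sigma_p_minus L \<alpha> = (\<lambda>\<mu>. \<i> * \<mu>) ` Sigma_p_minus L \<alpha>"

definition H_p_minus :: "real \<Rightarrow> real \<Rightarrow> tadpole_fun inner_module" where
  "H_p_minus L \<alpha> = (tadpole_L2 L)\<lparr>carrier :=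
     closed_span (tadpole_L2 L)
       (\<Union>\<mu>\<in>i_Sigma_p_minus L \<alpha>. root_space (tadpole_L2 L) (tadpole_domain L \<alpha>) (tadpole_iH L) \<mu>)\<rparr>"

end

theory Submission
  imports
    Defs
    "HOL-Complex_Analysis.Complex_Analysis"
begin

text \<open>
  The space that the generalized eigenfunctions span has finite dimension, and in such a space
  every basis is a Riesz basis.
  
  \<^bold>\<open>Finitely many eigenvalues.\<close>  If \<open>\<lambda>\<close> lies in the open first quadrant and solves the characteristic
  equation, then \<open>\<bar>exp (\<i> \<lambda> L)\<bar> < 1\<close>, so \<open>\<bar>3 - 4 \<alpha> / (\<lambda> + \<alpha>)\<bar> < 1\<close> and hence \<open>\<bar>\<lambda> + \<alpha>\<bar> < 2 \<alpha>\<close>.  The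
  solutions are therefore zeros, in a fixed disc, of the entire function
  \<open>F(\<lambda>) = exp (\<i> \<lambda> L) (\<lambda> + \<alpha>) - (3 \<lambda> - \<alpha>)\<close>, and \<open>F\<close> is not constant
  (\<open>finite_Sigma_p_minus\<close>).
  
  \<^bold>\<open>Eigenvectors are determined by their value at the vertex.\<close>  An eigenvector that vanishes at the
  vertex solves a Dirichlet problem on each edge; that problem is symmetric, while the
  eigenvalue is not real (\<open>eigenfunction_vertex_value\<close>).  Consequently the kernel of the
  \<open>k\<close>-th power of \<open>\<i>H - \<mu>\<close> has dimension at most \<open>k\<close> (\<open>ker_independent_card\<close>).
  
  \<^bold>\<open>Jordan chains are short.\<close>  For \<open>Im k > 0\<close> let \<open>v\<^sub>k\<close> be the solution of \<open>- v'' = k\<^sup>2 v\<close> that decays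
  on the half line, is symmetric on the loop and is continuous at the vertex.  It violates the
  derivative condition at the vertex by a multiple of \<open>F(k)\<close>.  Green's identity (\<open>tadpole_Green\<close>)
  gives, for \<open>w = (\<i>H - \<i>z) u\<close> and the bilinear pairing with \<open>v\<^sub>k\<close>,
  \<open>(k\<^sup>2 - z) (u, v\<^sub>k) = - \<i> ((w, v\<^sub>k) + F(k) u(0))\<close>.  Along a Jordan chain of length \<open>n\<close> this
  iterates to \<open>(k\<^sup>2 - z)\<^sup>n (u, v\<^sub>k) = F(k) P(k\<^sup>2 - z)\<close> with \<open>P(0) \<noteq> 0\<close>
  (\<open>root_vector_vanishing_order\<close>), and since \<open>(u, v\<^sub>k)\<close> stays bounded, \<open>F\<close> vanishes to order at
  least \<open>n\<close> at the square root \<open>k\<^sub>0\<close> of \<open>z\<close>.  The order of that zero bounds the length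
  (\<open>root_space_bounded_length\<close>).
  
  \<^bold>\<open>Conclusion.\<close>  Root subspaces of different eigenvalues are linearly independent, so the family
  is a finite basis of its span.  A finite basis \<open>\<Psi>\<close> has a dual family \<open>d\<close> (\<open>dual_family\<close>), and
  it is orthonormal for the new inner product \<open>\<Sum>\<^sub>i \<langle>x, d\<^sub>i\<rangle> \<langle>d\<^sub>i, y\<rangle>\<close>, whose norm is equivalent to
  the old one; the identity is the required isomorphism (\<open>riesz_basis_finite_dimensional\<close>).
  
  The operator is defined by weak derivatives and by boundary values of continuous
  representatives.  The link with calculus is that a function with a weak derivative agrees
  almost everywhere with an indefinite integral of it (\<open>weak_derivative_continuous_rep\<close>).
  Every root vector \<open>u\<close> satisfies \<open>u'' = \<i> w - z u\<close> with \<open>w\<close> in the domain again, so its second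
  derivative has a continuous representative too and Green's identity is the classical one.
\<close>

section \<open>Complex inner product spaces on a carrier\<close>

lemma complex_field_simps [simp]:
  "carrier complex_field = UNIV" "zero complex_field = 0" "one complex_field = 1"
  "add complex_field x y = x + y" "monoid.mult complex_field x y = x * y"
  by (simp_all add: ring_of_type_algebra_def)

context complex_inner_space
begin

lemma smult_in [simp, intro]: "x \<in> carrier V \<Longrightarrow> c \<odot> x \<in> carrier V"
  by (rule smult_closed) simp_all

lemma inner_zero_left [simp]: "y \<in> carrier V \<Longrightarrow> inner_prod V \<zero> y = 0"
  using inner_add_left[of \<zero> \<zero> y] by simp

lemma inner_uminus_left [simp]:
  assumes "x \<in> carrier V" "y \<in> carrier V" shows "inner_prod V (\<ominus> x) y = - inner_prod V x y"
  using inner_add_left[of "\<ominus> x" x y] assms by (simp add: M.l_neg add_eq_0_iff)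

lemma inner_minus_left [simp]:
  assumes "x \<in> carrier V" "y \<in> carrier V" "z \<in> carrier V"
  shows "inner_prod V (x \<ominus> y) z = inner_prod V x z - inner_prod V y z"
  using assms by (simp add: a_minus_def inner_add_left)

declare inner_add_left [simp] inner_smult_left [simp]

lemma inner_finsum_left [simp]:
  assumes "f \<in> A \<rightarrow> carrier V" "y \<in> carrier V"
  shows "inner_prod V (finsum V f A) y = (if finite A then \<Sum>i\<in>A. inner_prod V (f i) y else 0)"
proof (cases "finite A")
  case True
  then show ?thesis using assms
    by (induction A rule: finite_induct) (auto simp: Pi_def)
next
  case False
  then show ?thesis using assms by (simp add: M.finsum_infinite)
qed

text \<open>
  Testing with all vectors turns an identity between linear combinations into one between complex
  numbers, which the simplifier settles with the rules for \<open>inner_prod\<close>.  Most vector identities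
  below are proved in this way.
\<close>

lemma inner_eqI:
  assumes "x \<in> carrier V" "y \<in> carrier V"
    and "\<And>z. z \<in> carrier V \<Longrightarrow> inner_prod V x z = inner_prod V y z"
  shows "x = y"
proof -
  have "inner_prod V (x \<ominus> y) (x \<ominus> y) = 0"
    using assms by simp
  then have "x \<ominus> y = \<zero>"
    using assms by (intro inner_definite) auto
  then show ?thesis
    using assms by (simp add: M.add.inv_solve_right' a_minus_def)
qed

lemma minus_eq_zero_iff [simp]:
  assumes "x \<in> carrier V" "y \<in> carrier V" shows "x \<ominus> y = \<zero> \<longleftrightarrow> x = y"
proof
  assume *: "x \<ominus> y = \<zero>"
  show "x = y"
  proof (rule inner_eqI)
    fix z assume "z \<in> carrier V"
    then show "inner_prod V x z = inner_prod V y z"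
      using assms inner_minus_left[of x y z] * by simp
  qed (use assms in auto)
qed (use assms in \<open>simp add: a_minus_def M.r_neg\<close>)

lemma smult_1 [simp]: "x \<in> carrier V \<Longrightarrow> 1 \<odot> x = x"
  by (intro inner_eqI) auto

lemma inner_add_right [simp]:
  "\<lbrakk>x \<in> carrier V; y \<in> carrier V; z \<in> carrier V\<rbrakk> \<Longrightarrow>
    inner_prod V z (x \<oplus> y) = inner_prod V z x + inner_prod V z y"
  using inner_commute[of "x \<oplus> y" z] inner_commute[of x z] inner_commute[of y z] by simp

lemma inner_smult_right [simp]:
  "\<lbrakk>x \<in> carrier V; z \<in> carrier V\<rbrakk> \<Longrightarrow> inner_prod V z (c \<odot> x) = cnj c * inner_prod V z x"
  using inner_commute[of "c \<odot> x" z] inner_commute[of x z] by simp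

lemma inner_minus_right [simp]:
  "\<lbrakk>x \<in> carrier V; y \<in> carrier V; z \<in> carrier V\<rbrakk> \<Longrightarrow>
    inner_prod V z (x \<ominus> y) = inner_prod V z x - inner_prod V z y"
  using inner_commute[of "x \<ominus> y" z] inner_commute[of x z] inner_commute[of y z] by simp

lemma inner_self:
  assumes "x \<in> carrier V" shows "inner_prod V x x = of_real ((norm_of V x)\<^sup>2)"
proof -
  have "Im (inner_prod V x x) = 0"
    using inner_commute[OF assms assms] by (metis Reals_cnj_iff complex_is_Real_iff)
  then show ?thesis
    using inner_ge_zero[OF assms] by (simp add: complex_eq_iff norm_of_def)
qed

lemma norm_of_power2: "x \<in> carrier V \<Longrightarrow> (norm_of V x)\<^sup>2 = Re (inner_prod V x x)"
  by (simp add: norm_of_def inner_ge_zero)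

lemma norm_of_nonneg [simp]: "x \<in> carrier V \<Longrightarrow> 0 \<le> norm_of V x"
  by (simp add: norm_of_def inner_ge_zero)

lemma norm_of_eq_0 [simp]: "x \<in> carrier V \<Longrightarrow> norm_of V x = 0 \<longleftrightarrow> x = \<zero>"
  using inner_self[of x] inner_definite[of x] by auto

text \<open>
  The vector \<open>x - c y\<close>, where \<open>c y\<close> is the orthogonal projection of \<open>x\<close> on \<open>y\<close>, has a nonnegative
  square norm.
\<close>

lemma Cauchy_Schwarz:
  assumes "x \<in> carrier V" "y \<in> carrier V"
  shows "cmod (inner_prod V x y) \<le> norm_of V x * norm_of V y"
proof (cases "y = \<zero>")
  case True
  then show ?thesis using assms inner_commute[of \<zero> x] by simp
next
  case False
  define c where "c = inner_prod V x y / inner_prod V y y"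
  have "norm_of V y \<noteq> 0" "inner_prod V y y \<noteq> 0"
    using assms False inner_definite[of y] by auto
  then have y0: "norm_of V y > 0" "inner_prod V y y \<noteq> 0"
    using norm_of_nonneg[OF assms(2)] by auto
  have yx: "inner_prod V y x = cnj (inner_prod V x y)"
    using inner_commute[of x y] assms by simp
  have yy: "cnj (inner_prod V y y) = inner_prod V y y"
    using assms by (simp add: inner_self)
  have "inner_prod V (x \<ominus> c \<odot> y) (x \<ominus> c \<odot> y)
      = inner_prod V x x - cnj c * inner_prod V x y - (c * cnj (inner_prod V x y)
        - cnj c * (c * inner_prod V y y))"
    using assms by (simp add: yx algebra_simps)
  also have "\<dots> = inner_prod V x x - inner_prod V x y * cnj (inner_prod V x y) / inner_prod V y y"
    using y0 by (simp add: c_def yy)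
  also have "\<dots> = of_real ((norm_of V x)\<^sup>2 - (cmod (inner_prod V x y))\<^sup>2 / (norm_of V y)\<^sup>2)"
    using assms by (simp add: inner_self complex_mult_cnj cmod_power2)
  finally have "0 \<le> (norm_of V x)\<^sup>2 - (cmod (inner_prod V x y))\<^sup>2 / (norm_of V y)\<^sup>2"
    using inner_ge_zero[of "x \<ominus> c \<odot> y"] assms by simp
  then have "(cmod (inner_prod V x y))\<^sup>2 \<le> (norm_of V x * norm_of V y)\<^sup>2"
    using y0(1) by (simp add: divide_le_eq power_mult_distrib)
  then show ?thesis
    by (rule power2_le_imp_le) (use assms in auto)
qed

lemma norm_of_triangle:
  assumes "x \<in> carrier V" "y \<in> carrier V"
  shows "norm_of V (x \<oplus> y) \<le> norm_of V x + norm_of V y"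
proof -
  have "(norm_of V (x \<oplus> y))\<^sup>2 = Re (inner_prod V (x \<oplus> y) (x \<oplus> y))"
    using assms by (simp add: norm_of_power2 del: inner_add_left inner_add_right)
  also have "\<dots> = (norm_of V x)\<^sup>2 + (norm_of V y)\<^sup>2 + 2 * Re (inner_prod V x y)"
    using assms inner_commute[of x y] by (simp add: norm_of_power2)
  also have "\<dots> \<le> (norm_of V x)\<^sup>2 + (norm_of V y)\<^sup>2 + 2 * (norm_of V x * norm_of V y)"
    using Cauchy_Schwarz[OF assms] complex_Re_le_cmod[of "inner_prod V x y"] by linarith
  also have "\<dots> = (norm_of V x + norm_of V y)\<^sup>2"
    by (simp add: power2_sum)
  finally show ?thesis
    by (rule power2_le_imp_le) (use assms in auto)
qed

lemma norm_of_smult: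
  assumes "x \<in> carrier V" shows "norm_of V (c \<odot> x) = cmod c * norm_of V x"
proof -
  have "(norm_of V (c \<odot> x))\<^sup>2 = Re (c * cnj c * of_real ((norm_of V x)\<^sup>2))"
    using assms by (subst norm_of_power2) (simp_all add: inner_self[OF assms] mult.assoc)
  also have "\<dots> = (cmod c * norm_of V x)\<^sup>2"
    by (subst complex_norm_square[symmetric]) (simp add: power_mult_distrib flip: of_real_mult)
  finally have "(norm_of V (c \<odot> x))\<^sup>2 = (cmod c * norm_of V x)\<^sup>2" .
  then show ?thesis
    using assms by (simp add: power2_eq_iff_nonneg)
qed

lemma norm_of_finsum:
  assumes "finite A" "f \<in> A \<rightarrow> carrier V"
  shows "norm_of V (finsum V f A) \<le> (\<Sum>i\<in>A. norm_of V (f i))"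
  using assms
proof (induction A rule: finite_induct)
  case empty
  then show ?case using norm_of_eq_0[OF M.zero_closed] by (simp del: norm_of_eq_0)
next
  case (insert a A)
  then show ?case
    using norm_of_triangle[of "f a" "finsum V f A"] by (auto simp: Pi_def)
qed

lemma norm_of_minus_commute:
  assumes "x \<in> carrier V" "y \<in> carrier V"
  shows "norm_of V (x \<ominus> y) = norm_of V (y \<ominus> x)"
  using assms by (simp add: norm_of_def)

lemma Metric_space_dist_of: "Metric_space (carrier V) (dist_of V)"
proof
  show "0 \<le> dist_of V x y" for x y
    by (simp add: dist_of_def)
  show "dist_of V x y = dist_of V y x" for x y
    by (simp add: dist_of_def norm_of_minus_commute)
  show "dist_of V x y = 0 \<longleftrightarrow> x = y" if "x \<in> carrier V" "y \<in> carrier V" for x y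
    using that by (simp add: dist_of_def)
  show "dist_of V x z \<le> dist_of V x y + dist_of V y z"
    if "x \<in> carrier V" "y \<in> carrier V" "z \<in> carrier V" for x y z
  proof -
    have "x \<ominus> z = (x \<ominus> y) \<oplus> (y \<ominus> z)"
      using that by (intro inner_eqI) auto
    then show ?thesis
      using that norm_of_triangle[of "x \<ominus> y" "y \<ominus> z"] by (simp add: dist_of_def)
  qed
qed

section \<open>Subspaces and spans\<close>

lemma subspaceI:
  assumes "W \<subseteq> carrier V" "\<zero> \<in> W" "\<And>x y. x \<in> W \<Longrightarrow> y \<in> W \<Longrightarrow> x \<oplus> y \<in> W"
    "\<And>c x. x \<in> W \<Longrightarrow> c \<odot> x \<in> W"
  shows "submodule W complex_field V"
proof (rule submoduleI)
  fix x assume x: "x \<in> W"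
  have "\<ominus> x = (-1) \<odot> x"
    using x assms(1) by (intro inner_eqI) auto
  then show "\<ominus> x \<in> W" using assms(4) x by metis
qed (use assms in auto)

lemma
  assumes "submodule W complex_field V"
  shows subspace_subset: "W \<subseteq> carrier V"
    and subspace_0: "\<zero> \<in> W"
    and subspace_add: "\<And>x y. x \<in> W \<Longrightarrow> y \<in> W \<Longrightarrow> x \<oplus> y \<in> W"
    and subspace_smult: "\<And>c x. x \<in> W \<Longrightarrow> c \<odot> x \<in> W"
    and subspace_minus: "\<And>x y. x \<in> W \<Longrightarrow> y \<in> W \<Longrightarrow> x \<ominus> y \<in> W"
proof -
  note E = submoduleE[OF assms]
  show "W \<subseteq> carrier V" "\<And>x y. x \<in> W \<Longrightarrow> y \<in> W \<Longrightarrow> x \<oplus> y \<in> W"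
    "\<And>c x. x \<in> W \<Longrightarrow> c \<odot> x \<in> W" "\<And>x y. x \<in> W \<Longrightarrow> y \<in> W \<Longrightarrow> x \<ominus> y \<in> W"
    using E by (auto simp: a_minus_def)
  obtain w where "w \<in> W" using E(2) by blast
  then have "w \<oplus> \<ominus> w \<in> W" "w \<in> carrier V" using E by auto
  then show "\<zero> \<in> W" by (simp add: M.r_neg)
qed

lemma subspace_finsum:
  assumes "submodule W complex_field V" "f \<in> A \<rightarrow> W"
  shows "finsum V f A \<in> W"
proof (cases "finite A")
  case True
  then show ?thesis using assms(2)
  proof (induction A rule: finite_induct)
    case (insert a A)
    then show ?case
      using subspace_subset[OF assms(1)] subspace_add[OF assms(1)]
      by (subst M.finsum_insert) (auto simp: Pi_def)
  qed (simp add: subspace_0[OF assms(1)])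
qed (simp add: M.finsum_infinite subspace_0[OF assms(1)])

lemma lin_span_minimal:
  assumes "submodule W complex_field V" "S \<subseteq> W"
  shows "lin_span V S \<subseteq> W"
  using assms by (auto simp: lin_span_def intro!: subspace_finsum subspace_smult)

lemma lin_span_superset:
  assumes "S \<subseteq> carrier V" shows "S \<subseteq> lin_span V S"
proof
  fix x assume x: "x \<in> S"
  then have "finsum V (\<lambda>y. 1 \<odot> y) {x} = x"
    using assms by (subst M.finsum_insert) auto
  then show "x \<in> lin_span V S"
    using x unfolding lin_span_def
    by (intro CollectI exI[of _ "\<lambda>_. 1"] exI[of _ "{x}"]) auto
qed

lemma subspace_lin_span:
  assumes S: "S \<subseteq> carrier V" shows "submodule (lin_span V S) complex_field V"
proof (rule subspaceI)
  show "lin_span V S \<subseteq> carrier V"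
    using S by (auto simp: lin_span_def intro!: M.finsum_closed)
  show "\<zero> \<in> lin_span V S"
    unfolding lin_span_def by (intro CollectI exI[of _ "\<lambda>_. 0"] exI[of _ "{}"]) auto
next
  fix x y assume "x \<in> lin_span V S" "y \<in> lin_span V S"
  then obtain a A b B where
    A: "x = finsum V (\<lambda>x. a x \<odot> x) A" "finite A" "A \<subseteq> S" and
    B: "y = finsum V (\<lambda>x. b x \<odot> x) B" "finite B" "B \<subseteq> S"
    unfolding lin_span_def by blast
  define c where "c i = (if i \<in> A then a i else 0) + (if i \<in> B then b i else 0)" for i
  have cA: "(\<lambda>i. a i \<odot> i) \<in> A \<rightarrow> carrier V" "(\<lambda>i. b i \<odot> i) \<in> B \<rightarrow> carrier V"
    "(\<lambda>i. c i \<odot> i) \<in> A \<union> B \<rightarrow> carrier V"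
    using A B S by auto
  have "x \<oplus> y = finsum V (\<lambda>i. c i \<odot> i) (A \<union> B)"
  proof (rule inner_eqI)
    fix z assume z: "z \<in> carrier V"
    have AB: "\<And>i. i \<in> A \<union> B \<Longrightarrow> i \<in> carrier V" using A B S by auto
    have "(\<Sum>i\<in>A \<union> B. c i * inner_prod V i z)
        = (\<Sum>i\<in>A \<union> B. (if i \<in> A then a i * inner_prod V i z else 0))
          + (\<Sum>i\<in>A \<union> B. (if i \<in> B then b i * inner_prod V i z else 0))"
      by (subst sum.distrib[symmetric], rule sum.cong) (auto simp: c_def algebra_simps)
    also have "\<dots> = (\<Sum>i\<in>A. a i * inner_prod V i z) + (\<Sum>i\<in>B. b i * inner_prod V i z)"
      using A B by (simp add: sum.If_cases Int_absorb1 Collect_mem_eq)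
    finally show "inner_prod V (x \<oplus> y) z = inner_prod V (finsum V (\<lambda>i. c i \<odot> i) (A \<union> B)) z"
      using cA A B z AB M.finsum_closed[OF cA(1)] M.finsum_closed[OF cA(2)]
      by (simp add: subset_iff)
  qed (use A B cA in \<open>auto intro!: M.finsum_closed\<close>)
  then show "x \<oplus> y \<in> lin_span V S"
    unfolding lin_span_def using A B by blast
next
  fix c x assume "x \<in> lin_span V S"
  then obtain a A where
    A: "x = finsum V (\<lambda>x. a x \<odot> x) A" "finite A" "A \<subseteq> S"
    unfolding lin_span_def by blast
  have AS: "\<And>i. i \<in> A \<Longrightarrow> i \<in> carrier V" using A S by auto
  have "c \<odot> x = finsum V (\<lambda>i. (c * a i) \<odot> i) A"
    using A AS by (intro inner_eqI)
      (auto intro!: M.finsum_closed simp: Pi_def sum_distrib_left mult.assoc)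
  then show "c \<odot> x \<in> lin_span V S"
    unfolding lin_span_def using A by (intro CollectI exI[of _ "\<lambda>i. c * a i"] exI[of _ A]) auto
qed

text \<open>
  The definition of \<open>lin_span\<close> takes coefficients on a set of vectors; for a family it is more
  convenient to take them on the index set.
\<close>

lemma lin_span_image_eq:
  assumes "finite A" "\<Psi> \<in> A \<rightarrow> carrier V"
  shows "lin_span V (\<Psi> ` A) = {finsum V (\<lambda>i. c i \<odot> \<Psi> i) A | c. True}" (is "_ = ?R")
proof
  have cl: "(\<lambda>i. c i \<odot> \<Psi> i) \<in> A \<rightarrow> carrier V" for c
    using assms by auto
  have P: "\<Psi> i \<in> carrier V" if "i \<in> A" for i
    using that assms by auto
  have "submodule ?R complex_field V"
  proof (rule subspaceI)
    show "?R \<subseteq> carrier V" using cl by (auto intro!: M.finsum_closed)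
    have "\<zero> = finsum V (\<lambda>i. 0 \<odot> \<Psi> i) A"
      using assms P by (intro inner_eqI) (auto intro!: M.finsum_closed simp: Pi_def)
    then show "\<zero> \<in> ?R" by (intro CollectI exI[of _ "\<lambda>_. 0"]) auto
    show "x \<oplus> y \<in> ?R" if xy: "x \<in> ?R" "y \<in> ?R" for x y
    proof -
      obtain a b where ab: "x = finsum V (\<lambda>i. a i \<odot> \<Psi> i) A" "y = finsum V (\<lambda>i. b i \<odot> \<Psi> i) A"
        using xy by blast
      have "x \<oplus> y = finsum V (\<lambda>i. (a i + b i) \<odot> \<Psi> i) A"
        using assms P ab by (intro inner_eqI)
          (auto intro!: M.finsum_closed simp: Pi_def sum.distrib algebra_simps)
      then show ?thesis by (intro CollectI exI[of _ "\<lambda>i. a i + b i"]) auto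
    qed
    show "c \<odot> x \<in> ?R" if x: "x \<in> ?R" for c x
    proof -
      obtain a where a: "x = finsum V (\<lambda>i. a i \<odot> \<Psi> i) A"
        using x by blast
      have "c \<odot> x = finsum V (\<lambda>i. (c * a i) \<odot> \<Psi> i) A"
        using assms P a by (intro inner_eqI)
          (auto intro!: M.finsum_closed simp: Pi_def sum_distrib_left mult.assoc)
      then show ?thesis by (intro CollectI exI[of _ "\<lambda>i. c * a i"]) auto
    qed
  qed
  moreover have "\<Psi> ` A \<subseteq> ?R"
  proof clarify
    fix j assume j: "j \<in> A"
    have "\<Psi> j = finsum V (\<lambda>i. (if i = j then 1 else 0) \<odot> \<Psi> i) A"
      using assms P j
      by (intro inner_eqI) (auto intro!: M.finsum_closed simp: Pi_def if_distrib[of "\<lambda>x. x * _"] cong: if_cong)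
    then show "\<exists>c. \<Psi> j = finsum V (\<lambda>i. c i \<odot> \<Psi> i) A \<and> True"
      by (intro exI[of _ "\<lambda>i. if i = j then 1 else 0"]) auto
  qed
  ultimately show "lin_span V (\<Psi> ` A) \<subseteq> ?R"
    by (rule lin_span_minimal)
  have sub: "\<Psi> ` A \<subseteq> carrier V" using P by auto
  show "?R \<subseteq> lin_span V (\<Psi> ` A)"
    using subspace_smult[OF subspace_lin_span[OF sub]] lin_span_superset[OF sub]
    by (auto intro!: subspace_finsum subspace_lin_span sub)
qed

section \<open>Finite-dimensional subspaces\<close>

text \<open>
  Induction on the family.  The dual vectors of the old members give the orthogonal projection \<open>p\<close>
  of the new member on their span; the remainder \<open>r\<close> is nonzero by independence and orthogonal
  to the old members.  Rescaled, \<open>r\<close> is dual to the new member, and it corrects the old dual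
  vectors.
\<close>

lemma dual_family:
  assumes "finite A" "\<Psi> \<in> A \<rightarrow> carrier V" "lin_independent V A \<Psi>"
  shows "\<exists>d. d \<in> A \<rightarrow> lin_span V (\<Psi> ` A)
    \<and> (\<forall>i\<in>A. \<forall>j\<in>A. inner_prod V (\<Psi> i) (d j) = (if i = j then 1 else 0))"
  using assms
proof (induction A rule: finite_induct)
  case empty
  then show ?case by auto
next
  case (insert a A)
  have P: "\<Psi> i \<in> carrier V" if "i \<in> insert a A" for i
    using that insert by auto
  have ind: "lin_independent V A \<Psi>"
    using insert.prems(2) unfolding lin_independent_def by (meson subset_insertI subset_trans)
  obtain d where d: "d \<in> A \<rightarrow> lin_span V (\<Psi> ` A)"
    and dual: "\<And>i j. i \<in> A \<Longrightarrow> j \<in> A \<Longrightarrow> inner_prod V (\<Psi> i) (d j) = (if i = j then 1 else 0)"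
    using insert.IH ind insert.prems(1) by auto
  have sub: "\<Psi> ` A \<subseteq> carrier V" "\<Psi> ` insert a A \<subseteq> carrier V" using P by auto
  note W = subspace_lin_span[OF sub(1)] and W' = subspace_lin_span[OF sub(2)]
  have mono: "lin_span V (\<Psi> ` A) \<subseteq> lin_span V (\<Psi> ` insert a A)"
    using lin_span_superset[OF sub(2)] by (intro lin_span_minimal W') auto
  have dc: "d i \<in> carrier V" if "i \<in> A" for i
    using d that subspace_subset[OF W] by auto
  define p where "p = finsum V (\<lambda>i. inner_prod V (\<Psi> a) (\<Psi> i) \<odot> d i) A"
  define r where "r = \<Psi> a \<ominus> p"
  have pW: "p \<in> lin_span V (\<Psi> ` A)"
    unfolding p_def using d by (intro subspace_finsum W) (auto intro!: subspace_smult W)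
  then have pc: "p \<in> carrier V" using subspace_subset[OF W] by auto
  have rc: "r \<in> carrier V" using P pc by (simp add: r_def)
  have rorth: "inner_prod V (\<Psi> j) r = 0" if j: "j \<in> A" for j
  proof -
    have "inner_prod V p (\<Psi> j) = (\<Sum>i\<in>A. inner_prod V (\<Psi> a) (\<Psi> i) * inner_prod V (d i) (\<Psi> j))"
      using dc P j insert.hyps by (simp add: p_def Pi_def)
    also have "\<dots> = (\<Sum>i\<in>A. if i = j then inner_prod V (\<Psi> a) (\<Psi> i) else 0)"
    proof (rule sum.cong)
      fix i assume i: "i \<in> A"
      have "inner_prod V (d i) (\<Psi> j) = cnj (inner_prod V (\<Psi> j) (d i))"
        using dc P i j by (intro inner_commute) auto
      then show "inner_prod V (\<Psi> a) (\<Psi> i) * inner_prod V (d i) (\<Psi> j)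
          = (if i = j then inner_prod V (\<Psi> a) (\<Psi> i) else 0)"
        using dual i j by auto
    qed simp
    also have "\<dots> = inner_prod V (\<Psi> a) (\<Psi> j)"
      using j insert.hyps by simp
    finally have "inner_prod V r (\<Psi> j) = 0"
      using P pc j by (simp add: r_def)
    then show ?thesis using inner_commute[of r "\<Psi> j"] rc P j by simp
  qed
  have rspan: "inner_prod V y r = 0" if y: "y \<in> lin_span V (\<Psi> ` A)" for y
  proof -
    obtain c where "y = finsum V (\<lambda>i. c i \<odot> \<Psi> i) A"
      using y lin_span_image_eq[of A \<Psi>] insert P by auto
    then show ?thesis
      using rorth P rc insert.hyps by (simp add: Pi_def)
  qed
  have r0: "inner_prod V r r \<noteq> 0"
  proof
    assume "inner_prod V r r = 0"
    then have "r = \<zero>" using inner_definite rc by auto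
    then have "\<Psi> a = p" using P pc by (simp add: r_def)
    then obtain c where c: "\<Psi> a = finsum V (\<lambda>i. c i \<odot> \<Psi> i) A"
      using pW lin_span_image_eq[of A \<Psi>] insert P by auto
    define c' where "c' i = (if i = a then -1 else c i)" for i
    have "finsum V (\<lambda>i. c' i \<odot> \<Psi> i) (insert a A) = \<zero>"
    proof (rule inner_eqI)
      fix z assume z: "z \<in> carrier V"
      have "inner_prod V (finsum V (\<lambda>i. c' i \<odot> \<Psi> i) (insert a A)) z
        = - inner_prod V (\<Psi> a) z + (\<Sum>i\<in>A. c' i * inner_prod V (\<Psi> i) z)"
        using z P insert.hyps by (simp add: Pi_def c'_def)
      also have "(\<Sum>i\<in>A. c' i * inner_prod V (\<Psi> i) z) = (\<Sum>i\<in>A. c i * inner_prod V (\<Psi> i) z)"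
        using insert.hyps by (intro sum.cong) (auto simp: c'_def)
      also have "\<dots> = inner_prod V (\<Psi> a) z"
        unfolding c using z P insert.hyps by (simp add: Pi_def)
      finally show "inner_prod V (finsum V (\<lambda>i. c' i \<odot> \<Psi> i) (insert a A)) z = inner_prod V \<zero> z"
        using z by simp
    qed (use P in \<open>auto intro!: M.finsum_closed\<close>)
    then have "c' a = 0"
      using insert.prems(2) insert.hyps unfolding lin_independent_def by blast
    then show False by (simp add: c'_def)
  qed
  have Par: "inner_prod V (\<Psi> a) r = inner_prod V r r"
  proof -
    have "\<Psi> a = r \<oplus> p" using P pc by (intro inner_eqI) (auto simp: r_def)
    then show ?thesis using rspan[OF pW] rc pc by simp
  qed
  \<comment> \<open>the pairing of the new member with \<open>r\<close> is the square norm of \<open>r\<close>, which \<open>e\<close> normalizes to 1\<close>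
  define e where "e = (1 / cnj (inner_prod V r r)) \<odot> r"
  define d' where "d' j = (if j = a then e else d j \<ominus> cnj (inner_prod V (\<Psi> a) (d j)) \<odot> e)" for j
  have rW: "r \<in> lin_span V (\<Psi> ` insert a A)"
    unfolding r_def using lin_span_superset[OF sub(2)] mono pW by (intro subspace_minus W') auto
  have eW: "e \<in> lin_span V (\<Psi> ` insert a A)" and ec: "e \<in> carrier V"
    unfolding e_def using rW rc subspace_smult[OF W'] by auto
  have "d' \<in> insert a A \<rightarrow> lin_span V (\<Psi> ` insert a A)"
  proof
    fix j assume "j \<in> insert a A"
    then show "d' j \<in> lin_span V (\<Psi> ` insert a A)"
      using eW d mono subspace_minus[OF W'] subspace_smult[OF W'] by (auto simp: d'_def Pi_iff subset_iff)
  qed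
  moreover have "inner_prod V (\<Psi> i) (d' j) = (if i = j then 1 else 0)"
    if "i \<in> insert a A" "j \<in> insert a A" for i j
  proof -
    have e: "inner_prod V (\<Psi> i) e = (if i = a then 1 else 0)"
      using that rc P r0 Par rorth insert.hyps by (auto simp: e_def)
    show ?thesis
      using that e dual P ec dc insert.hyps by (auto simp: d'_def)
  qed
  ultimately show ?case by blast
qed

lemma dual_expansion:
  assumes "finite A" "\<Psi> \<in> A \<rightarrow> carrier V" "d \<in> A \<rightarrow> carrier V"
    and "\<And>i j. i \<in> A \<Longrightarrow> j \<in> A \<Longrightarrow> inner_prod V (\<Psi> i) (d j) = (if i = j then 1 else 0)"
    and "x \<in> lin_span V (\<Psi> ` A)"
  shows "x = finsum V (\<lambda>i. inner_prod V x (d i) \<odot> \<Psi> i) A"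
proof -
  obtain c where c: "x = finsum V (\<lambda>i. c i \<odot> \<Psi> i) A"
    using assms lin_span_image_eq[of A \<Psi>] by auto
  have "inner_prod V x (d j) = c j" if "j \<in> A" for j
    using that assms(1-4) by (simp add: c Pi_iff if_distrib[of "\<lambda>x. _ * x"] cong: if_cong)
  then show ?thesis
    using assms(1-3) unfolding c by (intro M.finsum_cong') (auto intro!: M.finsum_closed simp: Pi_iff)
qed

text \<open>
  The coordinates \<open>\<langle>x, d\<^sub>i\<rangle>\<close> depend continuously on \<open>x\<close>, so the projection \<open>p\<close> that they define is
  bounded.  It is the identity on the span, hence also on the closure of the span.
\<close>

lemma closed_span_eq_lin_span:
  assumes "finite A" "\<Psi> \<in> A \<rightarrow> carrier V" "lin_independent V A \<Psi>"
    and S: "lin_span V S = lin_span V (\<Psi> ` A)"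
  shows "closed_span V S = lin_span V S"
proof -
  interpret MS: Metric_space "carrier V" "dist_of V" by (rule Metric_space_dist_of)
  obtain d where d: "d \<in> A \<rightarrow> lin_span V (\<Psi> ` A)"
    and dual: "\<And>i j. i \<in> A \<Longrightarrow> j \<in> A \<Longrightarrow> inner_prod V (\<Psi> i) (d j) = (if i = j then 1 else 0)"
    using dual_family[OF assms(1-3)] by blast
  have sub: "\<Psi> ` A \<subseteq> carrier V" using assms by auto
  note W = subspace_lin_span[OF sub]
  have P: "\<Psi> i \<in> carrier V" "d i \<in> carrier V" if "i \<in> A" for i
    using that d assms subspace_subset[OF W] by auto
  define p where "p x = finsum V (\<lambda>i. inner_prod V x (d i) \<odot> \<Psi> i) A" for x
  have pc: "p x \<in> carrier V" if "x \<in> carrier V" for x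
    using that P unfolding p_def by (intro M.finsum_closed) auto
  have pW: "p x \<in> lin_span V (\<Psi> ` A)" if "x \<in> carrier V" for x
    unfolding p_def using that lin_span_superset[OF sub]
    by (intro subspace_finsum W) (auto intro!: subspace_smult W)
  have pid: "p x = x" if "x \<in> lin_span V (\<Psi> ` A)" for x
    unfolding p_def
    by (rule dual_expansion[OF assms(1,2) _ dual that, symmetric]) (use P in auto)
  define K where "K = (\<Sum>i\<in>A. norm_of V (d i) * norm_of V (\<Psi> i))"
  have K: "norm_of V (p x) \<le> K * norm_of V x" if x: "x \<in> carrier V" for x
  proof -
    have "norm_of V (p x) \<le> (\<Sum>i\<in>A. norm_of V (inner_prod V x (d i) \<odot> \<Psi> i))"
      unfolding p_def using assms P by (intro norm_of_finsum) auto
    also have "\<dots> = (\<Sum>i\<in>A. cmod (inner_prod V x (d i)) * norm_of V (\<Psi> i))"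
      using P by (intro sum.cong) (auto simp: norm_of_smult)
    also have "\<dots> \<le> (\<Sum>i\<in>A. (norm_of V x * norm_of V (d i)) * norm_of V (\<Psi> i))"
      using P x Cauchy_Schwarz by (intro sum_mono mult_right_mono) auto
    finally show ?thesis by (simp add: K_def sum_distrib_left mult_ac)
  qed
  have "x \<in> lin_span V S" if x: "x \<in> closed_span V S" for x
  proof -
    have xc: "x \<in> carrier V" and near: "\<And>e. 0 < e \<Longrightarrow> \<exists>y\<in>lin_span V S. y \<in> MS.mball x e"
      using x unfolding closed_span_def MS.metric_closure_of by auto
    have K0: "0 \<le> K" unfolding K_def using P by (intro sum_nonneg) auto
    have "norm_of V (x \<ominus> p x) \<le> 0 + e" if e: "0 < e" for e
    proof -
      obtain y where y: "y \<in> lin_span V S" "y \<in> MS.mball x (e / (1 + K))"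
        using near[of "e / (1 + K)"] e K0 by auto
      then have yc: "y \<in> carrier V" and xy: "norm_of V (x \<ominus> y) < e / (1 + K)"
        using xc by (auto simp: dist_of_def)
      have "x \<ominus> p x = (x \<ominus> y) \<oplus> p (y \<ominus> x)"
      proof (rule inner_eqI)
        fix z assume z: "z \<in> carrier V"
        have "inner_prod V (p (y \<ominus> x)) z = inner_prod V (p y) z - inner_prod V (p x) z"
          unfolding p_def using xc yc z P assms(1)
          by (simp add: Pi_iff sum_subtractf left_diff_distrib)
        then show "inner_prod V (x \<ominus> p x) z = inner_prod V ((x \<ominus> y) \<oplus> p (y \<ominus> x)) z"
          using xc yc z pc pid[of y] y S by simp
      qed (use xc yc pc in auto)
      then have "norm_of V (x \<ominus> p x) \<le> norm_of V (x \<ominus> y) + norm_of V (p (y \<ominus> x))"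
        using norm_of_triangle[of "x \<ominus> y" "p (y \<ominus> x)"] xc yc pc by simp
      also have "\<dots> \<le> norm_of V (x \<ominus> y) + K * norm_of V (x \<ominus> y)"
        using K[of "y \<ominus> x"] xc yc norm_of_minus_commute[of x y] by simp
      also have "\<dots> = (1 + K) * norm_of V (x \<ominus> y)" by (simp add: algebra_simps)
      also have "\<dots> \<le> (1 + K) * (e / (1 + K))"
        using xy K0 by (intro mult_left_mono) auto
      finally show ?thesis using K0 by (simp add: add_nonneg_eq_0_iff)
    qed
    then have "norm_of V (x \<ominus> p x) \<le> 0" by (rule field_le_epsilon)
    then have "norm_of V (x \<ominus> p x) = 0"
      using xc pc norm_of_nonneg[of "x \<ominus> p x"] by (intro antisym) auto
    then have "x = p x" using xc pc by simp
    then show ?thesis using pW[OF xc] S by simp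
  qed
  moreover have "lin_span V S \<subseteq> closed_span V S"
    unfolding closed_span_def using S subspace_subset[OF W]
    by (intro closure_of_subset) auto
  ultimately show ?thesis by blast
qed

text \<open>
  By the Cauchy--Schwarz inequality the coordinates of a Cauchy sequence with respect to a dual
  family are Cauchy sequences of complex numbers.
\<close>

lemma complete_finite_dimensional:
  assumes "finite A" "\<Psi> \<in> A \<rightarrow> carrier V" "lin_independent V A \<Psi>"
    and car: "carrier V = lin_span V (\<Psi> ` A)"
  shows "complex_hilbert_space V"
proof
  interpret MS: Metric_space "carrier V" "dist_of V" by (rule Metric_space_dist_of)
  obtain d where "d \<in> A \<rightarrow> lin_span V (\<Psi> ` A)"
    and dual: "\<And>i j. i \<in> A \<Longrightarrow> j \<in> A \<Longrightarrow> inner_prod V (\<Psi> i) (d j) = (if i = j then 1 else 0)"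
    using dual_family[OF assms(1-3)] by blast
  then have P: "\<Psi> i \<in> carrier V" "d i \<in> carrier V" if "i \<in> A" for i
    using that assms by auto
  show "MS.mcomplete"
    unfolding MS.mcomplete_def
  proof (intro allI impI)
    fix \<sigma> :: "nat \<Rightarrow> 'a" assume cau: "MS.MCauchy \<sigma>"
    then have sc: "\<sigma> n \<in> carrier V" for n
      by (auto simp: MS.MCauchy_def)
    have "\<exists>c. (\<lambda>n. inner_prod V (\<sigma> n) (d i)) \<longlonglongrightarrow> c" if i: "i \<in> A" for i
    proof -
      have "Cauchy (\<lambda>n. inner_prod V (\<sigma> n) (d i))"
      proof (rule metric_CauchyI)
        fix e :: real assume e: "0 < e"
        have n1: "0 < 1 + norm_of V (d i)" using P(2)[OF i] norm_of_nonneg[of "d i"] by (simp add: add_pos_nonneg)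
        then obtain N where N: "\<And>m n. N \<le> m \<Longrightarrow> N \<le> n \<Longrightarrow>
            dist_of V (\<sigma> m) (\<sigma> n) < e / (1 + norm_of V (d i))"
          using cau e unfolding MS.MCauchy_def by (metis divide_pos_pos)
        have "dist (inner_prod V (\<sigma> m) (d i)) (inner_prod V (\<sigma> n) (d i)) < e"
          if "N \<le> m" "N \<le> n" for m n
        proof -
          have "dist (inner_prod V (\<sigma> m) (d i)) (inner_prod V (\<sigma> n) (d i))
              = cmod (inner_prod V (\<sigma> m \<ominus> \<sigma> n) (d i))"
            using sc P i by (simp add: dist_norm)
          also have "\<dots> \<le> norm_of V (\<sigma> m \<ominus> \<sigma> n) * norm_of V (d i)"
            using sc P i by (intro Cauchy_Schwarz) auto
          also have "\<dots> \<le> norm_of V (\<sigma> m \<ominus> \<sigma> n) * (1 + norm_of V (d i))"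
            using sc by (intro mult_left_mono) auto
          also have "\<dots> < e / (1 + norm_of V (d i)) * (1 + norm_of V (d i))"
            using N[OF that] sc n1 by (intro mult_strict_right_mono) (auto simp: dist_of_def)
          finally show ?thesis using n1 by simp
        qed
        then show "\<exists>N. \<forall>m\<ge>N. \<forall>n\<ge>N. dist (inner_prod V (\<sigma> m) (d i)) (inner_prod V (\<sigma> n) (d i)) < e"
          by blast
      qed
      then show ?thesis by (simp add: Cauchy_convergent_iff convergent_def)
    qed
    then obtain c where c: "\<And>i. i \<in> A \<Longrightarrow> (\<lambda>n. inner_prod V (\<sigma> n) (d i)) \<longlonglongrightarrow> c i"
      by metis
    define x where "x = finsum V (\<lambda>i. c i \<odot> \<Psi> i) A"
    have xc: "x \<in> carrier V" unfolding x_def using P by (intro M.finsum_closed) auto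
    define \<rho> where "\<rho> n = (\<Sum>i\<in>A. cmod (inner_prod V (\<sigma> n) (d i) - c i) * norm_of V (\<Psi> i))" for n
    have le: "dist_of V (\<sigma> n) x \<le> \<rho> n" for n
    proof -
      define a where "a i = inner_prod V (\<sigma> n) (d i)" for i
      have eq: "\<sigma> n = finsum V (\<lambda>i. a i \<odot> \<Psi> i) A"
        unfolding a_def by (rule dual_expansion[OF assms(1,2) _ dual]) (use P sc car in auto)
      have "\<sigma> n \<ominus> x = finsum V (\<lambda>i. (a i - c i) \<odot> \<Psi> i) A"
        using xc P assms(1) unfolding eq x_def
        by (intro inner_eqI)
          (auto intro!: M.finsum_closed simp: Pi_iff sum_subtractf left_diff_distrib)
      then have "norm_of V (\<sigma> n \<ominus> x) \<le> (\<Sum>i\<in>A. norm_of V ((a i - c i) \<odot> \<Psi> i))"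
        using assms(1) P by (simp add: norm_of_finsum Pi_iff)
      also have "\<dots> = \<rho> n"
        unfolding \<rho>_def using P by (intro sum.cong) (auto simp: norm_of_smult a_def)
      finally show ?thesis using sc xc by (simp add: dist_of_def)
    qed
    have "\<rho> \<longlonglongrightarrow> (\<Sum>i\<in>A. cmod (c i - c i) * norm_of V (\<Psi> i))"
      unfolding \<rho>_def by (intro tendsto_intros c)
    then have "\<rho> \<longlonglongrightarrow> 0" by simp
    then have "(\<lambda>n. dist_of V (\<sigma> n) x) \<longlonglongrightarrow> 0"
      by (rule Lim_null_comparison[rotated]) (use le MS.nonneg in auto)
    then have "limitin MS.mtopology \<sigma> x sequentially"
      using sc xc by (simp add: MS.limitin_metric_dist_null)
    then show "\<exists>x. limitin MS.mtopology \<sigma> x sequentially" by blast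
  qed
qed

lemma module_subspace:
  "submodule W complex_field V \<Longrightarrow> module complex_field (V\<lparr>carrier := W\<rparr>)"
  by (erule submodule.submodule_is_module) unfold_locales

lemma finsum_subspace_eq:
  assumes W: "submodule W complex_field V" and f: "f \<in> A \<rightarrow> W"
  shows "finsum (V\<lparr>carrier := W\<rparr>) f A = finsum V f A"
proof (cases "finite A")
  case True
  interpret W: module complex_field "V\<lparr>carrier := W\<rparr>" by (rule module_subspace[OF W])
  from True f show ?thesis
  proof (induction A rule: finite_induct)
    case empty
    then show ?case by (simp add: W.M.finsum_empty[simplified])
  next
    case (insert a A)
    then show ?case
      using subspace_subset[OF W] W.M.finsum_insert[of A a f] M.finsum_insert[of A a f]
      by (auto simp: Pi_iff subset_iff)
  qed
qed (simp add: finsum_def finprod_def)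

lemma complex_inner_space_subspace:
  assumes W: "submodule W complex_field V"
  shows "complex_inner_space (V\<lparr>carrier := W\<rparr>)"
proof -
  interpret W: module complex_field "V\<lparr>carrier := W\<rparr>" by (rule module_subspace[OF W])
  show ?thesis
  proof
    show "inner_prod (V\<lparr>carrier := W\<rparr>) y x = cnj (inner_prod (V\<lparr>carrier := W\<rparr>) x y)"
      if "x \<in> carrier (V\<lparr>carrier := W\<rparr>)" "y \<in> carrier (V\<lparr>carrier := W\<rparr>)" for x y
      using that subspace_subset[OF W] by (auto intro!: inner_commute)
  qed (use subspace_subset[OF W] inner_ge_zero inner_definite in \<open>auto simp: subset_iff\<close>)
qed

lemma lin_span_subspace_eq:
  assumes W: "submodule W complex_field V" and S: "S \<subseteq> W"
  shows "lin_span (V\<lparr>carrier := W\<rparr>) S = lin_span V S"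
proof -
  have "finsum (V\<lparr>carrier := W\<rparr>) (\<lambda>x. c x \<odot> x) A = finsum V (\<lambda>x. c x \<odot> x) A" if "A \<subseteq> S" for c A
    using that S subspace_smult[OF W] by (intro finsum_subspace_eq W) auto
  then show ?thesis unfolding lin_span_def by (intro Collect_cong iff_exI) auto
qed

lemma lin_independent_subspace_eq:
  assumes W: "submodule W complex_field V" and S: "\<Psi> ` I \<subseteq> W"
  shows "lin_independent (V\<lparr>carrier := W\<rparr>) I \<Psi> \<longleftrightarrow> lin_independent V I \<Psi>"
proof -
  have "finsum (V\<lparr>carrier := W\<rparr>) (\<lambda>x. c x \<odot> \<Psi> x) A = finsum V (\<lambda>x. c x \<odot> \<Psi> x) A" if "A \<subseteq> I" for c A
    using that S subspace_smult[OF W] by (intro finsum_subspace_eq W) auto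
  then have "(finite A \<and> A \<subseteq> I \<and> finsum (V\<lparr>carrier := W\<rparr>) (\<lambda>x. c x \<odot> \<Psi> x) A = \<zero>) \<longleftrightarrow>
      (finite A \<and> A \<subseteq> I \<and> finsum V (\<lambda>x. c x \<odot> \<Psi> x) A = \<zero>)" for A c
    by auto
  then show ?thesis unfolding lin_independent_def by simp
qed

end

text \<open>
  The auxiliary Hilbert space is \<open>V\<close> itself with the inner product that makes \<open>\<Psi>\<close> orthonormal, and
  the isomorphism is the identity; \<open>dual_family\<close> makes the two norms comparable.
\<close>

lemma riesz_basis_finite_dimensional:
  fixes V :: "'a inner_module"
  assumes "complex_inner_space V" and fin: "finite I" and P: "\<Psi> \<in> I \<rightarrow> carrier V"
    and ind: "lin_independent V I \<Psi>" and car: "carrier V = lin_span V (\<Psi> ` I)"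
  shows "riesz_basis V I \<Psi>"
proof -
  interpret complex_inner_space V by fact
  obtain d where d: "d \<in> I \<rightarrow> lin_span V (\<Psi> ` I)"
    and dual: "\<And>i j. i \<in> I \<Longrightarrow> j \<in> I \<Longrightarrow> inner_prod V (\<Psi> i) (d j) = (if i = j then 1 else 0)"
    using dual_family[OF fin P ind] by blast
  have Pc: "\<Psi> i \<in> carrier V" "d i \<in> carrier V" if "i \<in> I" for i
    using that d P car by auto
  define b where "b x y = (\<Sum>i\<in>I. inner_prod V x (d i) * cnj (inner_prod V y (d i)))" for x y
  define Vt where "Vt = V\<lparr>inner_prod := b\<rparr>"
  have Vt [simp]: "carrier Vt = carrier V" "add Vt = add V" "zero Vt = zero V" "smult Vt = smult V"
      "inner_prod Vt = b"
    by (simp_all add: Vt_def)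
  have am: "add_monoid Vt = add_monoid V" by (simp add: Vt_def)
  have finsum [simp]: "finsum Vt = finsum V" unfolding finsum_def am ..
  have span: "lin_span Vt = lin_span V" by (simp add: lin_span_def fun_eq_iff)
  have bself: "b x x = of_real (\<Sum>i\<in>I. (cmod (inner_prod V x (d i)))\<^sup>2)" for x
    unfolding b_def of_real_sum complex_norm_square ..
  have norm_t: "norm_of Vt x = L2_set (\<lambda>i. cmod (inner_prod V x (d i))) I" for x
    by (simp add: norm_of_def L2_set_def bself)
  have zero: "x = zero V" if "x \<in> carrier V" "b x x = 0" for x
  proof -
    define a where "a i = inner_prod V x (d i)" for i
    have a0: "a i = 0" if "i \<in> I" for i
      using \<open>b x x = 0\<close> fin that unfolding bself of_real_eq_0_iff a_def
      by (subst (asm) sum_nonneg_eq_0_iff) auto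
    have "x = finsum V (\<lambda>i. a i \<odot>\<^bsub>V\<^esub> \<Psi> i) I"
      unfolding a_def using \<open>x \<in> carrier V\<close> Pc car by (intro dual_expansion[OF fin P _ dual]) auto
    also have "\<dots> = finsum V (\<lambda>i. 0 \<odot>\<^bsub>V\<^esub> \<Psi> i) I"
      using Pc a0 by (intro M.finsum_cong') (auto simp: Pi_iff)
    also have "\<dots> = zero V"
      using Pc fin by (intro inner_eqI) (auto intro!: M.finsum_closed simp: Pi_iff)
    finally show ?thesis .
  qed
  have "module complex_field Vt"
  proof (rule moduleI)
    show "abelian_group Vt"
      by (rule abelian_groupI) (auto simp: M.a_ac intro: M.l_neg)
  qed (auto simp: smult_l_distr[simplified] smult_r_distr[simplified] smult_assoc1[simplified] intro: cring_from_type_algebra)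
  then interpret Vt: module complex_field Vt .
  interpret Vt: complex_inner_space Vt
  proof
    show "inner_prod Vt (x \<oplus>\<^bsub>Vt\<^esub> y) z = inner_prod Vt x z + inner_prod Vt y z"
      if "x \<in> carrier Vt" "y \<in> carrier Vt" "z \<in> carrier Vt" for x y z
      using that Pc by (simp add: b_def distrib_right sum.distrib)
    show "inner_prod Vt (c \<odot>\<^bsub>Vt\<^esub> x) y = c * inner_prod Vt x y"
      if "x \<in> carrier Vt" "y \<in> carrier Vt" for c x y
      using that Pc by (simp add: b_def sum_distrib_left mult.assoc)
    show "inner_prod Vt y x = cnj (inner_prod Vt x y)" for x y
      by (simp add: b_def mult.commute)
    show "0 \<le> Re (inner_prod Vt x x)" for x
      by (simp add: bself sum_nonneg)
    show "x = zero Vt" if "x \<in> carrier Vt" "inner_prod Vt x x = 0" for x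
      using zero that by simp
  qed
  have ind_t: "lin_independent Vt I \<Psi>"
    using ind by (simp add: lin_independent_def)
  have P_t: "\<Psi> \<in> I \<rightarrow> carrier Vt" using P by simp
  have hilbert_t: "complex_hilbert_space Vt"
    using car by (intro Vt.complete_finite_dimensional[OF fin P_t ind_t]) (simp add: span)
  have "orthonormal_basis Vt I \<Psi>"
    unfolding orthonormal_basis_def
  proof (intro conjI ballI)
    show "\<Psi> ` I \<subseteq> carrier Vt" using Pc by auto
    show "inner_prod Vt (\<Psi> i) (\<Psi> j) = (if i = j then 1 else 0)" if "i \<in> I" "j \<in> I" for i j
    proof -
      have "b (\<Psi> i) (\<Psi> j) = (\<Sum>k\<in>I. if k = i then (if i = j then 1 else 0) else 0)"
        unfolding b_def using that dual by (intro sum.cong) auto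
      then show ?thesis using that fin by simp
    qed
    show "closed_span Vt (\<Psi> ` I) = carrier Vt"
      using Vt.closed_span_eq_lin_span[OF fin P_t ind_t refl] car by (simp add: span)
  qed
  moreover have "hilbert_isomorphism Vt V id"
    unfolding hilbert_isomorphism_def
  proof (intro conjI)
    show "\<exists>C. \<forall>x\<in>carrier Vt. norm_of V (id x) \<le> C * norm_of Vt x"
    proof (intro exI ballI)
      fix x assume "x \<in> carrier Vt"
      then have x: "x \<in> carrier V" by simp
      define a where "a i = inner_prod V x (d i)" for i
      have "x = finsum V (\<lambda>i. a i \<odot>\<^bsub>V\<^esub> \<Psi> i) I"
        unfolding a_def using x Pc car by (intro dual_expansion[OF fin P _ dual]) auto
      then have "norm_of V x \<le> (\<Sum>i\<in>I. norm_of V (a i \<odot>\<^bsub>V\<^esub> \<Psi> i))"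
        using norm_of_finsum[of I "\<lambda>i. a i \<odot>\<^bsub>V\<^esub> \<Psi> i"] fin Pc by auto
      also have "\<dots> = (\<Sum>i\<in>I. norm_of V (\<Psi> i) * cmod (a i))"
        using Pc by (intro sum.cong) (auto simp: norm_of_smult)
      also have "\<dots> \<le> (\<Sum>i\<in>I. norm_of V (\<Psi> i) * norm_of Vt x)"
        unfolding norm_t a_def using Pc fin
        by (intro sum_mono mult_left_mono member_le_L2_set[where f="\<lambda>i. cmod (inner_prod V x (d i))"]) auto
      finally show "norm_of V (id x) \<le> (\<Sum>i\<in>I. norm_of V (\<Psi> i)) * norm_of Vt x"
        by (simp add: sum_distrib_right)
    qed
    show "\<exists>C. \<forall>x\<in>carrier Vt. norm_of Vt x \<le> C * norm_of V (id x)"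
    proof (intro exI ballI)
      fix x assume "x \<in> carrier Vt"
      then have x: "x \<in> carrier V" by simp
      have "norm_of Vt x \<le> (\<Sum>i\<in>I. cmod (inner_prod V x (d i)))"
        unfolding norm_t by (rule L2_set_le_sum) auto
      also have "\<dots> \<le> (\<Sum>i\<in>I. norm_of V x * norm_of V (d i))"
        using Pc x by (intro sum_mono Cauchy_Schwarz) auto
      finally show "norm_of Vt x \<le> (\<Sum>i\<in>I. norm_of V (d i)) * norm_of V (id x)"
        by (simp add: sum_distrib_left mult.commute)
    qed
  qed auto
  moreover have "complex_hilbert_space V"
    by (rule complete_finite_dimensional[OF fin P ind car])
  ultimately show ?thesis
    unfolding riesz_basis_def using hilbert_t fin by (auto simp: countable_finite intro!: exI[of _ Vt] exI[of _ \<Psi>] exI[of _ id])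
qed

section \<open>Root subspaces\<close>

locale unbounded_operator = complex_inner_space +
  fixes D :: "'a set" and T :: "'a \<Rightarrow> 'a"
  assumes domain_subspace: "submodule D complex_field V"
    and T_in: "u \<in> D \<Longrightarrow> T u \<in> carrier V"
    and T_add: "u \<in> D \<Longrightarrow> v \<in> D \<Longrightarrow> T (u \<oplus> v) = T u \<oplus> T v"
    and T_smult: "u \<in> D \<Longrightarrow> T (c \<odot> u) = c \<odot> T u"
begin

definition shift :: "complex \<Rightarrow> 'a \<Rightarrow> 'a" where
  "shift \<mu> u = T u \<ominus> \<mu> \<odot> u"

lemma D_in: "u \<in> D \<Longrightarrow> u \<in> carrier V"
  using subspace_subset[OF domain_subspace] by auto

lemma shift_in: "u \<in> D \<Longrightarrow> shift \<mu> u \<in> carrier V"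
  by (simp add: shift_def T_in D_in)

lemma shift_add: "u \<in> D \<Longrightarrow> v \<in> D \<Longrightarrow> shift \<mu> (u \<oplus> v) = shift \<mu> u \<oplus> shift \<mu> v"
  by (intro inner_eqI) (auto simp: shift_def T_in D_in T_add algebra_simps)

lemma shift_smult: "u \<in> D \<Longrightarrow> shift \<mu> (c \<odot> u) = c \<odot> shift \<mu> u"
  by (intro inner_eqI) (auto simp: shift_def T_in D_in T_smult algebra_simps)

lemma shift_change: "u \<in> D \<Longrightarrow> shift \<nu> u = shift \<mu> u \<oplus> (\<mu> - \<nu>) \<odot> u"
  by (intro inner_eqI) (auto simp: shift_def T_in D_in algebra_simps)

lemma shift_zero: "shift \<mu> \<zero> = \<zero>"
proof (rule inner_eqI)
  have 0: "\<zero> \<in> D" by (rule subspace_0[OF domain_subspace])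
  fix z assume z: "z \<in> carrier V"
  have "shift \<mu> (0 \<odot> \<zero>) = 0 \<odot> shift \<mu> \<zero>" by (rule shift_smult[OF 0])
  moreover have "0 \<odot> \<zero> = \<zero>" by (intro inner_eqI) auto
  ultimately have "inner_prod V (shift \<mu> \<zero>) z = inner_prod V (0 \<odot> shift \<mu> \<zero>) z" by simp
  then show "inner_prod V (shift \<mu> \<zero>) z = inner_prod V \<zero> z"
    using z shift_in[OF 0] by simp
qed (use shift_in subspace_0[OF domain_subspace] in auto)

abbreviation ker where "ker \<equiv> ker_power V D T"

lemma ker_Suc: "ker \<mu> (Suc k) = {u \<in> D. shift \<mu> u \<in> ker \<mu> k}"
  by (simp add: shift_def)

declare ker_power.simps(2) [simp del]

lemma ker_subset: "ker \<mu> k \<subseteq> D"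
  by (cases k) (auto simp: ker_Suc subspace_0[OF domain_subspace])

lemma subspace_ker: "submodule (ker \<mu> k) complex_field V"
proof (induction k)
  case 0
  then show ?case by (intro subspaceI) (auto intro!: inner_eqI)
next
  case (Suc k)
  show ?case
    using D_in domain_subspace Suc unfolding ker_Suc
    by (intro subspaceI)
      (auto simp: shift_zero shift_add shift_smult subspace_0 subspace_add subspace_smult)
qed

lemma ker_mono_Suc: "ker \<mu> k \<subseteq> ker \<mu> (Suc k)"
proof (induction k)
  case 0
  then show ?case by (auto simp: ker_Suc shift_zero subspace_0[OF domain_subspace])
next
  case (Suc k)
  then show ?case by (auto simp: ker_Suc)
qed

lemma ker_mono: "k \<le> l \<Longrightarrow> ker \<mu> k \<subseteq> ker \<mu> l"
  by (rule lift_Suc_mono_le[of "ker \<mu>"]) (rule ker_mono_Suc)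

lemma shift_ker:
  assumes "u \<in> ker \<mu> k" shows "shift \<nu> u \<in> ker \<mu> k"
proof -
  have u: "u \<in> D" using assms ker_subset by auto
  have "u \<in> ker \<mu> (Suc k)" using assms ker_mono_Suc by auto
  then have "shift \<mu> u \<in> ker \<mu> k" by (simp add: ker_Suc)
  then show ?thesis
    unfolding shift_change[OF u, of \<nu> \<mu>] using assms subspace_ker
    by (auto intro!: subspace_add subspace_smult)
qed

text \<open>
  On the kernel of a power of \<open>T - \<mu>\<close> this operator is nilpotent, so \<open>T - \<nu>\<close>, which differs from it by
  a nonzero scalar, is injective there.
\<close>

lemma shift_eq_zero:
  assumes "u \<in> ker \<mu> k" "shift \<nu> u = \<zero>" "\<mu> \<noteq> \<nu>"
  shows "u = \<zero>"
  using assms(1)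
proof (induction k)
  case (Suc k)
  have u: "u \<in> D" using Suc ker_subset by auto
  have "shift \<mu> u = (\<nu> - \<mu>) \<odot> u"
    using shift_change[OF u, of \<mu> \<nu>] assms(2) D_in[OF u] by simp
  then have "(\<nu> - \<mu>) \<odot> u \<in> ker \<mu> k" using Suc by (simp add: ker_Suc)
  then have "(1 / (\<nu> - \<mu>)) \<odot> ((\<nu> - \<mu>) \<odot> u) \<in> ker \<mu> k"
    by (rule subspace_smult[OF subspace_ker])
  also have "(1 / (\<nu> - \<mu>)) \<odot> ((\<nu> - \<mu>) \<odot> u) = u"
    using assms(3) D_in[OF u] by (intro inner_eqI) auto
  finally show ?case by (rule Suc.IH)
qed simp

lemma shift_funpow_ker: "u \<in> ker \<mu> k \<Longrightarrow> (shift \<nu> ^^ n) u \<in> ker \<mu> k"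
  by (induction n) (auto intro: shift_ker)

lemma shift_funpow_eq_zero:
  assumes "u \<in> ker \<mu> k" "(shift \<nu> ^^ n) u = \<zero>" "\<mu> \<noteq> \<nu>"
  shows "u = \<zero>"
  using assms(2)
proof (induction n)
  case (Suc n)
  then show ?case
    using shift_eq_zero[OF shift_funpow_ker[OF assms(1)] _ assms(3), of n] by simp
qed simp

lemma shift_funpow_self: "u \<in> ker \<mu> k \<Longrightarrow> (shift \<mu> ^^ k) u = \<zero>"
  by (induction k arbitrary: u) (auto simp: ker_Suc funpow_Suc_right simp del: funpow.simps(2))

lemma shift_finsum:
  assumes "finite A" "u \<in> A \<rightarrow> D"
  shows "shift \<mu> (finsum V u A) = finsum V (\<lambda>i. shift \<mu> (u i)) A"
  using assms
proof (induction A rule: finite_induct)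
  case empty
  then show ?case by (simp add: shift_zero)
next
  case (insert a A)
  have "finsum V u A \<in> D"
    using insert by (intro subspace_finsum domain_subspace) auto
  then show ?case
    using insert D_in shift_in by (simp add: M.finsum_insert Pi_iff shift_add)
qed

text \<open>
  A power of \<open>T - \<nu>\<close> that annihilates the component for \<open>\<nu>\<close> maps the relation to a shorter one, and
  it is injective on the other components.
\<close>

lemma root_spaces_independent:
  assumes "finite M" "\<And>\<mu>. \<mu> \<in> M \<Longrightarrow> u \<mu> \<in> root_space V D T \<mu>" "finsum V u M = \<zero>"
  shows "\<forall>\<mu>\<in>M. u \<mu> = \<zero>"
  using assms
proof (induction M arbitrary: u rule: finite_induct)
  case (insert \<nu> M)
  have uD: "u \<mu> \<in> D" if "\<mu> \<in> insert \<nu> M" for \<mu>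
    using insert.prems(1)[OF that] ker_subset by (auto simp: root_space_def)
  obtain k where k: "u \<nu> \<in> ker \<nu> k"
    using insert.prems(1)[of \<nu>] by (auto simp: root_space_def)
  have D_pow: "(shift \<nu> ^^ n) (u \<mu>) \<in> D" if "\<mu> \<in> insert \<nu> M" for \<mu> n
    using insert.prems(1)[OF that] ker_subset shift_funpow_ker
    unfolding root_space_def by blast
  have pow: "(shift \<nu> ^^ n) (finsum V u (insert \<nu> M)) = finsum V (\<lambda>\<mu>. (shift \<nu> ^^ n) (u \<mu>)) (insert \<nu> M)" for n
  proof (induction n)
    case (Suc n)
    have "(shift \<nu> ^^ Suc n) (finsum V u (insert \<nu> M))
        = shift \<nu> (finsum V (\<lambda>\<mu>. (shift \<nu> ^^ n) (u \<mu>)) (insert \<nu> M))"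
      using Suc by simp
    also have "\<dots> = finsum V (\<lambda>\<mu>. shift \<nu> ((shift \<nu> ^^ n) (u \<mu>))) (insert \<nu> M)"
      using insert.hyps D_pow by (intro shift_finsum) auto
    finally show ?case by simp
  qed simp
  define v where "v \<mu> = (shift \<nu> ^^ k) (u \<mu>)" for \<mu>
  have vc: "v \<mu> \<in> carrier V" if "\<mu> \<in> insert \<nu> M" for \<mu>
    unfolding v_def using D_pow[OF that] D_in by auto
  have "finsum V v (insert \<nu> M) = (shift \<nu> ^^ k) \<zero>"
    unfolding v_def pow[symmetric] insert.prems(2) ..
  also have "\<dots> = \<zero>" by (induction k) (simp_all add: shift_zero)
  also have "v \<nu> = \<zero>" unfolding v_def by (rule shift_funpow_self[OF k])
  then have "finsum V v (insert \<nu> M) = finsum V v M"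
    using insert.hyps vc by (simp add: Pi_iff)
  finally have "finsum V v M = \<zero>" by simp
  moreover have "v \<mu> \<in> root_space V D T \<mu>" if "\<mu> \<in> M" for \<mu>
    unfolding v_def using insert.prems(1)[of \<mu>] that shift_funpow_ker unfolding root_space_def by blast
  ultimately have v0: "\<forall>\<mu>\<in>M. v \<mu> = \<zero>"
    using insert.IH by blast
  have uM: "u \<mu> = \<zero>" if \<mu>: "\<mu> \<in> M" for \<mu>
  proof -
    obtain l where "u \<mu> \<in> ker \<mu> l"
      using insert.prems(1)[of \<mu>] \<mu> by (auto simp: root_space_def)
    moreover have "\<mu> \<noteq> \<nu>" using \<mu> insert.hyps by auto
    ultimately show ?thesis
      using v0 \<mu> shift_funpow_eq_zero unfolding v_def by blast
  qed
  have "finsum V u (insert \<nu> M) = u \<nu> \<oplus> finsum V u M"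
    using insert.hyps uD D_in by (intro M.finsum_insert) auto
  also have "finsum V u M = \<zero>"
    using uM M.finsum_cong'[of M M "\<lambda>_. \<zero>" u] by simp
  finally have "u \<nu> = \<zero>" using insert.prems(2) uD D_in by simp
  then show ?case using uM by simp
qed simp

text \<open>
  One step of Gaussian elimination: on the kernel of a linear functional there is an independent
  family with at most one member less.
\<close>

lemma independent_eliminate:
  assumes W: "submodule W complex_field V" and fin: "finite A"
    and P: "\<And>i. i \<in> A \<Longrightarrow> \<Psi> i \<in> W" and ind: "lin_independent V A \<Psi>"
    and l: "\<And>x y. x \<in> W \<Longrightarrow> y \<in> W \<Longrightarrow> l (x \<oplus> y) = l x + l y"
      "\<And>c x. x \<in> W \<Longrightarrow> l (c \<odot> x) = c * l x"
    and W0: "\<And>x. x \<in> W \<Longrightarrow> l x = (0::complex) \<Longrightarrow> x \<in> W0"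
  shows "\<exists>B \<Phi>. B \<subseteq> A \<and> card A \<le> Suc (card B) \<and> lin_independent V B \<Phi> \<and> \<Phi> ` B \<subseteq> W0"
proof (cases "\<forall>i\<in>A. l (\<Psi> i) = 0")
  case True
  then show ?thesis
    using ind P W0 by (intro exI[of _ A] exI[of _ \<Psi>]) auto
next
  case False
  then obtain a where a: "a \<in> A" "l (\<Psi> a) \<noteq> 0" by blast
  have Pc: "\<Psi> i \<in> carrier V" if "i \<in> A" for i
    using P[OF that] subspace_subset[OF W] by auto
  define q where "q i = l (\<Psi> i) / l (\<Psi> a)" for i
  define \<Phi> where "\<Phi> i = \<Psi> i \<oplus> (- q i) \<odot> \<Psi> a" for i
  have Fc: "\<Phi> i \<in> carrier V" if "i \<in> A" for i
    unfolding \<Phi>_def using that Pc a by auto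
  have "\<Phi> i \<in> W0" if "i \<in> A" for i
  proof (rule W0)
    show "\<Phi> i \<in> W" unfolding \<Phi>_def
      using that a P by (intro subspace_add[OF W] subspace_smult[OF W])
    show "l (\<Phi> i) = 0" unfolding \<Phi>_def
      using that a P subspace_smult[OF W] by (simp add: l q_def)
  qed
  moreover have "lin_independent V (A - {a}) \<Phi>"
    unfolding lin_independent_def
  proof (intro allI impI)
    fix B c
    assume *: "finite B \<and> B \<subseteq> A - {a} \<and> finsum V (\<lambda>i. c i \<odot> \<Phi> i) B = \<zero>"
    then have B: "finite B" "a \<notin> B" "\<And>i. i \<in> B \<Longrightarrow> i \<in> A" by auto
    \<comment> \<open>the coefficient of the pivot collects what the elimination subtracted\<close>
    define c' where "c' i = (if i = a then - (\<Sum>i\<in>B. c i * q i) else c i)" for i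
    have "finsum V (\<lambda>i. c' i \<odot> \<Psi> i) (insert a B) = \<zero>"
    proof (rule inner_eqI)
      fix z assume z: "z \<in> carrier V"
      have "inner_prod V (finsum V (\<lambda>i. c' i \<odot> \<Psi> i) (insert a B)) z
          = c' a * inner_prod V (\<Psi> a) z + (\<Sum>i\<in>B. c' i * inner_prod V (\<Psi> i) z)"
        using z B a Pc by (simp add: Pi_iff)
      also have "(\<Sum>i\<in>B. c' i * inner_prod V (\<Psi> i) z) = (\<Sum>i\<in>B. c i * inner_prod V (\<Psi> i) z)"
        using B by (intro sum.cong) (auto simp: c'_def)
      also have "c' a * inner_prod V (\<Psi> a) z + \<dots> = (\<Sum>i\<in>B. c i * inner_prod V (\<Phi> i) z)"
        using z a Pc B by (simp add: c'_def \<Phi>_def sum_distrib_right sum_distrib_left algebra_simps sum_subtractf)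
      also have "\<dots> = inner_prod V (finsum V (\<lambda>i. c i \<odot> \<Phi> i) B) z"
        using z B Fc by (simp add: Pi_iff)
      finally show "inner_prod V (finsum V (\<lambda>i. c' i \<odot> \<Psi> i) (insert a B)) z = inner_prod V \<zero> z"
        using * z by simp
    qed (use B a Pc in \<open>auto intro!: M.finsum_closed\<close>)
    moreover have "insert a B \<subseteq> A" using a B by auto
    ultimately have "\<forall>i\<in>insert a B. c' i = 0"
      using ind B(1) unfolding lin_independent_def by (meson finite.insertI)
    then show "\<forall>i\<in>B. c i = 0" using B by (auto simp: c'_def split: if_splits)
  qed
  ultimately show ?thesis
    using a fin by (intro exI[of _ "A - {a}"] exI[of _ \<Phi>]) (auto simp: card_Diff_singleton)
qed

text \<open>
  If \<open>\<delta>\<close> separates eigenvectors from zero, then \<open>\<delta>\<close> composed with the \<open>k\<close>-th power of \<open>T - \<mu>\<close> cuts the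
  kernel of the \<open>(k + 1)\<close>-st power down to that of the \<open>k\<close>-th power.
\<close>

lemma ker_functional:
  assumes d: "\<And>x y. x \<in> D \<Longrightarrow> y \<in> D \<Longrightarrow> \<delta> (x \<oplus> y) = \<delta> x + \<delta> y"
      "\<And>c x. x \<in> D \<Longrightarrow> \<delta> (c \<odot> x) = c * \<delta> x"
    and inj: "\<And>x. x \<in> ker \<mu> 1 \<Longrightarrow> \<delta> x = (0::complex) \<Longrightarrow> x = \<zero>"
  shows "\<exists>l. (\<forall>x\<in>ker \<mu> (Suc k). \<forall>y\<in>ker \<mu> (Suc k). l (x \<oplus> y) = l x + l y)
    \<and> (\<forall>c. \<forall>x\<in>ker \<mu> (Suc k). l (c \<odot> x) = c * l x)
    \<and> (\<forall>x\<in>ker \<mu> (Suc k). l x = (0::complex) \<longrightarrow> x \<in> ker \<mu> k)"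
proof (induction k)
  case 0
  then show ?case
  proof (intro exI[of _ \<delta>] conjI ballI allI impI)
    show "x \<in> ker \<mu> 0" if "x \<in> ker \<mu> (Suc 0)" "\<delta> x = 0" for x
      using inj[of x] that by simp
  qed (use d ker_subset in blast)+
next
  case (Suc k)
  then obtain l where l: "\<forall>x\<in>ker \<mu> (Suc k). \<forall>y\<in>ker \<mu> (Suc k). l (x \<oplus> y) = l x + l y"
    "\<forall>c. \<forall>x\<in>ker \<mu> (Suc k). l (c \<odot> x) = c * l x"
    "\<forall>x\<in>ker \<mu> (Suc k). l x = 0 \<longrightarrow> x \<in> ker \<mu> k" by blast
  have K: "x \<in> D" "shift \<mu> x \<in> ker \<mu> (Suc k)" if "x \<in> ker \<mu> (Suc (Suc k))" for x
    using that unfolding ker_Suc[of \<mu> "Suc k"] by auto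
  show ?case
  proof (intro exI[of _ "\<lambda>x. l (shift \<mu> x)"] conjI ballI allI impI)
    show "l (shift \<mu> (x \<oplus> y)) = l (shift \<mu> x) + l (shift \<mu> y)"
      if "x \<in> ker \<mu> (Suc (Suc k))" "y \<in> ker \<mu> (Suc (Suc k))" for x y
      using K[OF that(1)] K[OF that(2)] l(1) by (simp add: shift_add)
    show "l (shift \<mu> (c \<odot> x)) = c * l (shift \<mu> x)" if "x \<in> ker \<mu> (Suc (Suc k))" for c x
      using K[OF that(1)] l(2) by (simp add: shift_smult)
    show "x \<in> ker \<mu> (Suc k)" if "x \<in> ker \<mu> (Suc (Suc k))" "l (shift \<mu> x) = 0" for x
      using K[OF that(1)] l(3) that(2) unfolding ker_Suc[of \<mu> k] by blast
  qed
qed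

text \<open>
  Each of the \<open>k\<close> steps from the kernel of the \<open>k\<close>-th power down to zero is the kernel of one
  functional, so it lowers the dimension by at most one.
\<close>

lemma ker_independent_card:
  assumes d: "\<And>x y. x \<in> D \<Longrightarrow> y \<in> D \<Longrightarrow> \<delta> (x \<oplus> y) = \<delta> x + \<delta> y"
      "\<And>c x. x \<in> D \<Longrightarrow> \<delta> (c \<odot> x) = c * \<delta> x"
    and inj: "\<And>x. x \<in> ker \<mu> 1 \<Longrightarrow> \<delta> x = (0::complex) \<Longrightarrow> x = \<zero>"
    and A: "finite A" "lin_independent V A \<Psi>" "\<Psi> ` A \<subseteq> ker \<mu> k"
  shows "card A \<le> k"
  using A
proof (induction k arbitrary: A \<Psi>)
  case 0
  have "A = {}"
  proof (rule ccontr)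
    assume "A \<noteq> {}"
    then obtain a where a: "a \<in> A" by blast
    have "\<Psi> a = \<zero>" using 0 a by auto
    then have "finsum V (\<lambda>i. 1 \<odot> \<Psi> i) {a} = \<zero>" by (subst M.finsum_insert) auto
    then have "\<forall>i\<in>{a}. (1::complex) = 0"
      using 0(2)[unfolded lin_independent_def, rule_format, of "{a}" "\<lambda>_. 1"] a by simp
    then show False by simp
  qed
  then show ?case by simp
next
  case (Suc k)
  obtain l where l: "\<forall>x\<in>ker \<mu> (Suc k). \<forall>y\<in>ker \<mu> (Suc k). l (x \<oplus> y) = l x + l y"
    "\<forall>c. \<forall>x\<in>ker \<mu> (Suc k). l (c \<odot> x) = c * l x"
    "\<forall>x\<in>ker \<mu> (Suc k). l x = (0::complex) \<longrightarrow> x \<in> ker \<mu> k"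
  proof -
    have "\<exists>l. (\<forall>x\<in>ker \<mu> (Suc k). \<forall>y\<in>ker \<mu> (Suc k). l (x \<oplus> y) = l x + l y)
        \<and> (\<forall>c. \<forall>x\<in>ker \<mu> (Suc k). l (c \<odot> x) = c * l x)
        \<and> (\<forall>x\<in>ker \<mu> (Suc k). l x = (0::complex) \<longrightarrow> x \<in> ker \<mu> k)"
      by (rule ker_functional[of \<delta>]) (use d inj in blast)+
    then show thesis using that by blast
  qed
  have "\<exists>B \<Phi>. B \<subseteq> A \<and> card A \<le> Suc (card B) \<and> lin_independent V B \<Phi> \<and> \<Phi> ` B \<subseteq> ker \<mu> k"
    by (rule independent_eliminate[of "ker \<mu> (Suc k)" A \<Psi> l])
      (use Suc.prems l subspace_ker in blast)+
  then obtain B \<Phi> where B: "B \<subseteq> A" "card A \<le> Suc (card B)" "lin_independent V B \<Phi>" "\<Phi> ` B \<subseteq> ker \<mu> k"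
    by blast
  then have "card B \<le> k"
    using Suc.IH[of B \<Phi>] finite_subset[OF B(1) Suc.prems(1)] by auto
  then show ?case using B by simp
qed

end

text \<open>
  What has to be checked for a concrete operator: finitely many eigenvalues, a linear functional that
  does not vanish on eigenvectors, and a bound on the length of Jordan chains.
\<close>

lemma riesz_basis_generalized_eigenfunctions:
  fixes V :: "'a inner_module"
  assumes "unbounded_operator V D T" and fin: "finite \<Sigma>"
    and d: "\<And>x y. x \<in> D \<Longrightarrow> y \<in> D \<Longrightarrow> \<delta> (x \<oplus>\<^bsub>V\<^esub> y) = \<delta> x + \<delta> y"
      "\<And>c x. x \<in> D \<Longrightarrow> \<delta> (c \<odot>\<^bsub>V\<^esub> x) = c * \<delta> x"
    and inj: "\<And>\<mu> x. \<mu> \<in> \<Sigma> \<Longrightarrow> x \<in> ker_power V D T \<mu> 1 \<Longrightarrow> \<delta> x = (0::complex) \<Longrightarrow> x = \<zero>\<^bsub>V\<^esub>"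
    and stop: "\<And>\<mu>. \<mu> \<in> \<Sigma> \<Longrightarrow> \<exists>m. root_space V D T \<mu> \<subseteq> ker_power V D T \<mu> m"
    and gen: "generalized_eigenfunctions V D T \<Sigma> I \<Psi>"
  shows "riesz_basis (V\<lparr>carrier := closed_span V (\<Union>\<mu>\<in>\<Sigma>. root_space V D T \<mu>)\<rparr>) I \<Psi>"
proof -
  interpret unbounded_operator V D T by fact
  let ?R = "root_space V D T"
  have RD: "?R \<mu> \<subseteq> D" for \<mu>
    unfolding root_space_def using ker_subset by blast
  have Rc: "?R \<mu> \<subseteq> carrier V" for \<mu>
    using RD D_in by blast
  have unit: "norm_of V (\<Psi> i) = 1" and ex: "\<exists>\<mu>\<in>\<Sigma>. \<Psi> i \<in> ?R \<mu>" if "i \<in> I" for i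
    using gen that unfolding generalized_eigenfunctions_def by blast+
  have ind: "lin_independent V {i \<in> I. \<Psi> i \<in> ?R \<mu>} \<Psi>"
    and span: "lin_span V (\<Psi> ` {i \<in> I. \<Psi> i \<in> ?R \<mu>}) = ?R \<mu>" if "\<mu> \<in> \<Sigma>" for \<mu>
    using gen that unfolding generalized_eigenfunctions_def by blast+
  have Pc: "\<Psi> i \<in> carrier V" if "i \<in> I" for i
    using ex[OF that] Rc by auto
  have sub_R: "submodule (?R \<mu>) complex_field V" if "\<mu> \<in> \<Sigma>" for \<mu>
    using subspace_lin_span[of "\<Psi> ` {i \<in> I. \<Psi> i \<in> ?R \<mu>}"] Pc span[OF that] by auto
  obtain m where m: "\<And>i. i \<in> I \<Longrightarrow> m i \<in> \<Sigma>" "\<And>i. i \<in> I \<Longrightarrow> \<Psi> i \<in> ?R (m i)"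
    using ex by metis
  \<comment> \<open>each root subspace has finite dimension\<close>
  have "finite {i \<in> I. \<Psi> i \<in> ?R \<mu>}" if \<mu>: "\<mu> \<in> \<Sigma>" for \<mu>
  proof -
    obtain k where k: "?R \<mu> \<subseteq> ker_power V D T \<mu> k" using stop[OF \<mu>] by blast
    have "card A \<le> k" if A: "A \<subseteq> {i \<in> I. \<Psi> i \<in> ?R \<mu>}" "finite A" for A
    proof (rule ker_independent_card[of \<delta> \<mu> A \<Psi>])
      show "lin_independent V A \<Psi>"
        using ind[OF \<mu>] A unfolding lin_independent_def by (meson subset_trans)
      show "\<Psi> ` A \<subseteq> ker_power V D T \<mu> k" using A k by auto
    qed (use d inj[OF \<mu>] A in blast)+
    then show ?thesis
      by (rule finite_if_finite_subsets_card_bdd[THEN conjunct1, rotated]) auto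
  qed
  moreover have "I \<subseteq> (\<Union>\<mu>\<in>\<Sigma>. {i \<in> I. \<Psi> i \<in> ?R \<mu>})" using m by auto
  ultimately have finI: "finite I"
    using fin by (meson finite_UN finite_subset)
  \<comment> \<open>grouping a linear relation by eigenvalues reduces it to relations inside the root subspaces\<close>
  have indI: "lin_independent V I \<Psi>"
    unfolding lin_independent_def
  proof (intro allI impI ballI)
    fix A c j
    assume *: "finite A \<and> A \<subseteq> I \<and> finsum V (\<lambda>i. c i \<odot>\<^bsub>V\<^esub> \<Psi> i) A = \<zero>\<^bsub>V\<^esub>" and j: "j \<in> A"
    then have A: "finite A" "\<And>i. i \<in> A \<Longrightarrow> i \<in> I" by auto
    define u where "u \<mu> = finsum V (\<lambda>i. c i \<odot>\<^bsub>V\<^esub> \<Psi> i) {i \<in> A. m i = \<mu>}" for \<mu>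
    have PR: "\<Psi> i \<in> ?R \<mu>" if "i \<in> A" "m i = \<mu>" for i \<mu>
      using m(2) A(2) that by blast
    have uR: "u \<mu> \<in> ?R \<mu>" if "\<mu> \<in> m ` A" for \<mu>
      unfolding u_def using that m A PR by (intro subspace_finsum sub_R) (auto intro!: subspace_smult[OF sub_R])
    have "finsum V u (m ` A) = \<zero>\<^bsub>V\<^esub>"
    proof (rule inner_eqI)
      fix z assume z: "z \<in> carrier V"
      have "inner_prod V (finsum V u (m ` A)) z = (\<Sum>\<mu>\<in>m ` A. inner_prod V (u \<mu>) z)"
        using A z uR Rc by (subst inner_finsum_left) auto
      also have "\<dots> = (\<Sum>\<mu>\<in>m ` A. \<Sum>i | i \<in> A \<and> m i = \<mu>. c i * inner_prod V (\<Psi> i) z)"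
        unfolding u_def using A Pc z by (intro sum.cong refl, subst inner_finsum_left) auto
      also have "\<dots> = (\<Sum>i\<in>A. c i * inner_prod V (\<Psi> i) z)"
        using A by (intro sum.group) auto
      also have "\<dots> = inner_prod V (finsum V (\<lambda>i. c i \<odot>\<^bsub>V\<^esub> \<Psi> i) A) z"
        using A Pc z by (subst inner_finsum_left) auto
      finally show "inner_prod V (finsum V u (m ` A)) z = inner_prod V \<zero>\<^bsub>V\<^esub> z"
        using * by simp
    qed (use uR Rc in \<open>auto intro!: M.finsum_closed\<close>)
    then have "\<forall>\<mu>\<in>m ` A. u \<mu> = \<zero>\<^bsub>V\<^esub>"
      using root_spaces_independent[of "m ` A" u] A uR by auto
    then have "u (m j) = \<zero>\<^bsub>V\<^esub>" using j by auto
    moreover have "{i \<in> A. m i = m j} \<subseteq> {i \<in> I. \<Psi> i \<in> ?R (m j)}" using m A by force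
    moreover have "lin_independent V {i \<in> I. \<Psi> i \<in> ?R (m j)} \<Psi>"
      using ind m(1) A(2) j by blast
    ultimately have "\<forall>i\<in>{i \<in> A. m i = m j}. c i = 0"
      using A(1) unfolding lin_independent_def u_def by (metis (no_types, lifting) finite_subset mem_Collect_eq subsetI)
    then show "c j = 0" using j by auto
  qed
  have P: "\<Psi> \<in> I \<rightarrow> carrier V" using Pc by auto
  have sub: "\<Psi> ` I \<subseteq> carrier V" "(\<Union>\<mu>\<in>\<Sigma>. ?R \<mu>) \<subseteq> carrier V" using Pc Rc by auto
  have spanI: "lin_span V (\<Union>\<mu>\<in>\<Sigma>. ?R \<mu>) = lin_span V (\<Psi> ` I)"
  proof
    have "?R \<mu> \<subseteq> lin_span V (\<Psi> ` I)" if "\<mu> \<in> \<Sigma>" for \<mu>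
    proof -
      have "lin_span V (\<Psi> ` {i \<in> I. \<Psi> i \<in> ?R \<mu>}) \<subseteq> lin_span V (\<Psi> ` I)"
        using lin_span_superset[OF sub(1)] by (intro lin_span_minimal subspace_lin_span sub) auto
      then show ?thesis unfolding span[OF that] .
    qed
    then show "lin_span V (\<Union>\<mu>\<in>\<Sigma>. ?R \<mu>) \<subseteq> lin_span V (\<Psi> ` I)"
      by (intro lin_span_minimal subspace_lin_span sub) auto
    show "lin_span V (\<Psi> ` I) \<subseteq> lin_span V (\<Union>\<mu>\<in>\<Sigma>. ?R \<mu>)"
      using lin_span_superset[OF sub(2)] m by (intro lin_span_minimal subspace_lin_span sub) auto
  qed
  define W where "W = lin_span V (\<Psi> ` I)"
  have W: "submodule W complex_field V" "\<Psi> ` I \<subseteq> W"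
    unfolding W_def using subspace_lin_span lin_span_superset sub by auto
  have "closed_span V (\<Union>\<mu>\<in>\<Sigma>. ?R \<mu>) = W"
    unfolding W_def using closed_span_eq_lin_span[OF finI P indI spanI] spanI by simp
  moreover have "riesz_basis (V\<lparr>carrier := W\<rparr>) I \<Psi>"
  proof (rule riesz_basis_finite_dimensional)
    show "complex_inner_space (V\<lparr>carrier := W\<rparr>)"
      by (rule complex_inner_space_subspace[OF W(1)])
    show "lin_independent (V\<lparr>carrier := W\<rparr>) I \<Psi>"
      using lin_independent_subspace_eq[OF W] indI by simp
    show "carrier (V\<lparr>carrier := W\<rparr>) = lin_span (V\<lparr>carrier := W\<rparr>) (\<Psi> ` I)"
      using lin_span_subspace_eq[OF W] by (simp add: W_def)
  qed (use finI W in auto)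
  ultimately show ?thesis by simp
qed

section \<open>Square integrable functions\<close>

lemma ae_class_eq_iff:
  assumes "f \<in> borel_measurable M" "g \<in> borel_measurable M"
  shows "ae_class M f = ae_class M g \<longleftrightarrow> (AE x in M. f x = g x)"
proof
  assume "ae_class M f = ae_class M g"
  moreover have "f \<in> ae_class M f" using assms by (auto simp: ae_class_def)
  ultimately show "AE x in M. f x = g x" by (auto simp: ae_class_def)
next
  assume fg: "AE x in M. f x = g x"
  have "(AE x in M. h x = f x) \<longleftrightarrow> (AE x in M. h x = g x)" for h
  proof
    assume "AE x in M. h x = f x"
    with fg show "AE x in M. h x = g x" by eventually_elim simp
  next
    assume "AE x in M. h x = g x"
    with fg show "AE x in M. h x = f x" by eventually_elim simp
  qed
  then show "ae_class M f = ae_class M g" by (simp add: ae_class_def)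
qed

lemma ae_class_self: "f \<in> borel_measurable M \<Longrightarrow> f \<in> ae_class M f"
  by (simp add: ae_class_def)

lemma
  assumes "f \<in> borel_measurable M"
  shows ae_rep_measurable: "ae_rep (ae_class M f) \<in> borel_measurable M"
    and ae_rep_AE: "AE x in M. ae_rep (ae_class M f) x = f x"
  using someI[of "\<lambda>g. g \<in> ae_class M f", OF ae_class_self[OF assms]]
  by (auto simp: ae_rep_def ae_class_def)

lemma L2_fun_measurable: "f \<in> L2_fun M \<Longrightarrow> f \<in> borel_measurable M"
  by (simp add: L2_fun_def)

lemma L2_fun_cong_AE:
  assumes "f \<in> L2_fun M" "g \<in> borel_measurable M" "AE x in M. g x = f x"
  shows "g \<in> L2_fun M"
proof -
  have "integrable M (\<lambda>x. (cmod (g x))\<^sup>2) \<longleftrightarrow> integrable M (\<lambda>x. (cmod (f x))\<^sup>2)"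
  proof (rule integrable_cong_AE)
    show "AE x in M. (cmod (g x))\<^sup>2 = (cmod (f x))\<^sup>2"
      using assms(3) by eventually_elim simp
  qed (use assms in \<open>auto simp: L2_fun_def\<close>)
  then show ?thesis using assms by (simp add: L2_fun_def)
qed

lemma integrable_mult_L2:
  assumes "f \<in> L2_fun M" "g \<in> L2_fun M"
  shows "integrable M (\<lambda>x. f x * g x)"
proof (rule Bochner_Integration.integrable_bound)
  show "integrable M (\<lambda>x. (cmod (f x))\<^sup>2 + (cmod (g x))\<^sup>2)"
    using assms by (auto simp: L2_fun_def)
  show "(\<lambda>x. f x * g x) \<in> borel_measurable M"
    using assms by (auto simp: L2_fun_def)
  have "cmod (f x) * cmod (g x) \<le> (cmod (f x))\<^sup>2 + (cmod (g x))\<^sup>2" for x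
  proof -
    have "0 \<le> cmod (f x) * cmod (g x)" by simp
    then show ?thesis using sum_squares_bound[of "cmod (f x)" "cmod (g x)"] by linarith
  qed
  then show "AE x in M. norm (f x * g x) \<le> norm ((cmod (f x))\<^sup>2 + (cmod (g x))\<^sup>2)"
    by (auto simp: norm_mult)
qed

lemma L2_fun_add:
  assumes "f \<in> L2_fun M" "g \<in> L2_fun M"
  shows "(\<lambda>x. f x + g x) \<in> L2_fun M"
proof -
  have "integrable M (\<lambda>x. (cmod (f x + g x))\<^sup>2)"
  proof (rule Bochner_Integration.integrable_bound)
    show "integrable M (\<lambda>x. 2 * (cmod (f x))\<^sup>2 + 2 * (cmod (g x))\<^sup>2)"
      using assms by (auto simp: L2_fun_def)
    have "(cmod (f x + g x))\<^sup>2 \<le> 2 * (cmod (f x))\<^sup>2 + 2 * (cmod (g x))\<^sup>2" for x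
    proof -
      have "(cmod (f x + g x))\<^sup>2 \<le> (cmod (f x) + cmod (g x))\<^sup>2"
        by (intro power_mono norm_triangle_ineq) auto
      also have "\<dots> \<le> 2 * (cmod (f x))\<^sup>2 + 2 * (cmod (g x))\<^sup>2"
        using sum_squares_bound[of "cmod (f x)" "cmod (g x)"] by (simp add: power2_sum)
      finally show ?thesis .
    qed
    then show "AE x in M. norm ((cmod (f x + g x))\<^sup>2) \<le> norm (2 * (cmod (f x))\<^sup>2 + 2 * (cmod (g x))\<^sup>2)"
      by auto
  qed (use assms in \<open>auto simp: L2_fun_def\<close>)
  then show ?thesis using assms by (auto simp: L2_fun_def)
qed

lemma L2_fun_scale: "f \<in> L2_fun M \<Longrightarrow> (\<lambda>x. c * f x) \<in> L2_fun M"
  by (auto simp: L2_fun_def norm_mult power_mult_distrib)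

lemma L2_fun_cnj: "f \<in> L2_fun M \<Longrightarrow> (\<lambda>x. cnj (f x)) \<in> L2_fun M"
  using measurable_compose[OF L2_fun_measurable borel_measurable_continuous_onI[OF continuous_on_cnj[OF continuous_on_id]]]
  by (auto simp: L2_fun_def)

lemma L2_fun_zero: "(\<lambda>x. 0) \<in> L2_fun M"
  by (simp add: L2_fun_def)

lemma L2_spaceE:
  assumes "u \<in> carrier (L2_space M)"
  obtains f where "f \<in> L2_fun M" "u = ae_class M f"
  using assms by (auto simp: L2_space_def)

lemma ae_class_in_L2: "f \<in> L2_fun M \<Longrightarrow> ae_class M f \<in> carrier (L2_space M)"
  by (auto simp: L2_space_def)

lemma L2_zero: "\<zero>\<^bsub>L2_space M\<^esub> = ae_class M (\<lambda>x. 0)"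
  by (simp add: L2_space_def)

lemma L2_add:
  assumes "f \<in> L2_fun M" "g \<in> L2_fun M"
  shows "ae_class M f \<oplus>\<^bsub>L2_space M\<^esub> ae_class M g = ae_class M (\<lambda>x. f x + g x)"
proof -
  have [measurable]: "f \<in> borel_measurable M" "g \<in> borel_measurable M"
    using assms by (auto simp: L2_fun_def)
  note [measurable] = ae_rep_measurable[OF \<open>f \<in> borel_measurable M\<close>] ae_rep_measurable[OF \<open>g \<in> borel_measurable M\<close>]
  have "AE x in M. ae_rep (ae_class M f) x + ae_rep (ae_class M g) x = f x + g x"
    using ae_rep_AE[OF \<open>f \<in> borel_measurable M\<close>] ae_rep_AE[OF \<open>g \<in> borel_measurable M\<close>]
    by eventually_elim simp
  then show ?thesis
    by (simp add: L2_space_def ae_class_eq_iff)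
qed

lemma L2_smult:
  assumes "f \<in> L2_fun M"
  shows "c \<odot>\<^bsub>L2_space M\<^esub> ae_class M f = ae_class M (\<lambda>x. c * f x)"
proof -
  have [measurable]: "f \<in> borel_measurable M"
    using assms by (auto simp: L2_fun_def)
  note [measurable] = ae_rep_measurable[OF \<open>f \<in> borel_measurable M\<close>]
  have "AE x in M. c * ae_rep (ae_class M f) x = c * f x"
    using ae_rep_AE[OF \<open>f \<in> borel_measurable M\<close>] by eventually_elim simp
  then show ?thesis
    by (simp add: L2_space_def ae_class_eq_iff)
qed

lemma L2_inner:
  assumes "f \<in> L2_fun M" "g \<in> L2_fun M"
  shows "inner_prod (L2_space M) (ae_class M f) (ae_class M g) = (LINT x|M. f x * cnj (g x))"
proof -
  have [measurable]: "f \<in> borel_measurable M" "g \<in> borel_measurable M"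
    using assms by (auto simp: L2_fun_def)
  note [measurable] = ae_rep_measurable[OF \<open>f \<in> borel_measurable M\<close>] ae_rep_measurable[OF \<open>g \<in> borel_measurable M\<close>]
  have "AE x in M. ae_rep (ae_class M f) x * cnj (ae_rep (ae_class M g) x) = f x * cnj (g x)"
    using ae_rep_AE[OF \<open>f \<in> borel_measurable M\<close>] ae_rep_AE[OF \<open>g \<in> borel_measurable M\<close>]
    by eventually_elim simp
  moreover have "(\<lambda>x. h x * cnj (k x)) \<in> borel_measurable M"
    if "h \<in> borel_measurable M" "k \<in> borel_measurable M" for h k :: "'a \<Rightarrow> complex"
    using that(1) measurable_compose[OF that(2) borel_measurable_continuous_onI[OF continuous_on_cnj[OF continuous_on_id]]]
    by simp
  ultimately have "(LINT x|M. ae_rep (ae_class M f) x * cnj (ae_rep (ae_class M g) x)) = (LINT x|M. f x * cnj (g x))"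
    by (intro integral_cong_AE) auto
  then show ?thesis by (simp add: L2_space_def)
qed

lemma complex_inner_space_L2: "complex_inner_space (L2_space M)"
proof -
  let ?V = "L2_space M"
  note [simp] = L2_zero L2_add L2_smult L2_inner ae_class_in_L2 L2_fun_add L2_fun_scale L2_fun_zero
  have "module complex_field ?V"
  proof (rule moduleI)
    show "abelian_group ?V"
    proof (rule abelian_groupI)
      fix x assume "x \<in> carrier ?V"
      then obtain f where f: "f \<in> L2_fun M" "x = ae_class M f" by (rule L2_spaceE)
      have "ae_class M (\<lambda>x. - 1 * f x) \<oplus>\<^bsub>?V\<^esub> x = \<zero>\<^bsub>?V\<^esub>"
        unfolding f(2) using f(1) L2_fun_scale[OF f(1), of "-1"] by (subst L2_add) auto
      then show "\<exists>y\<in>carrier ?V. y \<oplus>\<^bsub>?V\<^esub> x = \<zero>\<^bsub>?V\<^esub>"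
        using f ae_class_in_L2[OF L2_fun_scale[OF f(1), of "-1"]] by blast
    qed (auto elim!: L2_spaceE simp: add_ac)
  qed (auto elim!: L2_spaceE simp: algebra_simps intro: cring_from_type_algebra)
  then interpret V: module complex_field ?V .
  show ?thesis
  proof
    show "inner_prod ?V (x \<oplus>\<^bsub>?V\<^esub> y) z = inner_prod ?V x z + inner_prod ?V y z"
      if "x \<in> carrier ?V" "y \<in> carrier ?V" "z \<in> carrier ?V" for x y z
      using that by (elim L2_spaceE) (simp add: distrib_right integrable_mult_L2 L2_fun_cnj)
    show "inner_prod ?V (c \<odot>\<^bsub>?V\<^esub> x) y = c * inner_prod ?V x y"
      if "x \<in> carrier ?V" "y \<in> carrier ?V" for c x y
      using that by (elim L2_spaceE) (simp add: mult.assoc)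
    show "inner_prod ?V y x = cnj (inner_prod ?V x y)"
      if "x \<in> carrier ?V" "y \<in> carrier ?V" for x y
    proof -
      note xy = that
      obtain f where f: "f \<in> L2_fun M" "x = ae_class M f" using xy(1) by (rule L2_spaceE)
      obtain g where g: "g \<in> L2_fun M" "y = ae_class M g" using xy(2) by (rule L2_spaceE)
      note fg = f g
      have "cnj (LINT x|M. f x * cnj (g x)) = (LINT x|M. cnj (f x * cnj (g x)))"
        using fg by (intro integral_bounded_linear[OF bounded_linear_cnj, symmetric] integrable_mult_L2 L2_fun_cnj)
      also have "\<dots> = (LINT x|M. g x * cnj (f x))"
        by (intro Bochner_Integration.integral_cong refl) (simp add: mult.commute)
      finally show ?thesis using fg by simp
    qed
    show "0 \<le> Re (inner_prod ?V x x)" if "x \<in> carrier ?V" for x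
      using that by (elim L2_spaceE) (simp add: complex_norm_square[symmetric] del: of_real_power)
    show "x = \<zero>\<^bsub>?V\<^esub>" if "x \<in> carrier ?V" "inner_prod ?V x x = 0" for x
    proof -
      obtain f where f: "f \<in> L2_fun M" "x = ae_class M f" using \<open>x \<in> carrier ?V\<close> by (rule L2_spaceE)
      have "(LINT x|M. f x * cnj (f x)) = complex_of_real (LINT x|M. (cmod (f x))\<^sup>2)"
        unfolding complex_norm_square[symmetric] integral_complex_of_real ..
      then have "(LINT x|M. (cmod (f x))\<^sup>2) = 0"
        using that f by simp
      then have "AE x in M. (cmod (f x))\<^sup>2 = 0"
        using f by (subst (asm) integral_nonneg_eq_0_iff_AE) (auto simp: L2_fun_def)
      then show ?thesis
        using f by (auto simp: ae_class_eq_iff L2_fun_measurable)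
    qed
  qed
qed

lemma L2_memD:
  assumes "u \<in> carrier (L2_space M)" "f \<in> u"
  shows "f \<in> L2_fun M" "u = ae_class M f"
proof -
  obtain g where g: "g \<in> L2_fun M" "u = ae_class M g" using assms(1) by (rule L2_spaceE)
  then show "f \<in> L2_fun M"
    using assms(2) L2_fun_cong_AE[OF g(1)] by (auto simp: ae_class_def)
  have fg: "AE x in M. f x = g x" and fm: "f \<in> borel_measurable M"
    using assms(2) g by (auto simp: ae_class_def)
  then show "u = ae_class M f"
    unfolding g(2) by (subst ae_class_eq_iff) (use g in \<open>auto simp: L2_fun_measurable eq_commute\<close>)
qed

lemma ae_rep_in:
  assumes "u \<in> carrier (L2_space M)" shows "ae_rep u \<in> u"
proof -
  obtain g where g: "g \<in> L2_fun M" "u = ae_class M g" using assms(1) by (rule L2_spaceE)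
  then have "g \<in> u" by (auto intro: ae_class_self L2_fun_measurable)
  then show ?thesis unfolding ae_rep_def using someI by metis
qed

lemma L2_mem_AE:
  assumes "u \<in> carrier (L2_space M)" "f \<in> u" "g \<in> u"
  shows "AE x in M. f x = g x"
  using L2_memD[OF assms(1,2)] L2_memD[OF assms(1,3)] ae_class_eq_iff L2_fun_measurable by blast

lemma complex_inner_space_orthogonal_sum:
  assumes "complex_inner_space V" "complex_inner_space W"
  shows "complex_inner_space (orthogonal_sum V W)"
proof -
  interpret V: complex_inner_space V by fact
  interpret W: complex_inner_space W by fact
  let ?S = "orthogonal_sum V W"
  have "module complex_field ?S"
  proof (rule moduleI)
    show "abelian_group ?S"
    proof (rule abelian_groupI)
      fix x assume "x \<in> carrier ?S"
      then show "\<exists>y\<in>carrier ?S. y \<oplus>\<^bsub>?S\<^esub> x = \<zero>\<^bsub>?S\<^esub>"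
        by (intro bexI[of _ "(\<ominus>\<^bsub>V\<^esub> fst x, \<ominus>\<^bsub>W\<^esub> snd x)"])
          (auto simp: orthogonal_sum_def V.M.l_neg W.M.l_neg)
    qed (auto simp: orthogonal_sum_def V.M.a_ac W.M.a_ac)
  qed (auto simp: orthogonal_sum_def V.smult_l_distr[simplified] V.smult_r_distr[simplified]
      V.smult_assoc1[simplified] W.smult_l_distr[simplified] W.smult_r_distr[simplified]
      W.smult_assoc1[simplified] intro: cring_from_type_algebra)
  then interpret S: module complex_field ?S .
  show ?thesis
  proof
    show "inner_prod ?S y x = cnj (inner_prod ?S x y)"
      if "x \<in> carrier ?S" "y \<in> carrier ?S" for x y
      using that V.inner_commute[of "fst x" "fst y"] W.inner_commute[of "snd x" "snd y"]
      by (auto simp: orthogonal_sum_def)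
    show "x = \<zero>\<^bsub>?S\<^esub>" if x: "x \<in> carrier ?S" and "inner_prod ?S x x = 0" for x
    proof -
      have "complex_of_real ((norm_of V (fst x))\<^sup>2 + (norm_of W (snd x))\<^sup>2) = 0"
        using that by (auto simp: orthogonal_sum_def V.inner_self W.inner_self)
      then have "norm_of V (fst x) = 0 \<and> norm_of W (snd x) = 0"
        unfolding of_real_eq_0_iff by (simp add: sum_power2_eq_zero_iff)
      then show ?thesis using x by (auto simp: orthogonal_sum_def)
    qed
  qed (auto simp: orthogonal_sum_def algebra_simps V.inner_ge_zero W.inner_ge_zero)
qed

section \<open>Continuous representatives of weakly differentiable functions\<close>

text \<open>
  Extension by zero makes it possible to integrate over arbitrary intervals, as the differentiation
  theorem for Lebesgue integrals requires.
\<close>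

definition zero_ext :: "real set \<Rightarrow> (real \<Rightarrow> complex) \<Rightarrow> real \<Rightarrow> complex" where
  "zero_ext J f x = (if x \<in> J then f x else 0)"

lemma zero_ext_eq: "zero_ext J f x = indicat_real J x *\<^sub>R f x"
  by (simp add: zero_ext_def)

lemma zero_ext_L2:
  assumes "f \<in> L2_fun (lebesgue_on J)" and J: "J \<in> sets lebesgue"
  shows "zero_ext J f \<in> L2_fun lebesgue"
proof -
  have "zero_ext J f \<in> borel_measurable lebesgue"
    using assms unfolding L2_fun_def zero_ext_eq[abs_def]
    by (auto simp: borel_measurable_restrict_space_iff)
  moreover have "integrable lebesgue (\<lambda>x. indicat_real J x *\<^sub>R (cmod (f x))\<^sup>2)"
    using assms by (subst integrable_restrict_space[symmetric]) (auto simp: L2_fun_def)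
  then have "integrable lebesgue (\<lambda>x. (cmod (zero_ext J f x))\<^sup>2)"
    by (rule back_subst[of "integrable lebesgue"]) (auto simp: zero_ext_def)
  ultimately show ?thesis by (simp add: L2_fun_def)
qed

lemma indicator_L2: "A \<in> lmeasurable \<Longrightarrow> (\<lambda>x. of_real (indicat_real A x)) \<in> L2_fun lebesgue"
proof -
  assume A: "A \<in> lmeasurable"
  have "(\<lambda>x. (cmod (of_real (indicat_real A x)))\<^sup>2) = indicat_real A"
    by (auto simp: indicator_def)
  then show ?thesis
    using A unfolding L2_fun_def by (auto simp: fmeasurable_def)
qed

lemma L2_absolutely_integrable:
  assumes "F \<in> L2_fun lebesgue"
  shows "F absolutely_integrable_on {a..b::real}"
proof -
  have "integrable lebesgue (\<lambda>x. of_real (indicat_real {a..b} x) * F x)"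
    using assms by (intro integrable_mult_L2 indicator_L2) auto
  then show ?thesis
    unfolding set_integrable_def by (simp add: scaleR_conv_of_real)
qed

lemma LINT_interval:
  assumes "F absolutely_integrable_on {a..b}"
  shows "(LINT x|lebesgue. indicat_real {a..b} x *\<^sub>R F x) = integral {a..b} (F :: real \<Rightarrow> complex)"
  using set_lebesgue_integral_eq_integral(2)[OF assms] by (simp add: set_lebesgue_integral_def)

subsection \<open>Smoothed ramps\<close>

text \<open>
  A continuously differentiable approximation of the ramp \<open>max 0 y\<close>; its derivative \<open>ramp'\<close> rises
  linearly from \<open>0\<close> to \<open>1\<close> on \<open>[0, 1/n]\<close>.
\<close>

definition ramp :: "nat \<Rightarrow> real \<Rightarrow> real" where
  "ramp n y = real n / 2 * ((max 0 y)\<^sup>2 - (max 0 (y - 1 / real n))\<^sup>2)"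

definition ramp' :: "nat \<Rightarrow> real \<Rightarrow> real" where
  "ramp' n y = real n * (max 0 y - max 0 (y - 1 / real n))"

lemma max_square_deriv: "((\<lambda>y. (max 0 y)\<^sup>2) has_real_derivative 2 * max 0 x) (at x)" for x :: real
proof -
  consider "x < 0" | "x > 0" | "x = 0" by linarith
  then show ?thesis
  proof cases
    case 1
    have "((\<lambda>y::real. 0) has_real_derivative 2 * max 0 x) (at x)" using 1 by simp
    then show ?thesis
      by (rule has_field_derivative_transform_within_open[where S="{..<0}"]) (use 1 in auto)
  next
    case 2
    have "((\<lambda>y::real. y\<^sup>2) has_real_derivative 2 * max 0 x) (at x)"
      using 2 by (auto intro!: derivative_eq_intros)
    then show ?thesis
      by (rule has_field_derivative_transform_within_open[where S="{0<..}"]) (use 2 in auto)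
  next
    case 3
    have "((\<lambda>h::real. ((max 0 (0 + h))\<^sup>2 - (max 0 0)\<^sup>2) / h) \<longlongrightarrow> 0) (at 0)"
    proof (rule Lim_null_comparison)
      show "\<forall>\<^sub>F h in at (0::real). norm (((max 0 (0 + h))\<^sup>2 - (max 0 0)\<^sup>2) / h) \<le> \<bar>h\<bar>"
        by (auto simp: max_def power2_eq_square)
      show "((\<lambda>h::real. \<bar>h\<bar>) \<longlongrightarrow> 0) (at 0)"
        using tendsto_rabs[OF tendsto_ident_at[of "0::real" UNIV]] by simp
    qed
    then show ?thesis using 3 by (simp add: DERIV_def)
  qed
qed

lemma ramp_deriv: "(ramp n has_real_derivative ramp' n x) (at x)"
proof -
  have "((\<lambda>y. (max 0 (y - 1 / real n))\<^sup>2) has_real_derivative 2 * max 0 (x - 1 / real n) * 1) (at x)"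
    by (rule DERIV_chain2[OF max_square_deriv]) (auto intro!: derivative_eq_intros)
  from DERIV_cmult[OF DERIV_diff[OF max_square_deriv[of x] this], of "real n / 2"]
  show ?thesis unfolding ramp_def[abs_def] ramp'_def by (simp add: algebra_simps)
qed

lemma continuous_ramp': "continuous_on A (ramp' n)"
  unfolding ramp'_def[abs_def] by (intro continuous_intros)

lemma ramp_neg: "y \<le> 0 \<Longrightarrow> ramp n y = 0"
proof -
  assume y: "y \<le> 0"
  then have "y - 1 / real n \<le> 0" using divide_nonneg_nonneg[of 1 "real n"] by linarith
  then show ?thesis using y by (simp add: ramp_def max_def)
qed

lemma ramp_pos: "n > 0 \<Longrightarrow> 1 / real n \<le> y \<Longrightarrow> ramp n y = y - 1 / (2 * real n)"
proof -
  assume n: "n > 0" and y: "1 / real n \<le> y"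
  have "0 < 1 / real n" using n by simp
  then have "0 \<le> y" using y by linarith
  then show ?thesis using n y by (simp add: ramp_def max_def power2_eq_square field_simps)
qed

lemma ramp'_neg: "y \<le> 0 \<Longrightarrow> ramp' n y = 0"
proof -
  assume y: "y \<le> 0"
  then have "y - 1 / real n \<le> 0" using divide_nonneg_nonneg[of 1 "real n"] by linarith
  then show ?thesis using y by (simp add: ramp'_def max_def)
qed

lemma ramp'_pos: "n > 0 \<Longrightarrow> 1 / real n \<le> y \<Longrightarrow> ramp' n y = 1"
proof -
  assume n: "n > 0" and y: "1 / real n \<le> y"
  have "0 < 1 / real n" using n by simp
  then have "0 \<le> y" using y by linarith
  then show ?thesis using n y by (simp add: ramp'_def max_def field_simps)
qed

lemma ramp_mid: "0 \<le> y \<Longrightarrow> y \<le> 1 / real n \<Longrightarrow> ramp n y = real n / 2 * y\<^sup>2 \<and> ramp' n y = real n * y"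
  by (simp add: ramp_def ramp'_def max_def)

lemma ramp_bounds: "0 \<le> ramp' n y" "ramp' n y \<le> 1" "\<bar>ramp n y\<bar> \<le> \<bar>y\<bar>"
proof -
  have "0 \<le> ramp' n y \<and> ramp' n y \<le> 1 \<and> \<bar>ramp n y\<bar> \<le> \<bar>y\<bar>"
  proof (cases "n = 0")
    case True
    then show ?thesis by (simp add: ramp_def ramp'_def)
  next
    case n: False
    consider "y \<le> 0" | "0 < y" "y < 1 / real n" | "1 / real n \<le> y" by linarith
    then show ?thesis
    proof cases
      case 2
      then have "real n * y \<le> 1" using n by (simp add: field_simps)
      then have "real n * y * y \<le> 1 * y" using 2 by (intro mult_right_mono) auto
      moreover have "0 \<le> real n * y * y" using 2 by simp
      ultimately have "\<bar>real n / 2 * y\<^sup>2\<bar> \<le> \<bar>y\<bar>"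
        using 2 by (simp add: power2_eq_square abs_of_nonneg)
      moreover have "ramp n y = real n / 2 * y\<^sup>2" "ramp' n y = real n * y"
        using ramp_mid[of y n] 2 by auto
      ultimately show ?thesis using 2 \<open>real n * y \<le> 1\<close> by (metis less_imp_le mult_nonneg_nonneg of_nat_0_le_iff)
    next
      case 3
      have "0 < 1 / real n" "1 / (2 * real n) = (1 / real n) / 2" using n by simp_all
      then have "0 \<le> y - 1 / (2 * real n)" "y - 1 / (2 * real n) \<le> y" "0 \<le> y" using 3 by linarith+
      then show ?thesis using 3 n by (simp add: ramp_pos ramp'_pos)
    qed (simp add: ramp_neg ramp'_neg)
  qed
  then show "0 \<le> ramp' n y" "ramp' n y \<le> 1" "\<bar>ramp n y\<bar> \<le> \<bar>y\<bar>" by auto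
qed

lemma eventually_inverse_le: "0 < y \<Longrightarrow> \<forall>\<^sub>F n in sequentially. 0 < n \<and> 1 / real n \<le> y"
proof -
  assume y: "0 < y"
  obtain N :: nat where N: "1 / y < real N" using reals_Archimedean2 by blast
  show ?thesis
  proof (rule eventually_sequentiallyI[of "max N 1"])
    fix n assume n: "max N 1 \<le> n"
    then have "1 / y \<le> real n" using N by linarith
    then show "0 < n \<and> 1 / real n \<le> y" using n y by (auto simp: field_simps)
  qed
qed

lemma ramp'_tendsto: "(\<lambda>n. ramp' n y) \<longlonglongrightarrow> (if 0 < y then 1 else 0)"
proof (cases "0 < y")
  case True
  then show ?thesis
    using eventually_inverse_le[OF True] by (auto intro!: tendsto_eventually elim!: eventually_mono simp: ramp'_pos)
qed (simp add: ramp'_neg)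

lemma ramp_tendsto: "(\<lambda>n. ramp n y) \<longlonglongrightarrow> max 0 y"
proof (cases "0 < y")
  case True
  have "(\<lambda>n. y - (1 / 2) * (1 / real n)) \<longlonglongrightarrow> y - (1 / 2) * 0"
    by (intro tendsto_intros lim_1_over_n)
  moreover have "\<forall>\<^sub>F n in sequentially. y - (1 / 2) * (1 / real n) = ramp n y"
    using eventually_inverse_le[OF True] by eventually_elim (simp add: ramp_pos)
  ultimately show ?thesis using True by (auto intro: Lim_transform_eventually)
qed (simp add: ramp_neg)

subsection \<open>Second differences as test functions\<close>

text \<open>
  For the ramp \<open>g y = max 0 y\<close> and \<open>h \<le> b - a\<close> this is a trapezoid supported in \<open>[a, b + h]\<close>, of height \<open>h\<close> on
  \<open>[a + h, b]\<close>; its derivative is the indicator of \<open>[a, a + h]\<close> minus that of \<open>[b, b + h]\<close>.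
\<close>

definition diff2 :: "real \<Rightarrow> real \<Rightarrow> real \<Rightarrow> (real \<Rightarrow> real) \<Rightarrow> real \<Rightarrow> real" where
  "diff2 a b h g x = g (x - a) - g (x - a - h) - g (x - b) + g (x - b - h)"

lemma diff2_ramp_outside:
  assumes "a < b" "0 < h" "n > 0" "1 / real n \<le> h" "x \<notin> {a..b + 2 * h}"
  shows "diff2 a b h (ramp n) x = 0" "diff2 a b h (ramp' n) x = 0"
proof -
  consider "x < a" | "b + 2 * h < x" using assms(5) by fastforce
  then have "diff2 a b h (ramp n) x = 0 \<and> diff2 a b h (ramp' n) x = 0"
  proof cases
    case 1
    then show ?thesis using assms(1,2) by (simp add: diff2_def ramp_neg ramp'_neg)
  next
    case 2
    then have "1 / real n \<le> x - a" "1 / real n \<le> x - a - h" "1 / real n \<le> x - b" "1 / real n \<le> x - b - h"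
      using assms by linarith+
    then show ?thesis using assms(3) by (simp add: diff2_def ramp_pos ramp'_pos)
  qed
  then show "diff2 a b h (ramp n) x = 0" "diff2 a b h (ramp' n) x = 0" by auto
qed

lemma diff2_ramp_deriv:
  "((\<lambda>x. complex_of_real (diff2 a b h (ramp n) x)) has_vector_derivative of_real (diff2 a b h (ramp' n) x)) (at x)"
proof -
  have shift: "((\<lambda>x. ramp n (x - c)) has_real_derivative ramp' n (x - c) * 1) (at x)" for c
    by (rule DERIV_chain2[OF ramp_deriv]) (auto intro!: derivative_eq_intros)
  have "((\<lambda>x. diff2 a b h (ramp n) x) has_real_derivative diff2 a b h (ramp' n) x) (at x)"
    unfolding diff2_def diff_diff_eq using shift
    by (auto intro!: derivative_eq_intros)
  then have "(diff2 a b h (ramp n) has_vector_derivative diff2 a b h (ramp' n) x) (at x)"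
    by (simp add: has_real_derivative_iff_has_vector_derivative)
  then show ?thesis by (rule bounded_linear.has_vector_derivative[OF bounded_linear_of_real])
qed

lemma test_function_diff2:
  assumes "a < b" "0 < h" "n > 0" "1 / real n \<le> h" "{a..b + 2 * h} \<subseteq> J"
  shows "test_function J (\<lambda>x. complex_of_real (diff2 a b h (ramp n) x))"
  unfolding test_function_def
proof
  have "continuous_on UNIV (\<lambda>x. complex_of_real (diff2 a b h (ramp' n) x))"
    unfolding diff2_def
    by (intro continuous_intros continuous_on_compose2[OF continuous_ramp'[of UNIV]]) auto
  then show "(\<lambda>x. complex_of_real (diff2 a b h (ramp n) x)) C1_differentiable_on UNIV"
    unfolding C1_differentiable_on_def using diff2_ramp_deriv
    by (intro exI[of _ "\<lambda>x. complex_of_real (diff2 a b h (ramp' n) x)"]) auto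
  show "\<exists>K. compact K \<and> K \<subseteq> J \<and> (\<forall>x. x \<notin> K \<longrightarrow> complex_of_real (diff2 a b h (ramp n) x) = 0)"
    using assms diff2_ramp_outside(1)[OF assms(1-4)] by (intro exI[of _ "{a..b + 2 * h}"]) auto
qed

lemma diff2_bound:
  assumes "\<And>y. \<bar>g y\<bar> \<le> B" shows "\<bar>diff2 a b h g x\<bar> \<le> 4 * B"
  using assms[of "x - a"] assms[of "x - a - h"] assms[of "x - b"] assms[of "x - b - h"]
  unfolding diff2_def by linarith

lemma LINT_zero_ext:
  assumes "J \<in> sets lebesgue"
  shows "(LINT x|lebesgue_on J. f x * g x) = (LINT x|lebesgue. zero_ext J f x * g x)"
proof -
  have "(LINT x|lebesgue_on J. f x * g x) = (LINT x|lebesgue. indicat_real J x *\<^sub>R (f x * g x))"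
    using assms by (intro integral_restrict_space) auto
  also have "\<dots> = (LINT x|lebesgue. zero_ext J f x * g x)"
    by (intro Bochner_Integration.integral_cong refl) (simp add: zero_ext_def indicator_def)
  finally show ?thesis .
qed

text \<open>
  The defining identity of the weak derivative remains true for the trapezoid, which is only Lipschitz
  continuous: it is the limit of the smoothed trapezoids, with dominated convergence on both
  sides.
\<close>

lemma weak_derivative_step:
  assumes w: "is_weak_derivative J u v" and J: "J \<in> sets lebesgue"
    and h: "a < b" "0 < h" "{a..b + 2 * h} \<subseteq> J"
  defines "U \<equiv> zero_ext J (ae_rep u)" and "V \<equiv> zero_ext J (ae_rep v)"
  shows "integral {a..a + h} U - integral {b..b + h} U
    = - (LINT x|lebesgue. V x * of_real (diff2 a b h (max 0) x))"
proof -
  have uv: "u \<in> carrier (L2_on J)" "v \<in> carrier (L2_on J)"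
    using w by (auto simp: is_weak_derivative_def)
  have L2: "U \<in> L2_fun lebesgue" "V \<in> L2_fun lebesgue"
    unfolding U_def V_def using L2_memD(1)[OF uv(1) ae_rep_in] L2_memD(1)[OF uv(2) ae_rep_in] uv J
    by (auto intro: zero_ext_L2)
  have [measurable]: "U \<in> borel_measurable lebesgue" "V \<in> borel_measurable lebesgue"
    using L2 by (auto simp: L2_fun_def)
  define K where "K = {a..b + 2 * h}"
  have int: "integrable lebesgue (\<lambda>x. B * cmod (F x) * indicat_real K x)" if "F \<in> L2_fun lebesgue" for F B
    using set_integrable_norm[OF L2_absolutely_integrable[OF that, of a "b + 2 * h"]]
    unfolding K_def set_integrable_def by (auto simp: mult_ac)
  have ev: "\<forall>\<^sub>F n in sequentially. 0 < n \<and> 1 / real n \<le> h"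
    by (rule eventually_inverse_le[OF h(2)])
  then obtain N where N: "\<And>n. N \<le> n \<Longrightarrow> 0 < n \<and> 1 / real n \<le> h"
    by (auto simp: eventually_sequentially)
  \<comment> \<open>from the index \<open>N\<close> on the smoothing is finer than \<open>h\<close> and the support stays inside \<open>[a, b + 2 h]\<close>\<close>
  define \<phi> where "\<phi> n x = complex_of_real (diff2 a b h (ramp (n + N)) x)" for n x
  define \<psi> where "\<psi> n x = complex_of_real (diff2 a b h (ramp' (n + N)) x)" for n x
  have tst: "(LINT x|lebesgue. U x * \<psi> n x) = - (LINT x|lebesgue. V x * \<phi> n x)" for n
  proof -
    have "test_function J (\<phi> n)"
      unfolding \<phi>_def using N[of "n + N"] h by (intro test_function_diff2) auto
    then have "(LINT x|lebesgue_on J. ae_rep u x * vector_derivative (\<phi> n) (at x))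
            = - (LINT x|lebesgue_on J. ae_rep v x * \<phi> n x)"
      using w unfolding is_weak_derivative_def by blast
    moreover have "vector_derivative (\<phi> n) (at x) = \<psi> n x" for x
      unfolding \<phi>_def \<psi>_def by (rule vector_derivative_at[OF diff2_ramp_deriv])
    ultimately have "(LINT x|lebesgue_on J. ae_rep u x * \<psi> n x) = - (LINT x|lebesgue_on J. ae_rep v x * \<phi> n x)"
      by simp
    then show ?thesis by (simp add: LINT_zero_ext[OF J] U_def V_def)
  qed
  define g where "g y = (if (0::real) < y then 1 else 0 :: real)" for y
  have lim1: "(\<lambda>n. LINT x|lebesgue. U x * \<psi> n x) \<longlonglongrightarrow> (LINT x|lebesgue. U x * of_real (diff2 a b h g x))"
  proof (rule integral_dominated_convergence)
    show "integrable lebesgue (\<lambda>x. 4 * cmod (U x) * indicat_real K x)"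
      by (rule int[OF L2(1)])
    show "AE x in lebesgue. (\<lambda>n. U x * \<psi> n x) \<longlonglongrightarrow> U x * of_real (diff2 a b h g x)"
      unfolding \<psi>_def diff2_def g_def
      by (intro AE_I2 tendsto_intros LIMSEQ_ignore_initial_segment ramp'_tendsto)
    show "AE x in lebesgue. cmod (U x * \<psi> n x) \<le> 4 * cmod (U x) * indicat_real K x" for n
    proof (rule AE_I2)
      fix x
      show "cmod (U x * \<psi> n x) \<le> 4 * cmod (U x) * indicat_real K x"
      proof (cases "x \<in> K")
        case True
        have "\<bar>diff2 a b h (ramp' (n + N)) x\<bar> \<le> 4 * 1"
          using ramp_bounds(1,2) by (intro diff2_bound) (simp add: abs_le_iff)
        then have "cmod (U x) * \<bar>diff2 a b h (ramp' (n + N)) x\<bar> \<le> cmod (U x) * 4"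
          by (intro mult_left_mono) auto
        then show ?thesis using True by (simp add: \<psi>_def norm_mult)
      next
        case False
        then show ?thesis
          using diff2_ramp_outside(2)[OF h(1,2)] N[of "n + N"] by (simp add: \<psi>_def K_def)
      qed
    qed
    show "(\<lambda>x. U x * \<psi> n x) \<in> borel_measurable lebesgue" for n
    proof -
      have "continuous_on UNIV (\<psi> n)"
        unfolding \<psi>_def diff2_def
        by (intro continuous_intros continuous_on_compose2[OF continuous_ramp'[of UNIV]]) auto
      then have "\<psi> n \<in> borel_measurable lebesgue"
        using borel_measurable_continuous_onI[of "\<psi> n"] by (simp add: measurable_completion)
      then show ?thesis by (intro borel_measurable_times) auto
    qed
    have "(\<lambda>x. diff2 a b h g x) \<in> borel_measurable borel"
      unfolding diff2_def g_def by measurable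
    then have "(\<lambda>x. diff2 a b h g x) \<in> borel_measurable lebesgue"
      by (simp add: measurable_completion)
    then show "(\<lambda>x. U x * of_real (diff2 a b h g x)) \<in> borel_measurable lebesgue"
      by (intro borel_measurable_times borel_measurable_of_real) auto
  qed
  have lim2: "(\<lambda>n. LINT x|lebesgue. V x * \<phi> n x) \<longlonglongrightarrow> (LINT x|lebesgue. V x * of_real (diff2 a b h (max 0) x))"
  proof (rule integral_dominated_convergence)
    define B where "B = b + 2 * h - a"
    show "integrable lebesgue (\<lambda>x. (4 * B) * cmod (V x) * indicat_real K x)"
      by (rule int[OF L2(2)])
    show "AE x in lebesgue. (\<lambda>n. V x * \<phi> n x) \<longlonglongrightarrow> V x * of_real (diff2 a b h (max 0) x)"
      unfolding \<phi>_def diff2_def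
      by (intro AE_I2 tendsto_intros LIMSEQ_ignore_initial_segment ramp_tendsto)
    show "AE x in lebesgue. cmod (V x * \<phi> n x) \<le> (4 * B) * cmod (V x) * indicat_real K x" for n
    proof (rule AE_I2)
      fix x
      show "cmod (V x * \<phi> n x) \<le> (4 * B) * cmod (V x) * indicat_real K x"
      proof (cases "x \<in> K")
        case True
        then have x: "a \<le> x" "x \<le> b + 2 * h" by (auto simp: K_def)
        have "\<bar>x - a\<bar> \<le> B" "\<bar>x - a - h\<bar> \<le> B" "\<bar>x - b\<bar> \<le> B" "\<bar>x - b - h\<bar> \<le> B"
          unfolding abs_le_iff B_def using x h(1,2) by linarith+
        then have "\<bar>ramp (n + N) (x - a)\<bar> \<le> B" "\<bar>ramp (n + N) (x - a - h)\<bar> \<le> B"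
          "\<bar>ramp (n + N) (x - b)\<bar> \<le> B" "\<bar>ramp (n + N) (x - b - h)\<bar> \<le> B"
          by (blast intro: order_trans ramp_bounds(3))+
        then have "\<bar>diff2 a b h (ramp (n + N)) x\<bar> \<le> 4 * B"
          unfolding diff2_def by linarith
        then have "cmod (V x) * \<bar>diff2 a b h (ramp (n + N)) x\<bar> \<le> cmod (V x) * (4 * B)"
          by (intro mult_left_mono) auto
        then show ?thesis using True by (simp add: \<phi>_def norm_mult mult_ac)
      next
        case False
        then show ?thesis
          using diff2_ramp_outside(1)[OF h(1,2)] N[of "n + N"] by (simp add: \<phi>_def K_def)
      qed
    qed
    show "(\<lambda>x. V x * \<phi> n x) \<in> borel_measurable lebesgue" for n
    proof -
      have "continuous_on UNIV (\<phi> n)"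
        using diff2_ramp_deriv unfolding \<phi>_def
        by (intro continuous_at_imp_continuous_on ballI) (rule has_vector_derivative_continuous)
      then have "\<phi> n \<in> borel_measurable lebesgue"
        using borel_measurable_continuous_onI[of "\<phi> n"] by (simp add: measurable_completion)
      then show ?thesis by (intro borel_measurable_times) auto
    qed
    have "(\<lambda>x. diff2 a b h (max 0) x) \<in> borel_measurable borel"
      unfolding diff2_def by measurable
    then have "(\<lambda>x. diff2 a b h (max 0) x) \<in> borel_measurable lebesgue"
      by (simp add: measurable_completion)
    then show "(\<lambda>x. V x * of_real (diff2 a b h (max 0) x)) \<in> borel_measurable lebesgue"
      by (intro borel_measurable_times borel_measurable_of_real) auto
  qed
  have "(LINT x|lebesgue. U x * of_real (diff2 a b h g x)) = - (LINT x|lebesgue. V x * of_real (diff2 a b h (max 0) x))"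
    using lim1 tendsto_minus[OF lim2] unfolding tst by (rule LIMSEQ_unique)
  moreover have "(LINT x|lebesgue. U x * of_real (diff2 a b h g x))
      = (LINT x|lebesgue. indicat_real {a..a + h} x *\<^sub>R U x - indicat_real {b..b + h} x *\<^sub>R U x)"
  proof (rule integral_cong_AE)
    have "{a, b} \<in> null_sets lebesgue"
      unfolding negligible_iff_null_sets[symmetric] by simp
    then have "AE x in lebesgue. x \<notin> {a, b}" by (rule AE_not_in)
    then show "AE x in lebesgue. U x * of_real (diff2 a b h g x)
        = indicat_real {a..a + h} x *\<^sub>R U x - indicat_real {b..b + h} x *\<^sub>R U x"
    proof eventually_elim
      fix x assume "x \<notin> {a, b}"
      then have eq: "diff2 a b h g x = indicat_real {a..a + h} x - indicat_real {b..b + h} x"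
        using h(1,2) by (auto simp: diff2_def g_def indicator_def)
      show "U x * of_real (diff2 a b h g x)
          = indicat_real {a..a + h} x *\<^sub>R U x - indicat_real {b..b + h} x *\<^sub>R U x"
        unfolding eq by (simp add: scaleR_conv_of_real algebra_simps)
    qed
    have "(\<lambda>x. diff2 a b h g x) \<in> borel_measurable borel"
      unfolding diff2_def g_def by measurable
    then have "(\<lambda>x. diff2 a b h g x) \<in> borel_measurable lebesgue"
      by (simp add: measurable_completion)
    then show "(\<lambda>x. U x * of_real (diff2 a b h g x)) \<in> borel_measurable lebesgue"
      by (intro borel_measurable_times borel_measurable_of_real) auto
    have m: "(\<lambda>x. indicat_real A x *\<^sub>R U x) \<in> borel_measurable lebesgue" if "A \<in> sets lebesgue" for A
      using that by (intro borel_measurable_scaleR borel_measurable_indicator) auto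
    show "(\<lambda>x. indicat_real {a..a + h} x *\<^sub>R U x - indicat_real {b..b + h} x *\<^sub>R U x)
        \<in> borel_measurable lebesgue"
      by (intro borel_measurable_diff m) auto
  qed
  moreover have "\<dots> = integral {a..a + h} U - integral {b..b + h} U"
    using L2_absolutely_integrable[OF L2(1), of a "a + h"] L2_absolutely_integrable[OF L2(1), of b "b + h"]
    unfolding LINT_interval[OF L2_absolutely_integrable[OF L2(1)], symmetric] set_integrable_def
    by (rule Bochner_Integration.integral_diff)
  ultimately show ?thesis by simp
qed

lemma diff2_max:
  assumes "a < b" "0 < h"
  shows "\<bar>diff2 a b h (max 0) x\<bar> \<le> h"
    and "x \<le> a \<Longrightarrow> diff2 a b h (max 0) x = 0"
    and "b + h \<le> x \<Longrightarrow> diff2 a b h (max 0) x = 0"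
    and "a + h \<le> x \<Longrightarrow> x \<le> b \<Longrightarrow> diff2 a b h (max 0) x = h"
  using assms unfolding diff2_def by (auto simp: max_def abs_le_iff)

lemma average_tendsto:
  assumes d: "\<And>e. 0 < e \<Longrightarrow> \<exists>d>0. \<forall>h. 0 < h \<and> h < d \<longrightarrow>
      norm (integral (cbox x (x + h *\<^sub>R One)) U /\<^sub>R h ^ DIM(real) - U x) < e"
    and h: "\<And>n. 0 < h n" "h \<longlonglongrightarrow> 0"
  shows "(\<lambda>n. integral {x..x + h n} U /\<^sub>R h n) \<longlonglongrightarrow> (U x :: complex)"
proof (rule metric_LIMSEQ_I)
  fix e :: real assume "0 < e"
  then obtain d where d: "0 < d" "\<And>h. 0 < h \<Longrightarrow> h < d \<Longrightarrow> norm (integral {x..x + h} U /\<^sub>R h - U x) < e"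
    using d[of e] by auto
  obtain N where "\<And>n. N \<le> n \<Longrightarrow> h n < d"
    using order_tendstoD(2)[OF h(2) d(1)] by (auto simp: eventually_sequentially)
  then show "\<exists>N. \<forall>n\<ge>N. dist (integral {x..x + h n} U /\<^sub>R h n) (U x) < e"
    using d(2) h(1) by (auto simp: dist_norm)
qed

text \<open>
  Divided by \<open>h\<close>, the trapezoid tends to the indicator of \<open>[a, b]\<close> as \<open>h\<close> tends to \<open>0\<close>, and the
  averages of \<open>u\<close> over \<open>[a, a + h]\<close> and \<open>[b, b + h]\<close> tend to its values at almost all points.
\<close>

lemma weak_derivative_increment:
  assumes w: "is_weak_derivative J u v" and J: "open J" "is_interval J"
  defines "U \<equiv> zero_ext J (ae_rep u)" and "V \<equiv> zero_ext J (ae_rep v)"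
  shows "\<exists>N. negligible N \<and> (\<forall>a\<in>J - N. \<forall>b\<in>J - N. a < b \<longrightarrow> U b - U a = integral {a..b} V)"
proof -
  have Jl: "J \<in> sets lebesgue" using J by (simp add: borel_open)
  have uv: "u \<in> carrier (L2_on J)" "v \<in> carrier (L2_on J)"
    using w by (auto simp: is_weak_derivative_def)
  have L2: "U \<in> L2_fun lebesgue" "V \<in> L2_fun lebesgue"
    unfolding U_def V_def using L2_memD(1)[OF uv(1) ae_rep_in] L2_memD(1)[OF uv(2) ae_rep_in] uv Jl
    by (auto intro: zero_ext_L2)
  have "U integrable_on cbox a b" for a b
    using L2_absolutely_integrable[OF L2(1), of a b] by (auto intro: set_lebesgue_integral_eq_integral(1))
  then obtain N where N: "negligible N"
    "\<And>x e. x \<notin> N \<Longrightarrow> 0 < e \<Longrightarrow> \<exists>d>0. \<forall>h. 0 < h \<and> h < d \<longrightarrow>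
      norm (integral (cbox x (x + h *\<^sub>R One)) U /\<^sub>R h ^ DIM(real) - U x) < e"
    by (rule integrable_ccontinuous_explicit) (blast intro: that)
  have "U b - U a = integral {a..b} V" if a: "a \<in> J - N" and b: "b \<in> J - N" and ab: "a < b" for a b
  proof -
    obtain r where r: "0 < r" "ball b r \<subseteq> J"
      using J(1) b openE by blast
    \<comment> \<open>trapezoids of width up to \<open>\<eta>\<close>, together with the margin for smoothing, stay inside \<open>J\<close>\<close>
    define \<eta> where "\<eta> = r / 3"
    have sub: "{a..b + 2 * \<eta>} \<subseteq> J"
    proof
      fix x assume x: "x \<in> {a..b + 2 * \<eta>}"
      show "x \<in> J"
      proof (cases "x \<le> b")
        case True
        then show ?thesis
          using J(2) a b x unfolding is_interval_1 by auto
      next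
        case False
        then have "x \<in> ball b r" using x r(1) by (auto simp: dist_real_def \<eta>_def)
        then show ?thesis using r by auto
      qed
    qed
    define h where "h n = \<eta> / real (Suc n)" for n
    have \<eta>: "0 < \<eta>" using r by (simp add: \<eta>_def)
    have h: "0 < h n" "h n \<le> \<eta>" for n
      unfolding h_def using \<eta> by (auto simp: field_simps)
    have "(\<lambda>n. \<eta> * (1 / real (Suc n))) \<longlonglongrightarrow> \<eta> * 0"
      by (intro tendsto_intros LIMSEQ_Suc[OF lim_1_over_n])
    then have h0: "h \<longlonglongrightarrow> 0" by (simp add: h_def[abs_def])
    have lhs: "(\<lambda>n. integral {a..a + h n} U /\<^sub>R h n - integral {b..b + h n} U /\<^sub>R h n) \<longlonglongrightarrow> U a - U b"
      using a b h h0 by (intro tendsto_diff average_tendsto N(2)) auto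
    define k where "k n x = diff2 a b (h n) (max 0) x / h n" for n x
    have "(integral {a..a + h n} U - integral {b..b + h n} U) /\<^sub>R h n
        = - (LINT x|lebesgue. V x * of_real (k n x))" for n
    proof -
      have "{a..b + 2 * h n} \<subseteq> J" using sub h(2)[of n] by (auto simp: subset_iff)
      then have "integral {a..a + h n} U - integral {b..b + h n} U
          = - (LINT x|lebesgue. V x * of_real (diff2 a b (h n) (max 0) x))"
        unfolding U_def V_def by (intro weak_derivative_step w Jl ab h(1))
      then have "(integral {a..a + h n} U - integral {b..b + h n} U) /\<^sub>R h n
          = - (LINT x|lebesgue. V x * of_real (diff2 a b (h n) (max 0) x) * of_real (1 / h n))"
        by (simp add: scaleR_conv_of_real divide_inverse mult.commute)
      also have "\<dots> = - (LINT x|lebesgue. V x * of_real (k n x))"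
        by (simp add: k_def mult.assoc)
      finally show ?thesis .
    qed
    then have eq: "integral {a..a + h n} U /\<^sub>R h n - integral {b..b + h n} U /\<^sub>R h n
        = - (LINT x|lebesgue. V x * of_real (k n x))" for n
      by (simp add: scaleR_diff_right)
    have "(\<lambda>n. LINT x|lebesgue. V x * of_real (k n x)) \<longlonglongrightarrow> (LINT x|lebesgue. indicat_real {a..b} x *\<^sub>R V x)"
    proof (rule integral_dominated_convergence)
      show "integrable lebesgue (\<lambda>x. cmod (V x) * indicat_real {a..b + \<eta>} x)"
        using set_integrable_norm[OF L2_absolutely_integrable[OF L2(2), of a "b + \<eta>"]]
        unfolding set_integrable_def by (auto simp: mult_ac)
      have "{a, b} \<in> null_sets lebesgue"
        unfolding negligible_iff_null_sets[symmetric] by simp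
      then have "AE x in lebesgue. x \<notin> {a, b}" by (rule AE_not_in)
      then show "AE x in lebesgue. (\<lambda>n. V x * of_real (k n x)) \<longlonglongrightarrow> indicat_real {a..b} x *\<^sub>R V x"
      proof eventually_elim
        fix x assume x: "x \<notin> {a, b}"
        have "\<forall>\<^sub>F n in sequentially. k n x = indicat_real {a..b} x"
        proof -
          consider "x < a" | "a < x" "x < b" | "b < x" using x by fastforce
          then show ?thesis
          proof cases
            case 1
            then show ?thesis using diff2_max(2)[OF ab h(1)] by (auto simp: k_def)
          next
            case 2
            have "\<forall>\<^sub>F n in sequentially. h n < x - a"
              using order_tendstoD(2)[OF h0, of "x - a"] 2 by simp
            then show ?thesis
            proof eventually_elim
              case (elim n)
              then have "diff2 a b (h n) (max 0) x = h n"
                using 2 by (intro diff2_max(4)[OF ab h(1)]) auto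
              then show ?case using 2 h(1)[of n] by (simp add: k_def)
            qed
          next
            case 3
            have "\<forall>\<^sub>F n in sequentially. h n < x - b"
              using order_tendstoD(2)[OF h0, of "x - b"] 3 by simp
            then show ?thesis
            proof eventually_elim
              case (elim n)
              then have "diff2 a b (h n) (max 0) x = 0"
                using 3 by (intro diff2_max(3)[OF ab h(1)]) auto
              then show ?case using 3 by (simp add: k_def)
            qed
          qed
        qed
        then have "\<forall>\<^sub>F n in sequentially. V x * of_real (k n x) = indicat_real {a..b} x *\<^sub>R V x"
          by eventually_elim (simp add: scaleR_conv_of_real)
        then show "(\<lambda>n. V x * of_real (k n x)) \<longlonglongrightarrow> indicat_real {a..b} x *\<^sub>R V x"
          by (rule tendsto_eventually)
      qed
      show "AE x in lebesgue. cmod (V x * of_real (k n x)) \<le> cmod (V x) * indicat_real {a..b + \<eta>} x" for n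
      proof (rule AE_I2)
        fix x
        show "cmod (V x * of_real (k n x)) \<le> cmod (V x) * indicat_real {a..b + \<eta>} x"
        proof (cases "x \<in> {a..b + \<eta>}")
          case True
          have "\<bar>k n x\<bar> \<le> 1"
            using diff2_max(1)[OF ab h(1), of n x] h(1)[of n] by (simp add: k_def)
          then have "cmod (V x) * \<bar>k n x\<bar> \<le> cmod (V x) * 1" by (intro mult_left_mono) auto
          then show ?thesis using True by (simp add: norm_mult)
        next
          case False
          then have "x \<le> a \<or> b + h n \<le> x" using h(2)[of n] by auto
          then have "k n x = 0"
            using diff2_max(2)[OF ab h(1), of x n] diff2_max(3)[OF ab h(1), of n x] by (auto simp: k_def)
          then show ?thesis by simp
        qed
      qed
      show "(\<lambda>x. V x * of_real (k n x)) \<in> borel_measurable lebesgue" for n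
      proof -
        have "k n \<in> borel_measurable borel"
          unfolding k_def diff2_def by measurable
        then have "k n \<in> borel_measurable lebesgue"
          by (simp add: measurable_completion)
        then show ?thesis
          using L2_fun_measurable[OF L2(2)] by (intro borel_measurable_times borel_measurable_of_real) auto
      qed
      show "(\<lambda>x. indicat_real {a..b} x *\<^sub>R V x) \<in> borel_measurable lebesgue"
        using L2_fun_measurable[OF L2(2)] by (intro borel_measurable_scaleR borel_measurable_indicator) auto
    qed
    then have "(\<lambda>n. - (LINT x|lebesgue. V x * of_real (k n x))) \<longlonglongrightarrow> - integral {a..b} V"
      unfolding LINT_interval[OF L2_absolutely_integrable[OF L2(2)]] by (rule tendsto_minus)
    from LIMSEQ_unique[OF lhs[unfolded eq] this] show ?thesis
      by (simp add: algebra_simps)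
  qed
  then show ?thesis using N(1) by blast
qed

subsection \<open>Uniqueness and boundary values\<close>

text \<open>
  The two kinds of edges of the tadpole graph.  Both start at \<open>0\<close>, which serves as the base point of
  indefinite integrals.
\<close>

definition edge :: "real set \<Rightarrow> bool" where
  "edge J \<longleftrightarrow> J = {0<..} \<or> (\<exists>L>0. J = {0<..<L})"

lemma edge_halfline [simp]: "edge {0<..}" and edge_loop [simp]: "L > 0 \<Longrightarrow> edge {0<..<L}"
  by (auto simp: edge_def)

lemma
  assumes "edge J"
  shows edge_open: "open J" and edge_interval: "is_interval J" and edge_nonempty: "J \<noteq> {}"
    and edge_lebesgue: "J \<in> sets lebesgue"
proof -
  show op: "open J" "is_interval J"
    using assms by (auto simp: edge_def is_interval_1)
  show "J \<noteq> {}"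
    using assms dense[of 0] gt_ex[of 0] unfolding edge_def by fastforce
  show "J \<in> sets lebesgue" using op by (simp add: borel_open)
qed

lemma
  assumes "edge J"
  shows edge_closure_cases: "(J = {0<..} \<and> closure J = {0..}) \<or> (\<exists>L>0. J = {0<..<L} \<and> closure J = {0..L})"
  using assms by (auto simp: edge_def)

lemma
  assumes "edge J"
  shows edge_zero: "0 \<in> closure J" and edge_nonneg: "x \<in> closure J \<Longrightarrow> 0 \<le> x"
    and edge_below: "x \<in> closure J \<Longrightarrow> {0<..<x} \<subseteq> J"
    and edge_between: "x \<in> closure J \<Longrightarrow> 0 \<le> y \<Longrightarrow> y \<le> x \<Longrightarrow> y \<in> closure J"
    and edge_pos: "x \<in> J \<Longrightarrow> 0 < x" and edge_sub: "x \<in> J \<Longrightarrow> x \<in> closure J"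
proof -
  have "0 \<in> closure J \<and> (x \<in> closure J \<longrightarrow> 0 \<le> x) \<and> (x \<in> closure J \<longrightarrow> {0<..<x} \<subseteq> J)
    \<and> (x \<in> closure J \<longrightarrow> 0 \<le> y \<longrightarrow> y \<le> x \<longrightarrow> y \<in> closure J)
    \<and> (x \<in> J \<longrightarrow> 0 < x) \<and> (x \<in> J \<longrightarrow> x \<in> closure J)"
    using edge_closure_cases[OF assms]
  proof (elim disjE exE conjE)
    fix L :: real assume "0 < L" "J = {0<..<L}" "closure J = {0..L}"
    then show ?thesis by (simp add: subset_iff)
  qed (simp add: subset_iff)
  then show "0 \<in> closure J" "x \<in> closure J \<Longrightarrow> 0 \<le> x" "x \<in> closure J \<Longrightarrow> {0<..<x} \<subseteq> J"
    "x \<in> closure J \<Longrightarrow> 0 \<le> y \<Longrightarrow> y \<le> x \<Longrightarrow> y \<in> closure J"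
    "x \<in> J \<Longrightarrow> 0 < x" "x \<in> J \<Longrightarrow> x \<in> closure J"
    by blast+
qed

lemma continuous_rep_unique:
  assumes J: "open J" and u: "u \<in> carrier (L2_on J)"
    and f: "f \<in> u" "continuous_on J f" and g: "g \<in> u" "continuous_on J g" and x: "x \<in> J"
  shows "f x = g x"
proof -
  have Jl: "J \<in> sets lebesgue" using J by (simp add: borel_open)
  have "AE x in lebesgue_on J. f x = g x" by (rule L2_mem_AE[OF u f(1) g(1)])
  then have "AE x in lebesgue. x \<in> J \<longrightarrow> f x = g x"
    using Jl by (simp add: AE_restrict_space_iff)
  then obtain N where N': "\<And>x. x \<in> space lebesgue - N \<Longrightarrow> x \<in> J \<longrightarrow> f x = g x" and N0: "N \<in> null_sets lebesgue"
    by (rule AE_E3) (blast intro: that)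
  then have N: "N \<in> null_sets lebesgue" "{x. \<not> (x \<in> J \<longrightarrow> f x = g x)} \<subseteq> N"
    by auto
  \<comment> \<open>the set where the two functions differ is open and null\<close>
  define S where "S = {x \<in> J. f x - g x \<in> - {0}}"
  have "open S" unfolding S_def
    using continuous_on_diff[OF f(2) g(2)] J by (intro continuous_open_preimage[unfolded vimage_def Int_def, simplified]) auto
  moreover have "negligible S"
    using N negligible_subset[of N S] by (auto simp: negligible_iff_null_sets S_def)
  ultimately have "S = {}" using open_not_negligible by blast
  then show ?thesis using x by (auto simp: S_def)
qed

lemma continuous_rep_unique_closure:
  assumes J: "open J" and u: "u \<in> carrier (L2_on J)"
    and f: "f \<in> u" "continuous_on (closure J) f" and g: "g \<in> u" "continuous_on (closure J) g"
    and x: "x \<in> closure J"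
  shows "f x = g x"
proof -
  have "continuous_on (closure J) (\<lambda>x. f x - g x)"
    using f g by (intro continuous_intros)
  moreover have "f y - g y = 0" if "y \<in> J" for y
    using continuous_rep_unique[OF J u f(1) _ g(1) _ that] f(2) g(2) closure_subset
    by (auto intro: continuous_on_subset)
  ultimately have "f x - g x = 0"
    by (rule continuous_constant_on_closure[OF _ _ x])
  then show ?thesis by simp
qed

lemma continuous_on_indefinite_integral_edge:
  assumes "edge J" and F: "\<And>a b. F integrable_on {a..b::real}"
  shows "continuous_on (closure J) (\<lambda>x. integral {0..x} (F :: real \<Rightarrow> complex))"
proof -
  have "continuous_on {0..} (\<lambda>x. integral {0..x} F)"
    unfolding continuous_on_eq_continuous_within
  proof
    fix x :: real assume x: "x \<in> {0..}"
    have "at x within {0..} = at x within {0..x + 1}"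
      by (rule at_within_nhd[of x "{..<x + 1}"]) auto
    moreover have "continuous (at x within {0..x + 1}) (\<lambda>x. integral {0..x} F)"
      using indefinite_integral_continuous_1[OF F, of 0 "x + 1"] x
      by (auto simp: continuous_on_eq_continuous_within)
    ultimately show "continuous (at x within {0..}) (\<lambda>x. integral {0..x} F)" by simp
  qed
  moreover have "closure J \<subseteq> {0..}" using edge_nonneg[OF assms(1)] by auto
  ultimately show ?thesis by (rule continuous_on_subset)
qed

lemma edge_integral_increment:
  assumes F: "\<And>a b. F integrable_on {a..b::real}" and ab: "0 \<le> a" "a \<le> b"
  shows "integral {0..b} F - integral {0..a} F = integral {a..b} (F :: real \<Rightarrow> complex)"
  using Henstock_Kurzweil_Integration.integral_combine[OF ab F] by (simp add: algebra_simps)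

text \<open>
  The representative is anchored at one point \<open>x0\<close> outside the exceptional null set and continued by the
  indefinite integral of the weak derivative.
\<close>

lemma weak_derivative_continuous_rep:
  assumes e: "edge J" and w: "is_weak_derivative J u v"
  shows "\<exists>f\<in>u. continuous_on (closure J) f
    \<and> (\<forall>x\<in>closure J. f x = f 0 + integral {0..x} (zero_ext J (ae_rep v)))"
proof -
  define U where "U = zero_ext J (ae_rep u)"
  define V where "V = zero_ext J (ae_rep v)"
  note J = edge_open[OF e] edge_interval[OF e] edge_lebesgue[OF e]
  have uv: "u \<in> carrier (L2_on J)" "v \<in> carrier (L2_on J)"
    using w by (auto simp: is_weak_derivative_def)
  have "V \<in> L2_fun lebesgue"
    unfolding V_def using L2_memD(1)[OF uv(2) ae_rep_in] uv J by (auto intro: zero_ext_L2)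
  then have Vint: "V integrable_on {a..b}" for a b
    using L2_absolutely_integrable set_lebesgue_integral_eq_integral(1) by blast
  obtain N where N: "negligible N"
    "\<And>a b. a \<in> J - N \<Longrightarrow> b \<in> J - N \<Longrightarrow> a < b \<Longrightarrow> U b - U a = integral {a..b} V"
    using weak_derivative_increment[OF w J(1,2)] unfolding U_def V_def by blast
  have "\<not> J \<subseteq> N"
    using N(1) negligible_subset open_not_negligible[OF J(1) edge_nonempty[OF e]] by blast
  then obtain x0 where x0: "x0 \<in> J - N" by blast
  define c where "c = U x0 - integral {0..x0} V"
  define f where "f x = c + integral {0..x} V" for x
  have cont: "continuous_on (closure J) f"
    unfolding f_def by (intro continuous_intros continuous_on_indefinite_integral_edge e Vint)
  have fU: "f x = U x" if x: "x \<in> J - N" for x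
  proof -
    consider "x < x0" | "x = x0" | "x0 < x" by linarith
    then show ?thesis
    proof cases
      case 1
      have "U x0 - U x = integral {0..x0} V - integral {0..x} V"
        using N(2)[OF x x0 1] edge_integral_increment[OF Vint, of x x0] edge_pos[OF e, of x] x 1 by simp
      then show ?thesis by (simp add: f_def c_def algebra_simps)
    next
      case 3
      have "U x - U x0 = integral {0..x} V - integral {0..x0} V"
        using N(2)[OF x0 x 3] edge_integral_increment[OF Vint, of x0 x] edge_pos[OF e, of x0] x0 3 by simp
      then show ?thesis by (simp add: f_def c_def algebra_simps)
    qed (simp add: f_def c_def)
  qed
  have "f \<in> u"
  proof -
    have "AE x in lebesgue. x \<notin> N" using N(1) by (intro AE_not_in) (simp add: negligible_iff_null_sets)
    then have "AE x in lebesgue. x \<in> J \<longrightarrow> f x = ae_rep u x"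
      by eventually_elim (use fU in \<open>auto simp: U_def zero_ext_def\<close>)
    then have "AE x in lebesgue_on J. f x = ae_rep u x"
      using J(3) by (simp add: AE_restrict_space_iff)
    moreover have "f \<in> borel_measurable (lebesgue_on J)"
      using cont closure_subset J(3)
      by (intro continuous_imp_measurable_on_sets_lebesgue) (auto intro: continuous_on_subset)
    ultimately have "f \<in> ae_class (lebesgue_on J) (ae_rep u)"
      by (simp add: ae_class_def)
    then show ?thesis using L2_memD(2)[OF uv(1) ae_rep_in[OF uv(1)]] by simp
  qed
  moreover have "f x = f 0 + integral {0..x} V" for x
    by (simp add: f_def)
  ultimately show ?thesis using cont unfolding V_def by blast
qed

text \<open>
  Two weak derivatives have the same indefinite integral, namely the increment of the continuous
  representative, so their difference vanishes at its Lebesgue points.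
\<close>

lemma weak_derivative_unique:
  assumes e: "edge J" and w: "is_weak_derivative J u v" "is_weak_derivative J u v'"
  shows "v = v'"
proof -
  note J = edge_open[OF e] edge_interval[OF e] edge_lebesgue[OF e]
  have c: "u \<in> carrier (L2_on J)" "v \<in> carrier (L2_on J)" "v' \<in> carrier (L2_on J)"
    using w by (auto simp: is_weak_derivative_def)
  define V where "V = zero_ext J (ae_rep v)"
  define V' where "V' = zero_ext J (ae_rep v')"
  have L2: "V \<in> L2_fun lebesgue" "V' \<in> L2_fun lebesgue"
    unfolding V_def V'_def using L2_memD(1)[OF c(2) ae_rep_in] L2_memD(1)[OF c(3) ae_rep_in] c J
    by (auto intro: zero_ext_L2)
  have Vint: "V integrable_on {a..b}" "V' integrable_on {a..b}" for a b
    using L2_absolutely_integrable L2 set_lebesgue_integral_eq_integral(1) by blast+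
  obtain f where f: "f \<in> u" "continuous_on (closure J) f"
    "\<And>x. x \<in> closure J \<Longrightarrow> f x = f 0 + integral {0..x} V"
    using weak_derivative_continuous_rep[OF e w(1)] unfolding V_def by blast
  obtain g where g: "g \<in> u" "continuous_on (closure J) g"
    "\<And>x. x \<in> closure J \<Longrightarrow> g x = g 0 + integral {0..x} V'"
    using weak_derivative_continuous_rep[OF e w(2)] unfolding V'_def by blast
  have fg: "f x = g x" if "x \<in> closure J" for x
    by (rule continuous_rep_unique_closure[OF J(1) c(1) f(1,2) g(1,2) that])
  define W where "W x = V x - V' x" for x
  have Wint: "W integrable_on {a..b}" for a b
    unfolding W_def using Vint by (intro integrable_diff) auto
  have W0: "integral {0..x} W = 0" if "x \<in> closure J" for x
    using f(3)[OF that] g(3)[OF that] fg[OF that] fg[OF edge_zero[OF e]] Vint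
    unfolding W_def by (subst Henstock_Kurzweil_Integration.integral_diff) auto
  have "\<And>a b. W integrable_on cbox a b" using Wint by simp
  then obtain N where N: "negligible N"
    "\<And>x e. x \<notin> N \<Longrightarrow> 0 < e \<Longrightarrow> \<exists>d>0. \<forall>h. 0 < h \<and> h < d \<longrightarrow>
      norm (integral (cbox x (x + h *\<^sub>R One)) W /\<^sub>R h ^ DIM(real) - W x) < e"
    by (rule integrable_ccontinuous_explicit) (blast intro: that)
  have W: "W x = 0" if x: "x \<in> J" "x \<notin> N" for x
  proof (rule ccontr)
    assume "W x \<noteq> 0"
    then obtain d where d: "d > 0"
      "\<And>h. 0 < h \<Longrightarrow> h < d \<Longrightarrow> norm (integral {x..x + h} W /\<^sub>R h - W x) < norm (W x)"
      using N(2)[OF x(2), of "norm (W x)"] by auto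
    obtain r where r: "r > 0" "ball x r \<subseteq> J" using J(1) x(1) openE by blast
    \<comment> \<open>the average over \<open>[x, x + h]\<close> is zero, although it should be close to \<open>W x\<close>\<close>
    define h where "h = min (d / 2) (r / 2)"
    have h: "0 < h" "h < d" "h < r" using d(1) r(1) by (auto simp: h_def)
    then have "x + h \<in> J" using r(2) by (auto simp: dist_real_def)
    then have "integral {x..x + h} W = 0"
      using edge_integral_increment[OF Wint, of x "x + h"] W0[OF edge_sub[OF e]] x(1) h(1) edge_pos[OF e x(1)]
      by simp
    then show False using d(2)[OF h(1,2)] by simp
  qed
  have "AE x in lebesgue. x \<notin> N" using N(1) by (intro AE_not_in) (simp add: negligible_iff_null_sets)
  then have "AE x in lebesgue. x \<in> J \<longrightarrow> ae_rep v x = ae_rep v' x"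
    by eventually_elim (use W in \<open>auto simp: W_def V_def V'_def zero_ext_def\<close>)
  then have "AE x in lebesgue_on J. ae_rep v x = ae_rep v' x"
    using J(3) by (simp add: AE_restrict_space_iff)
  then have "ae_class (lebesgue_on J) (ae_rep v) = ae_class (lebesgue_on J) (ae_rep v')"
    using L2_memD(1)[OF c(2) ae_rep_in[OF c(2)]] L2_memD(1)[OF c(3) ae_rep_in[OF c(3)]]
    by (subst ae_class_eq_iff) (auto intro: L2_fun_measurable)
  then show ?thesis
    using L2_memD(2)[OF c(2) ae_rep_in[OF c(2)]] L2_memD(2)[OF c(3) ae_rep_in[OF c(3)]] by simp
qed

lemma weak_derivative_eq: "edge J \<Longrightarrow> is_weak_derivative J u v \<Longrightarrow> weak_derivative J u = v"
  unfolding weak_derivative_def by (rule the_equality, assumption, rule weak_derivative_unique)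

lemma sobolev_H1_weak: "edge J \<Longrightarrow> u \<in> sobolev_H1 J \<Longrightarrow> is_weak_derivative J u (weak_derivative J u)"
  unfolding sobolev_H1_def using weak_derivative_eq by blast

text \<open>
  With a representative that is continuous up to the boundary, the description in the definition of the
  boundary value is satisfied by exactly one number.
\<close>

lemma boundary_value_eq:
  assumes e: "edge J" and u: "u \<in> carrier (L2_on J)"
    and f: "f \<in> u" "continuous_on (closure J) f" and a: "a \<in> closure J"
  shows "boundary_value J a u = f a"
proof -
  have lim: "(f \<longlongrightarrow> f a) (at a within J)"
    using f(2) a closure_subset[of J] by (auto simp: continuous_on_def intro: tendsto_within_subset)
  have nb: "at a within J \<noteq> bot"
  proof -
    have "a islimpt J"
    proof (cases "a \<in> J")
      case True
      then have "a \<in> interior J" using edge_open[OF e] by (simp add: interior_open)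
      then show ?thesis by (rule interior_limit_point)
    next
      case False
      then show ?thesis using a by (simp add: closure_def)
    qed
    then show ?thesis by (simp add: trivial_limit_within)
  qed
  have cJ: "continuous_on J f" using f(2) closure_subset by (rule continuous_on_subset)
  show ?thesis
    unfolding boundary_value_def
  proof (rule the_equality)
    show "\<exists>f'\<in>u. continuous_on J f' \<and> (f' \<longlongrightarrow> f a) (at a within J)"
      using f(1) cJ lim by blast
  next
    fix c assume "\<exists>f'\<in>u. continuous_on J f' \<and> (f' \<longlongrightarrow> c) (at a within J)"
    then obtain g where g: "g \<in> u" "continuous_on J g" "(g \<longlongrightarrow> c) (at a within J)" by blast
    have "\<forall>\<^sub>F x in at a within J. g x = f x"
      using continuous_rep_unique[OF edge_open[OF e] u g(1,2) f(1) cJ]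
      by (auto simp: eventually_at_filter)
    then have "(f \<longlongrightarrow> c) (at a within J)" using g(3) tendsto_cong by blast
    then show "c = f a" using lim nb tendsto_unique by blast
  qed
qed

lemma compact_support_L2:
  fixes h :: "real \<Rightarrow> complex"
  assumes "continuous_on UNIV h" "compact K" "\<And>x. x \<notin> K \<Longrightarrow> h x = 0" "J \<in> sets lebesgue"
  shows "h \<in> L2_fun (lebesgue_on J)"
proof -
  have "bounded (h ` K)"
    using assms(1,2) by (intro compact_imp_bounded compact_continuous_image) (auto intro: continuous_on_subset)
  then obtain B where B: "\<And>x. x \<in> K \<Longrightarrow> cmod (h x) \<le> B" by (auto simp: bounded_iff)
  have m: "h \<in> borel_measurable lebesgue"
    using borel_measurable_continuous_onI[OF assms(1)] by (simp add: measurable_completion)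
  have "integrable lebesgue (\<lambda>x. (cmod (h x))\<^sup>2)"
  proof (rule Bochner_Integration.integrable_bound)
    have "K \<in> lmeasurable" using assms(2) by (rule lmeasurable_compact)
    then have "integrable lebesgue (indicat_real K)"
      by (simp add: lmeasurable_iff_integrable)
    then show "integrable lebesgue (\<lambda>x. indicat_real K x * B\<^sup>2)"
      by (rule integrable_mult_left)
    show "AE x in lebesgue. norm ((cmod (h x))\<^sup>2) \<le> norm (indicat_real K x * B\<^sup>2)"
    proof (rule AE_I2)
      fix x
      show "norm ((cmod (h x))\<^sup>2) \<le> norm (indicat_real K x * B\<^sup>2)"
        using B[of x] assms(3)[of x] by (cases "x \<in> K") (auto intro!: power_mono)
    qed
    show "(\<lambda>x. (cmod (h x))\<^sup>2) \<in> borel_measurable lebesgue" using m by simp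
  qed
  then have "integrable (lebesgue_on J) (\<lambda>x. (cmod (h x))\<^sup>2)"
    using integrable_mult_indicator[OF assms(4)] assms(4)
    by (subst integrable_restrict_space) (simp_all del: real_scaleR_def)
  moreover have "h \<in> borel_measurable (lebesgue_on J)"
    using m by (rule measurable_restrict_space1)
  ultimately show ?thesis by (simp add: L2_fun_def)
qed

lemma test_function_L2:
  assumes "test_function J \<phi>" and J: "J \<in> sets lebesgue"
  shows "\<phi> \<in> L2_fun (lebesgue_on J)" "(\<lambda>x. vector_derivative \<phi> (at x)) \<in> L2_fun (lebesgue_on J)"
proof -
  obtain K where K: "compact K" "\<And>x. x \<notin> K \<Longrightarrow> \<phi> x = 0"
    using assms(1) by (auto simp: test_function_def)
  have d: "\<And>x. \<phi> differentiable at x" and c: "continuous_on UNIV (\<lambda>x. vector_derivative \<phi> (at x))"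
    using assms(1) by (auto simp: test_function_def C1_differentiable_on_eq)
  show "\<phi> \<in> L2_fun (lebesgue_on J)"
    using d K J by (intro compact_support_L2[of _ K])
      (auto intro: continuous_at_imp_continuous_on differentiable_imp_continuous_within)
  have "vector_derivative \<phi> (at x) = 0" if x: "x \<notin> K" for x
  proof (rule vector_derivative_at)
    show "(\<phi> has_vector_derivative 0) (at x)"
      by (rule has_vector_derivative_transform_within_open[of "\<lambda>_. 0" 0 x "- K"])
        (use x K compact_imp_closed in auto)
  qed
  then show "(\<lambda>x. vector_derivative \<phi> (at x)) \<in> L2_fun (lebesgue_on J)"
    by (rule compact_support_L2[OF c K(1) _ J])
qed

lemma LINT_ae_rep:
  assumes "u \<in> carrier (L2_space M)" "f \<in> u" "g \<in> borel_measurable M"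
  shows "(LINT x|M. ae_rep u x * g x) = (LINT x|M. f x * g x)"
proof (rule integral_cong_AE)
  show "AE x in M. ae_rep u x * g x = f x * g x"
    using L2_mem_AE[OF assms(1) ae_rep_in[OF assms(1)] assms(2)] by eventually_elim simp
  show "(\<lambda>x. ae_rep u x * g x) \<in> borel_measurable M" "(\<lambda>x. f x * g x) \<in> borel_measurable M"
    using L2_fun_measurable[OF L2_memD(1)[OF assms(1) ae_rep_in[OF assms(1)]]]
      L2_fun_measurable[OF L2_memD(1)[OF assms(1,2)]] assms(3)
    by (auto intro!: borel_measurable_times)
qed

lemma
  assumes pq: "p \<in> carrier (L2_space M)" "q \<in> carrier (L2_space M)"
  shows L2_lincomb_in: "p \<oplus>\<^bsub>L2_space M\<^esub> c \<odot>\<^bsub>L2_space M\<^esub> q \<in> carrier (L2_space M)"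
    and L2_lincomb_mem: "f \<in> p \<Longrightarrow> g \<in> q \<Longrightarrow> (\<lambda>x. f x + c * g x) \<in> p \<oplus>\<^bsub>L2_space M\<^esub> c \<odot>\<^bsub>L2_space M\<^esub> q"
    and LINT_lincomb: "h \<in> L2_fun M \<Longrightarrow> (LINT x|M. ae_rep (p \<oplus>\<^bsub>L2_space M\<^esub> c \<odot>\<^bsub>L2_space M\<^esub> q) x * h x)
      = (LINT x|M. ae_rep p x * h x) + c * (LINT x|M. ae_rep q x * h x)"
proof -
  have eq: "p \<oplus>\<^bsub>L2_space M\<^esub> c \<odot>\<^bsub>L2_space M\<^esub> q = ae_class M (\<lambda>x. f x + c * g x)"
    and fg: "(\<lambda>x. f x + c * g x) \<in> L2_fun M" if "f \<in> p" "g \<in> q" for f g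
  proof -
    note f = L2_memD[OF pq(1) that(1)] and g = L2_memD[OF pq(2) that(2)]
    have "p \<oplus>\<^bsub>L2_space M\<^esub> c \<odot>\<^bsub>L2_space M\<^esub> q
        = ae_class M f \<oplus>\<^bsub>L2_space M\<^esub> c \<odot>\<^bsub>L2_space M\<^esub> ae_class M g"
      using f(2) g(2) by simp
    also have "\<dots> = ae_class M (\<lambda>x. f x + c * g x)"
      using f(1) g(1) by (simp add: L2_smult L2_add L2_fun_scale)
    finally show "p \<oplus>\<^bsub>L2_space M\<^esub> c \<odot>\<^bsub>L2_space M\<^esub> q = ae_class M (\<lambda>x. f x + c * g x)" .
    show "(\<lambda>x. f x + c * g x) \<in> L2_fun M" using f(1) g(1) by (simp add: L2_fun_add L2_fun_scale)
  qed
  show car: "p \<oplus>\<^bsub>L2_space M\<^esub> c \<odot>\<^bsub>L2_space M\<^esub> q \<in> carrier (L2_space M)"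
    unfolding eq[OF ae_rep_in[OF pq(1)] ae_rep_in[OF pq(2)]]
    by (rule ae_class_in_L2[OF fg[OF ae_rep_in[OF pq(1)] ae_rep_in[OF pq(2)]]])
  show mem: "(\<lambda>x. f x + c * g x) \<in> p \<oplus>\<^bsub>L2_space M\<^esub> c \<odot>\<^bsub>L2_space M\<^esub> q" if "f \<in> p" "g \<in> q" for f g
    unfolding eq[OF that] by (rule ae_class_self[OF L2_fun_measurable[OF fg[OF that]]])
  show "(LINT x|M. ae_rep (p \<oplus>\<^bsub>L2_space M\<^esub> c \<odot>\<^bsub>L2_space M\<^esub> q) x * h x)
      = (LINT x|M. ae_rep p x * h x) + c * (LINT x|M. ae_rep q x * h x)" if h: "h \<in> L2_fun M"
  proof -
    have "(LINT x|M. ae_rep (p \<oplus>\<^bsub>L2_space M\<^esub> c \<odot>\<^bsub>L2_space M\<^esub> q) x * h x)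
        = (LINT x|M. (ae_rep p x + c * ae_rep q x) * h x)"
      using car mem[OF ae_rep_in[OF pq(1)] ae_rep_in[OF pq(2)]] L2_fun_measurable[OF h]
      by (rule LINT_ae_rep)
    also have "\<dots> = (LINT x|M. ae_rep p x * h x + c * (ae_rep q x * h x))"
      by (simp add: algebra_simps)
    also have "\<dots> = (LINT x|M. ae_rep p x * h x) + c * (LINT x|M. ae_rep q x * h x)"
      using integrable_mult_L2[OF L2_memD(1)[OF pq(1) ae_rep_in[OF pq(1)]] h]
        integrable_mult_L2[OF L2_memD(1)[OF pq(2) ae_rep_in[OF pq(2)]] h] by simp
    finally show ?thesis .
  qed
qed

lemma is_weak_derivative_lincomb:
  assumes J: "J \<in> sets lebesgue"
    and w: "is_weak_derivative J u v" "is_weak_derivative J u' v'"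
  shows "is_weak_derivative J (u \<oplus>\<^bsub>L2_on J\<^esub> c \<odot>\<^bsub>L2_on J\<^esub> u') (v \<oplus>\<^bsub>L2_on J\<^esub> c \<odot>\<^bsub>L2_on J\<^esub> v')"
proof -
  have c: "u \<in> carrier (L2_on J)" "v \<in> carrier (L2_on J)" "u' \<in> carrier (L2_on J)" "v' \<in> carrier (L2_on J)"
    using w by (auto simp: is_weak_derivative_def)
  show ?thesis
    unfolding is_weak_derivative_def
  proof (intro conjI allI impI)
    fix \<phi> assume t: "test_function J \<phi>"
    note L2 = test_function_L2[OF t J]
    show "(LINT x|lebesgue_on J. ae_rep (u \<oplus>\<^bsub>L2_on J\<^esub> c \<odot>\<^bsub>L2_on J\<^esub> u') x * vector_derivative \<phi> (at x))
        = - (LINT x|lebesgue_on J. ae_rep (v \<oplus>\<^bsub>L2_on J\<^esub> c \<odot>\<^bsub>L2_on J\<^esub> v') x * \<phi> x)"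
      using w t unfolding LINT_lincomb[OF c(1,3) L2(2)] LINT_lincomb[OF c(2,4) L2(1)]
      by (simp add: is_weak_derivative_def)
  qed (use L2_lincomb_in[OF c(1,3)] L2_lincomb_in[OF c(2,4)] in auto)
qed

section \<open>Classical form of regular elements and Green's identity\<close>

lemma weak_derivative_classical:
  assumes e: "edge J" and w: "is_weak_derivative J u v"
    and f: "f \<in> u" "continuous_on (closure J) f"
    and g: "g \<in> v" "continuous_on (closure J) g" and x: "x \<in> J"
  shows "(f has_vector_derivative g x) (at x)"
proof -
  note J = edge_open[OF e] edge_interval[OF e] edge_lebesgue[OF e]
  have c: "u \<in> carrier (L2_on J)" "v \<in> carrier (L2_on J)"
    using w by (auto simp: is_weak_derivative_def)
  define V where "V = zero_ext J (ae_rep v)"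
  obtain f' where f': "f' \<in> u" "continuous_on (closure J) f'"
    "\<And>x. x \<in> closure J \<Longrightarrow> f' x = f' 0 + integral {0..x} V"
    using weak_derivative_continuous_rep[OF e w] unfolding V_def by blast
  have ff: "f y = f' y" if "y \<in> closure J" for y
    by (rule continuous_rep_unique_closure[OF J(1) c(1) f f'(1,2) that])
  have "AE x in lebesgue_on J. g x = ae_rep v x" by (rule L2_mem_AE[OF c(2) g(1) ae_rep_in[OF c(2)]])
  then have "AE x in lebesgue. x \<in> J \<longrightarrow> g x = ae_rep v x"
    using J(3) by (simp add: AE_restrict_space_iff)
  then obtain N where N': "\<And>x. x \<in> space lebesgue - N \<Longrightarrow> x \<in> J \<longrightarrow> g x = ae_rep v x" and N0: "N \<in> null_sets lebesgue"
    by (rule AE_E3) (blast intro: that)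
  have gV: "integral {0..y} V = integral {0..y} g" if y: "y \<in> closure J" for y
  proof (rule integral_spike)
    show "negligible (N \<union> {0, y})" using N0 by (simp add: negligible_iff_null_sets)
    show "g t = V t" if "t \<in> {0..y} - (N \<union> {0, y})" for t
    proof -
      have "t \<in> J" using that edge_below[OF e y] by auto
      then show ?thesis using that N' by (auto simp: V_def zero_ext_def)
    qed
  qed
  obtain r where r: "r > 0" "ball x r \<subseteq> J" using J(1) x openE by blast
  define y where "y = x + r / 2"
  have y: "y \<in> J" "x < y" using r by (auto simp: y_def dist_real_def)
  have x0: "0 < x" by (rule edge_pos[OF e x])
  have sub: "{0..y} \<subseteq> closure J"
    using edge_between[OF e edge_sub[OF e y(1)]] by auto
  have "((\<lambda>t. integral {0..t} g) has_vector_derivative g x) (at x within {0..y})"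
    using g(2) sub x0 y by (intro integral_has_vector_derivative) (auto intro: continuous_on_subset)
  then have "((\<lambda>t. integral {0..t} g) has_vector_derivative g x) (at x)"
    using x0 y at_within_interior[of x "{0..y}"] by (simp add: interior_atLeastAtMost_real)
  then have "((\<lambda>t. f' 0 + integral {0..t} g) has_vector_derivative 0 + g x) (at x)"
    by (intro has_vector_derivative_add has_vector_derivative_const)
  then have "((\<lambda>t. f' 0 + integral {0..t} g) has_vector_derivative g x) (at x)" by simp
  then show ?thesis
  proof (rule has_vector_derivative_transform_within_open[where S=J])
    show "f' 0 + integral {0..t} g = f t" if "t \<in> J" for t
      using ff[OF edge_sub[OF e that]] gV[OF edge_sub[OF e that]] f'(3)[OF edge_sub[OF e that]] by simp
  qed (use J x in auto)
qed

lemma H1_carrier: "u \<in> sobolev_H1 J \<Longrightarrow> u \<in> carrier (L2_on J)"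
  by (auto simp: sobolev_H1_def is_weak_derivative_def)

lemma H1_continuous_rep:
  assumes "edge J" "u \<in> sobolev_H1 J"
  obtains f where "f \<in> u" "continuous_on (closure J) f"
  using weak_derivative_continuous_rep[OF assms(1) sobolev_H1_weak[OF assms]] by blast

lemma loop_FTC:
  fixes F :: "real \<Rightarrow> complex"
  assumes L: "L > 0" and c: "continuous_on {0..L} F"
    and d: "\<And>x. x \<in> {0<..<L} \<Longrightarrow> (F has_vector_derivative F' x) (at x)"
    and i: "integrable (lebesgue_on {0<..<L}) F'"
  shows "(LINT x|lebesgue_on {0<..<L}. F' x) = F L - F 0"
proof -
  have "(F' has_integral F L - F 0) {0..L}"
    using L by (intro fundamental_theorem_of_calculus_interior c d) auto
  then have "integral {0<..<L} F' = F L - F 0"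
    by (simp add: integral_open_interval_real[symmetric] integral_unique)
  then show ?thesis using lebesgue_integral_eq_integral[OF i] by simp
qed

text \<open>
  A nonzero limit would bound \<open>\<bar>F\<bar>\<close> from below on a set of infinite measure.
\<close>

lemma integrable_limit_zero:
  fixes F :: "real \<Rightarrow> complex"
  assumes i: "integrable (lebesgue_on {0<..}) F" and l: "(F \<longlongrightarrow> l) at_top"
  shows "l = 0"
proof (rule ccontr)
  assume "l \<noteq> 0"
  then have "\<forall>\<^sub>F x in at_top. dist (F x) l < cmod l / 2"
    using l tendstoD[of F l at_top "cmod l / 2"] by simp
  then obtain R where R: "\<And>x. R \<le> x \<Longrightarrow> dist (F x) l < cmod l / 2"
    by (auto simp: eventually_at_top_linorder)
  define S where "S = max R 1"
  have big: "cmod l / 2 \<le> cmod (F x)" if "S \<le> x" for x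
  proof -
    have "cmod l \<le> cmod (F x) + dist (F x) l"
      by (metis dist_commute dist_norm norm_triangle_sub)
    then show ?thesis using R[of x] that by (simp add: S_def)
  qed
  have iF: "integrable lebesgue (\<lambda>x. indicat_real {0<..} x *\<^sub>R F x)"
    using i by (subst (asm) integrable_restrict_space) auto
  have "integrable lebesgue (\<lambda>x. indicat_real {S..} x * (cmod l / 2))"
  proof (rule Bochner_Integration.integrable_bound[OF iF])
    show "AE x in lebesgue. norm (indicat_real {S..} x * (cmod l / 2)) \<le> norm (indicat_real {0<..} x *\<^sub>R F x)"
    proof (rule AE_I2)
      fix x
      show "norm (indicat_real {S..} x * (cmod l / 2)) \<le> norm (indicat_real {0<..} x *\<^sub>R F x)"
        using big[of x] by (cases "S \<le> x") (auto simp: S_def)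
    qed
    show "(\<lambda>x. indicat_real {S..} x * (cmod l / 2)) \<in> borel_measurable lebesgue"
      by (intro borel_measurable_times borel_measurable_indicator borel_measurable_const) auto
  qed
  then have "integrable lebesgue (\<lambda>x. indicat_real {S..} x * (cmod l / 2) * (2 / cmod l))"
    by (rule integrable_mult_left)
  then have "integrable lebesgue (indicat_real {S..})"
    using \<open>l \<noteq> 0\<close> by simp
  then have lm: "{S..} \<in> lmeasurable" by (simp add: lmeasurable_iff_integrable)
  obtain n :: nat where n: "measure lebesgue {S..} < real n" using reals_Archimedean2 by blast
  have "measure lebesgue {S..S + real n} \<le> measure lebesgue {S..}"
    using lm by (intro measure_mono_fmeasurable) auto
  then show False using n by simp
qed

text \<open>
  Since \<open>F'\<close> is integrable, \<open>F\<close> has a limit at infinity; since \<open>F\<close> is integrable, the limit is zero.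
\<close>

lemma halfline_FTC:
  fixes F :: "real \<Rightarrow> complex"
  assumes c: "continuous_on {0..} F"
    and d: "\<And>x. x \<in> {0<..} \<Longrightarrow> (F has_vector_derivative F' x) (at x)"
    and i: "integrable (lebesgue_on {0<..}) F" "integrable (lebesgue_on {0<..}) F'"
  shows "(LINT x|lebesgue_on {0<..}. F' x) = - F 0"
proof -
  have "integrable lebesgue (\<lambda>x. indicat_real {0<..} x *\<^sub>R F' x)"
    using i(2) by (subst (asm) integrable_restrict_space) auto
  moreover have "integrable lebesgue (\<lambda>x. indicat_real {0} x *\<^sub>R F' 0)"
    using lmeasurable_compact[of "{0::real}"]
    by (intro integrable_scaleR_left) (simp add: lmeasurable_iff_integrable)
  ultimately have "integrable lebesgue (\<lambda>x. indicat_real {0<..} x *\<^sub>R F' x + indicat_real {0} x *\<^sub>R F' 0)"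
    by (rule Bochner_Integration.integrable_add)
  moreover have "indicat_real {0<..} x *\<^sub>R F' x + indicat_real {0} x *\<^sub>R F' 0 = indicat_real {0..} x *\<^sub>R F' x" for x
    by (auto simp: indicator_def)
  ultimately have si: "set_integrable lebesgue {0..} F'"
    by (simp add: set_integrable_def)
  have lim: "((\<lambda>R. LINT x:{0..R}|lebesgue. F' x) \<longlongrightarrow> (LINT x:{0..}|lebesgue. F' x)) at_top"
    by (rule tendsto_set_lebesgue_integral_at_top[OF _ si]) auto
  have eq: "(LINT x:{0..R}|lebesgue. F' x) = F R - F 0" if R: "0 \<le> R" for R
  proof -
    have "(F' has_integral F R - F 0) {0..R}"
      using R by (intro fundamental_theorem_of_calculus_interior d continuous_on_subset[OF c]) auto
    moreover have "F' absolutely_integrable_on {0..R}"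
      using si by (rule set_integrable_subset) auto
    ultimately show ?thesis
      using set_lebesgue_integral_eq_integral(2) by (metis integral_unique)
  qed
  define I where "I = (LINT x:{0..}|lebesgue. F' x)"
  have "((\<lambda>R. F R - F 0) \<longlongrightarrow> I) at_top"
    using lim unfolding I_def
  proof (rule Lim_transform_eventually)
    show "\<forall>\<^sub>F R in at_top. (LINT x:{0..R}|lebesgue. F' x) = F R - F 0"
      using eventually_ge_at_top[of 0] by eventually_elim (rule eq)
  qed
  then have "((\<lambda>R. (F R - F 0) + F 0) \<longlongrightarrow> I + F 0) at_top"
    by (intro tendsto_add tendsto_const)
  then have "(F \<longlongrightarrow> I + F 0) at_top" by simp
  then have "I + F 0 = 0" by (rule integrable_limit_zero[OF i(1)])
  moreover have "I = (LINT x|lebesgue_on {0<..}. F' x)"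
  proof -
    have "I = (LINT x:{0<..}|lebesgue. F' x)"
      unfolding I_def set_lebesgue_integral_def
    proof (rule integral_cong_AE)
      have "AE x in lebesgue. x \<notin> {0::real}"
        by (intro AE_not_in) (simp add: negligible_iff_null_sets[symmetric])
      then show "AE x in lebesgue. indicat_real {0..} x *\<^sub>R F' x = indicat_real {0<..} x *\<^sub>R F' x"
        by eventually_elim (auto simp: indicator_def)
    qed (use si i(2) in \<open>auto simp: set_integrable_def integrable_restrict_space\<close>)
    then show ?thesis by (simp add: set_lebesgue_integral_def integral_restrict_space)
  qed
  ultimately show ?thesis by (simp add: add_eq_0_iff)
qed

text \<open>The functions to which the classical Green identity applies on an edge.\<close>

definition C2_L2 :: "real set \<Rightarrow> (real \<Rightarrow> complex) \<Rightarrow> (real \<Rightarrow> complex) \<Rightarrow> (real \<Rightarrow> complex) \<Rightarrow> bool" where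
  "C2_L2 J f f1 f2 \<longleftrightarrow> f \<in> L2_fun (lebesgue_on J) \<and> f1 \<in> L2_fun (lebesgue_on J) \<and> f2 \<in> L2_fun (lebesgue_on J)
    \<and> continuous_on (closure J) f \<and> continuous_on (closure J) f1
    \<and> (\<forall>x\<in>J. (f has_vector_derivative f1 x) (at x) \<and> (f1 has_vector_derivative f2 x) (at x))"

lemma C2_L2_cnj: "C2_L2 J f f1 f2 \<Longrightarrow> C2_L2 J (\<lambda>x. cnj (f x)) (\<lambda>x. cnj (f1 x)) (\<lambda>x. cnj (f2 x))"
  unfolding C2_L2_def by (auto intro: L2_fun_cnj continuous_on_cnj has_vector_derivative_cnj)

text \<open>
  Membership of the second weak derivative in \<open>sobolev_H1 J\<close> is what gives it a continuous
  representative; it holds for root vectors.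
\<close>

lemma C2_L2_representatives:
  assumes e: "edge J" and u: "u \<in> sobolev_H2 J"
    and u2: "weak_derivative J (weak_derivative J u) \<in> sobolev_H1 J"
  obtains f f1 f2 where "C2_L2 J f f1 f2" "f \<in> u" "f1 \<in> weak_derivative J u"
    "f2 \<in> weak_derivative J (weak_derivative J u)"
proof -
  have H: "u \<in> sobolev_H1 J" "weak_derivative J u \<in> sobolev_H1 J"
    using u by (auto simp: sobolev_H2_def)
  obtain f where f: "f \<in> u" "continuous_on (closure J) f" using H1_continuous_rep[OF e H(1)] .
  obtain f1 where f1: "f1 \<in> weak_derivative J u" "continuous_on (closure J) f1"
    using H1_continuous_rep[OF e H(2)] .
  obtain f2 where f2: "f2 \<in> weak_derivative J (weak_derivative J u)" "continuous_on (closure J) f2"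
    using H1_continuous_rep[OF e u2] .
  have "C2_L2 J f f1 f2"
    unfolding C2_L2_def
    using L2_memD(1)[OF H1_carrier[OF H(1)] f(1)] L2_memD(1)[OF H1_carrier[OF H(2)] f1(1)]
      L2_memD(1)[OF H1_carrier[OF u2] f2(1)] f f1
      weak_derivative_classical[OF e sobolev_H1_weak[OF e H(1)] f f1]
      weak_derivative_classical[OF e sobolev_H1_weak[OF e H(2)] f1 f2] by blast
  then show thesis using that f(1) f1(1) f2(1) by blast
qed

lemma
  assumes f: "C2_L2 J f f1 f2" and v: "C2_L2 J v v1 v2"
  shows Green_deriv: "x \<in> J \<Longrightarrow> ((\<lambda>x. f1 x * v x - f x * v1 x) has_vector_derivative f2 x * v x - f x * v2 x) (at x)"
    and Green_cont: "continuous_on (closure J) (\<lambda>x. f1 x * v x - f x * v1 x)"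
    and Green_int: "integrable (lebesgue_on J) (\<lambda>x. f1 x * v x - f x * v1 x)"
      "integrable (lebesgue_on J) (\<lambda>x. f2 x * v x - f x * v2 x)"
proof -
  show "((\<lambda>x. f1 x * v x - f x * v1 x) has_vector_derivative f2 x * v x - f x * v2 x) (at x)" if x: "x \<in> J"
  proof -
    have d: "(f has_vector_derivative f1 x) (at x)" "(f1 has_vector_derivative f2 x) (at x)"
      "(v has_vector_derivative v1 x) (at x)" "(v1 has_vector_derivative v2 x) (at x)"
      using f v x by (auto simp: C2_L2_def)
    have "((\<lambda>x. f1 x * v x - f x * v1 x) has_vector_derivative
        (f1 x * v1 x + f2 x * v x) - (f x * v2 x + f1 x * v1 x)) (at x)"
      by (intro has_vector_derivative_diff has_vector_derivative_mult d)
    then show ?thesis by (simp add: algebra_simps)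
  qed
  show "continuous_on (closure J) (\<lambda>x. f1 x * v x - f x * v1 x)"
    using f v unfolding C2_L2_def by (intro continuous_intros) auto
  show "integrable (lebesgue_on J) (\<lambda>x. f1 x * v x - f x * v1 x)"
    "integrable (lebesgue_on J) (\<lambda>x. f2 x * v x - f x * v2 x)"
    using f v unfolding C2_L2_def by (auto intro!: Bochner_Integration.integrable_diff integrable_mult_L2)
qed

lemma Green_halfline:
  assumes f: "C2_L2 {0<..} f f1 f2" and v: "C2_L2 {0<..} v v1 v2"
  shows "(LINT x|lebesgue_on {0<..}. f2 x * v x) - (LINT x|lebesgue_on {0<..}. f x * v2 x)
    = f 0 * v1 0 - f1 0 * v 0"
proof -
  have "(LINT x|lebesgue_on {0<..}. f2 x * v x - f x * v2 x) = - (f1 0 * v 0 - f 0 * v1 0)"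
    using Green_cont[OF f v] Green_deriv[OF f v] Green_int[OF f v] by (intro halfline_FTC) auto
  moreover have "(LINT x|lebesgue_on {0<..}. f2 x * v x - f x * v2 x)
      = (LINT x|lebesgue_on {0<..}. f2 x * v x) - (LINT x|lebesgue_on {0<..}. f x * v2 x)"
    using f v unfolding C2_L2_def by (intro Bochner_Integration.integral_diff integrable_mult_L2) auto
  ultimately show ?thesis by simp
qed

lemma Green_loop:
  assumes L: "L > 0" and f: "C2_L2 {0<..<L} f f1 f2" and v: "C2_L2 {0<..<L} v v1 v2"
  shows "(LINT x|lebesgue_on {0<..<L}. f2 x * v x) - (LINT x|lebesgue_on {0<..<L}. f x * v2 x)
    = (f1 L * v L - f L * v1 L) - (f1 0 * v 0 - f 0 * v1 0)"
proof -
  have "(LINT x|lebesgue_on {0<..<L}. f2 x * v x - f x * v2 x)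
      = (f1 L * v L - f L * v1 L) - (f1 0 * v 0 - f 0 * v1 0)"
    using L Green_cont[OF f v] Green_deriv[OF f v] Green_int[OF f v] by (intro loop_FTC) auto
  moreover have "(LINT x|lebesgue_on {0<..<L}. f2 x * v x - f x * v2 x)
      = (LINT x|lebesgue_on {0<..<L}. f2 x * v x) - (LINT x|lebesgue_on {0<..<L}. f x * v2 x)"
    using f v unfolding C2_L2_def by (intro Bochner_Integration.integral_diff integrable_mult_L2) auto
  ultimately show ?thesis by simp
qed

section \<open>Linearity of the tadpole operator\<close>

text \<open>
  Sums and scalar multiples are both instances of \<open>u + c v\<close>, so it suffices that this combination is
  respected; the value at zero comes from \<open>c = -1\<close>.
\<close>

lemma (in complex_inner_space) unbounded_operatorI:
  assumes D: "D \<subseteq> carrier V" "\<zero> \<in> D" "\<And>u v c. u \<in> D \<Longrightarrow> v \<in> D \<Longrightarrow> u \<oplus> c \<odot> v \<in> D"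
    and T: "\<And>u. u \<in> D \<Longrightarrow> T u \<in> carrier V"
      "\<And>u v c. u \<in> D \<Longrightarrow> v \<in> D \<Longrightarrow> T (u \<oplus> c \<odot> v) = T u \<oplus> c \<odot> T v"
  shows "unbounded_operator V D T"
proof (intro unbounded_operator.intro unbounded_operator_axioms.intro)
  show "complex_inner_space V" by unfold_locales
  have add: "u \<oplus> v = u \<oplus> 1 \<odot> v" if "v \<in> D" for u v
    using that D(1) by (simp add: subset_iff)
  have sm: "c \<odot> u = \<zero> \<oplus> c \<odot> u" if "u \<in> D" for u c
    using that D(1) by (simp add: subset_iff)
  have "T \<zero> = T (\<zero> \<oplus> (-1) \<odot> \<zero>)" using sm[OF D(2), of "-1"] by simp
  also have "\<dots> = T \<zero> \<oplus> (-1) \<odot> T \<zero>" by (rule T(2)[OF D(2) D(2)])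
  also have "\<dots> = \<zero>" using T(1)[OF D(2)] by (intro inner_eqI) auto
  finally have T0: "T \<zero> = \<zero>" .
  show "submodule D complex_field V"
  proof (rule subspaceI)
    show "x \<oplus> y \<in> D" if "x \<in> D" "y \<in> D" for x y
      using D(3)[OF that, of 1] add[OF that(2)] by simp
    show "c \<odot> x \<in> D" if "x \<in> D" for c x
      using D(3)[OF D(2) that] sm[OF that] by simp
  qed (use D in auto)
  show "T u \<in> carrier V" if "u \<in> D" for u by (rule T(1)[OF that])
  show "T (u \<oplus> v) = T u \<oplus> T v" if "u \<in> D" "v \<in> D" for u v
    using T(2)[OF that, of 1] add[OF that(2)] T(1)[OF that(2)] by simp
  show "T (c \<odot> u) = c \<odot> T u" if "u \<in> D" for u c
    using T(2)[OF D(2) that, of c] sm[OF that] T(1)[OF that] T0 by simp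
qed

lemma L2_zero_in: "\<zero>\<^bsub>L2_space M\<^esub> \<in> carrier (L2_space M)"
  by (simp add: L2_zero ae_class_in_L2 L2_fun_zero)

lemma zero_mem_L2_zero: "(\<lambda>x. 0) \<in> \<zero>\<^bsub>L2_space M\<^esub>"
  by (simp add: L2_zero ae_class_self)

lemma is_weak_derivative_zero:
  assumes J: "J \<in> sets lebesgue"
  shows "is_weak_derivative J \<zero>\<^bsub>L2_on J\<^esub> \<zero>\<^bsub>L2_on J\<^esub>"
proof -
  have "(LINT x|lebesgue_on J. ae_rep \<zero>\<^bsub>L2_on J\<^esub> x * h x) = 0" if "h \<in> L2_fun (lebesgue_on J)" for h
    using LINT_ae_rep[OF L2_zero_in zero_mem_L2_zero L2_fun_measurable[OF that]] by simp
  then show ?thesis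
    unfolding is_weak_derivative_def using L2_zero_in test_function_L2 J by auto
qed

lemma H1_zero: "edge J \<Longrightarrow> \<zero>\<^bsub>L2_on J\<^esub> \<in> sobolev_H1 J \<and> weak_derivative J \<zero>\<^bsub>L2_on J\<^esub> = \<zero>\<^bsub>L2_on J\<^esub>"
  using is_weak_derivative_zero[OF edge_lebesgue] weak_derivative_eq unfolding sobolev_H1_def by blast

lemma H2_zero: "edge J \<Longrightarrow> \<zero>\<^bsub>L2_on J\<^esub> \<in> sobolev_H2 J"
  using H1_zero[of J] by (simp add: sobolev_H2_def)

lemma boundary_value_zero:
  "edge J \<Longrightarrow> a \<in> closure J \<Longrightarrow> boundary_value J a \<zero>\<^bsub>L2_on J\<^esub> = 0"
  by (rule boundary_value_eq[OF _ L2_zero_in zero_mem_L2_zero]) auto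

lemma H1_lincomb:
  assumes e: "edge J" and u: "u \<in> sobolev_H1 J" "u' \<in> sobolev_H1 J"
  shows "u \<oplus>\<^bsub>L2_on J\<^esub> c \<odot>\<^bsub>L2_on J\<^esub> u' \<in> sobolev_H1 J"
    and "weak_derivative J (u \<oplus>\<^bsub>L2_on J\<^esub> c \<odot>\<^bsub>L2_on J\<^esub> u')
      = weak_derivative J u \<oplus>\<^bsub>L2_on J\<^esub> c \<odot>\<^bsub>L2_on J\<^esub> weak_derivative J u'"
proof -
  have w: "is_weak_derivative J (u \<oplus>\<^bsub>L2_on J\<^esub> c \<odot>\<^bsub>L2_on J\<^esub> u')
      (weak_derivative J u \<oplus>\<^bsub>L2_on J\<^esub> c \<odot>\<^bsub>L2_on J\<^esub> weak_derivative J u')"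
    by (rule is_weak_derivative_lincomb[OF edge_lebesgue[OF e] sobolev_H1_weak[OF e u(1)] sobolev_H1_weak[OF e u(2)]])
  then show "u \<oplus>\<^bsub>L2_on J\<^esub> c \<odot>\<^bsub>L2_on J\<^esub> u' \<in> sobolev_H1 J" unfolding sobolev_H1_def by blast
  show "weak_derivative J (u \<oplus>\<^bsub>L2_on J\<^esub> c \<odot>\<^bsub>L2_on J\<^esub> u')
      = weak_derivative J u \<oplus>\<^bsub>L2_on J\<^esub> c \<odot>\<^bsub>L2_on J\<^esub> weak_derivative J u'"
    by (rule weak_derivative_eq[OF e w])
qed

lemma H2_lincomb:
  assumes e: "edge J" and u: "u \<in> sobolev_H2 J" "u' \<in> sobolev_H2 J"
  shows "u \<oplus>\<^bsub>L2_on J\<^esub> c \<odot>\<^bsub>L2_on J\<^esub> u' \<in> sobolev_H2 J"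
  using u H1_lincomb[OF e] by (simp add: sobolev_H2_def)

lemma boundary_value_lincomb:
  assumes e: "edge J" and u: "u \<in> sobolev_H1 J" "u' \<in> sobolev_H1 J" and a: "a \<in> closure J"
  shows "boundary_value J a (u \<oplus>\<^bsub>L2_on J\<^esub> c \<odot>\<^bsub>L2_on J\<^esub> u') = boundary_value J a u + c * boundary_value J a u'"
proof -
  obtain f where f: "f \<in> u" "continuous_on (closure J) f" using H1_continuous_rep[OF e u(1)] .
  obtain g where g: "g \<in> u'" "continuous_on (closure J) g" using H1_continuous_rep[OF e u(2)] .
  note c = H1_carrier[OF u(1)] H1_carrier[OF u(2)]
  have "boundary_value J a (u \<oplus>\<^bsub>L2_on J\<^esub> c \<odot>\<^bsub>L2_on J\<^esub> u') = f a + c * g a"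
    using L2_lincomb_in[OF c] L2_lincomb_mem[OF c f(1) g(1)]
    by (rule boundary_value_eq[OF e _ _ _ a]) (intro continuous_intros f g)
  then show ?thesis
    by (simp add: boundary_value_eq[OF e c(1) f a] boundary_value_eq[OF e c(2) g a])
qed

lemma H2_H1: "u \<in> sobolev_H2 J \<Longrightarrow> u \<in> sobolev_H1 J \<and> weak_derivative J u \<in> sobolev_H1 J"
  by (simp add: sobolev_H2_def)

lemma H2_carrier: "edge J \<Longrightarrow> u \<in> sobolev_H2 J \<Longrightarrow> u \<in> carrier (L2_on J)
    \<and> weak_derivative J u \<in> carrier (L2_on J) \<and> weak_derivative J (weak_derivative J u) \<in> carrier (L2_on J)"
  using H2_H1[of u J] H1_carrier[of u J] sobolev_H1_weak[of J]
  unfolding is_weak_derivative_def by blast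

lemma complex_inner_space_tadpole: "complex_inner_space (tadpole_L2 L)"
  unfolding tadpole_L2_def by (intro complex_inner_space_orthogonal_sum complex_inner_space_L2)

lemma tadpole_simps:
  "carrier (tadpole_L2 L) = carrier (L2_on halfline) \<times> carrier (L2_on (loop L))"
  "fst \<zero>\<^bsub>tadpole_L2 L\<^esub> = \<zero>\<^bsub>L2_on halfline\<^esub>" "snd \<zero>\<^bsub>tadpole_L2 L\<^esub> = \<zero>\<^bsub>L2_on (loop L)\<^esub>"
  "fst (u \<oplus>\<^bsub>tadpole_L2 L\<^esub> v) = fst u \<oplus>\<^bsub>L2_on halfline\<^esub> fst v"
  "snd (u \<oplus>\<^bsub>tadpole_L2 L\<^esub> v) = snd u \<oplus>\<^bsub>L2_on (loop L)\<^esub> snd v"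
  "fst (c \<odot>\<^bsub>tadpole_L2 L\<^esub> u) = c \<odot>\<^bsub>L2_on halfline\<^esub> fst u"
  "snd (c \<odot>\<^bsub>tadpole_L2 L\<^esub> u) = c \<odot>\<^bsub>L2_on (loop L)\<^esub> snd u"
  by (simp_all add: tadpole_L2_def orthogonal_sum_def)

lemma unbounded_operator_tadpole:
  assumes L: "L > 0"
  shows "unbounded_operator (tadpole_L2 L) (tadpole_domain L \<alpha>) (tadpole_iH L)"
proof -
  interpret V: complex_inner_space "tadpole_L2 L" by (rule complex_inner_space_tadpole)
  interpret V1: complex_inner_space "L2_on halfline" by (rule complex_inner_space_L2)
  interpret V2: complex_inner_space "L2_on (loop L)" by (rule complex_inner_space_L2)
  note e = edge_halfline edge_loop[OF L]
  have cl: "0 \<in> closure halfline" "0 \<in> closure (loop L)" "L \<in> closure (loop L)"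
    using L by simp_all
  let ?D = "tadpole_domain L \<alpha>"
  have D: "fst u \<in> sobolev_H2 halfline" "snd u \<in> sobolev_H2 (loop L)"
    "boundary_value halfline 0 (fst u) = boundary_value (loop L) 0 (snd u)"
    "boundary_value (loop L) 0 (snd u) = boundary_value (loop L) L (snd u)"
    "boundary_value halfline 0 (weak_derivative halfline (fst u))
          + boundary_value (loop L) 0 (weak_derivative (loop L) (snd u))
          - boundary_value (loop L) L (weak_derivative (loop L) (snd u))
        = \<i> * complex_of_real \<alpha> * boundary_value halfline 0 (fst u)" if "u \<in> ?D" for u
    using that unfolding tadpole_domain_def by auto
  show ?thesis
  proof (rule V.unbounded_operatorI)
    show "?D \<subseteq> carrier (tadpole_L2 L)"
      using D(1,2) H2_carrier[OF e(1)] H2_carrier[OF e(2)] by (auto simp: tadpole_simps mem_Times_iff)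
    have "\<zero>\<^bsub>tadpole_L2 L\<^esub> = (\<zero>\<^bsub>L2_on halfline\<^esub>, \<zero>\<^bsub>L2_on (loop L)\<^esub>)"
      by (simp add: prod_eq_iff tadpole_simps)
    then show "\<zero>\<^bsub>tadpole_L2 L\<^esub> \<in> ?D"
      using H1_zero[OF e(1)] H1_zero[OF e(2)] H2_zero[OF e(1)] H2_zero[OF e(2)] cl
      by (simp add: tadpole_domain_def boundary_value_zero e L del: closure_greaterThan closure_greaterThanLessThan)
    show "u \<oplus>\<^bsub>tadpole_L2 L\<^esub> c \<odot>\<^bsub>tadpole_L2 L\<^esub> v \<in> ?D" if u: "u \<in> ?D" and v: "v \<in> ?D" for u v c
    proof -
      note h = D[OF u] D[OF v]
      note H = H2_H1[OF D(1)[OF u]] H2_H1[OF D(2)[OF u]] H2_H1[OF D(1)[OF v]] H2_H1[OF D(2)[OF v]]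
      have "u \<oplus>\<^bsub>tadpole_L2 L\<^esub> c \<odot>\<^bsub>tadpole_L2 L\<^esub> v
        = (fst u \<oplus>\<^bsub>L2_on halfline\<^esub> c \<odot>\<^bsub>L2_on halfline\<^esub> fst v, snd u \<oplus>\<^bsub>L2_on (loop L)\<^esub> c \<odot>\<^bsub>L2_on (loop L)\<^esub> snd v)"
        by (simp add: prod_eq_iff tadpole_simps)
      moreover have "boundary_value halfline 0 (weak_derivative halfline (fst u))
          + c * boundary_value halfline 0 (weak_derivative halfline (fst v))
          + (boundary_value (loop L) 0 (weak_derivative (loop L) (snd u))
            + c * boundary_value (loop L) 0 (weak_derivative (loop L) (snd v)))
          - (boundary_value (loop L) L (weak_derivative (loop L) (snd u))
            + c * boundary_value (loop L) L (weak_derivative (loop L) (snd v)))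
        = \<i> * complex_of_real \<alpha> * (boundary_value halfline 0 (fst u) + c * boundary_value halfline 0 (fst v))"
      proof -
        have "a1 + c * b1 + (a2 + c * b2) - (a3 + c * b3) = k * (x + c * y)"
          if "a1 + a2 - a3 = k * x" "b1 + b2 - b3 = k * y" for a1 a2 a3 b1 b2 b3 k x y :: complex
        proof -
          have "a1 + c * b1 + (a2 + c * b2) - (a3 + c * b3) = (a1 + a2 - a3) + c * (b1 + b2 - b3)"
            by (simp add: algebra_simps)
          then show ?thesis unfolding that by (simp add: algebra_simps)
        qed
        then show ?thesis using D(5)[OF u] D(5)[OF v] by blast
      qed
      ultimately show ?thesis
        using h(3,4,8,9) H H2_lincomb[OF e(1) h(1) h(6)] H2_lincomb[OF e(2) h(2) h(7)]
        by (simp add: tadpole_domain_def H1_lincomb(2) e L boundary_value_lincomb cl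
            del: closure_greaterThan closure_greaterThanLessThan)
    qed
    have T: "fst (tadpole_iH L u) = \<i> \<odot>\<^bsub>L2_on halfline\<^esub> (\<ominus>\<^bsub>L2_on halfline\<^esub> weak_derivative halfline (weak_derivative halfline (fst u)))"
      "snd (tadpole_iH L u) = \<i> \<odot>\<^bsub>L2_on (loop L)\<^esub> (\<ominus>\<^bsub>L2_on (loop L)\<^esub> weak_derivative (loop L) (weak_derivative (loop L) (snd u)))" for u
      by (simp_all add: tadpole_iH_def tadpole_H_def tadpole_simps)
    show "tadpole_iH L u \<in> carrier (tadpole_L2 L)" if "u \<in> ?D" for u
      using H2_carrier[OF e(1) D(1)[OF that]] H2_carrier[OF e(2) D(2)[OF that]]
      by (simp add: tadpole_simps mem_Times_iff T)
    show "tadpole_iH L (u \<oplus>\<^bsub>tadpole_L2 L\<^esub> c \<odot>\<^bsub>tadpole_L2 L\<^esub> v)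
        = tadpole_iH L u \<oplus>\<^bsub>tadpole_L2 L\<^esub> c \<odot>\<^bsub>tadpole_L2 L\<^esub> tadpole_iH L v" if u: "u \<in> ?D" and v: "v \<in> ?D" for u v c
    proof -
      note H = H2_H1[OF D(1)[OF u]] H2_H1[OF D(2)[OF u]] H2_H1[OF D(1)[OF v]] H2_H1[OF D(2)[OF v]]
      note C = H2_carrier[OF e(1) D(1)[OF u]] H2_carrier[OF e(2) D(2)[OF u]]
        H2_carrier[OF e(1) D(1)[OF v]] H2_carrier[OF e(2) D(2)[OF v]]
      show ?thesis
      proof (rule prod_eqI)
        show "fst (tadpole_iH L (u \<oplus>\<^bsub>tadpole_L2 L\<^esub> c \<odot>\<^bsub>tadpole_L2 L\<^esub> v))
          = fst (tadpole_iH L u \<oplus>\<^bsub>tadpole_L2 L\<^esub> c \<odot>\<^bsub>tadpole_L2 L\<^esub> tadpole_iH L v)"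
          using H C by (intro V1.inner_eqI) (simp_all add: T tadpole_simps H1_lincomb(2) algebra_simps)
        show "snd (tadpole_iH L (u \<oplus>\<^bsub>tadpole_L2 L\<^esub> c \<odot>\<^bsub>tadpole_L2 L\<^esub> v))
          = snd (tadpole_iH L u \<oplus>\<^bsub>tadpole_L2 L\<^esub> c \<odot>\<^bsub>tadpole_L2 L\<^esub> tadpole_iH L v)"
          using H C e by (intro V2.inner_eqI) (simp_all add: T tadpole_simps H1_lincomb(2) algebra_simps)
      qed
    qed
  qed
qed

section \<open>Eigenfunctions that vanish at the vertex\<close>

lemma weak_Green_halfline:
  assumes u: "u \<in> sobolev_H2 {0<..}" "weak_derivative {0<..} (weak_derivative {0<..} u) \<in> sobolev_H1 {0<..}"
    and v: "C2_L2 {0<..} v v1 v2"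
  shows "(LINT x|lebesgue_on {0<..}. ae_rep (weak_derivative {0<..} (weak_derivative {0<..} u)) x * v x)
      - (LINT x|lebesgue_on {0<..}. ae_rep u x * v2 x)
    = boundary_value {0<..} 0 u * v1 0 - boundary_value {0<..} 0 (weak_derivative {0<..} u) * v 0"
proof -
  note e = edge_halfline
  obtain f f1 f2 where f: "C2_L2 {0<..} f f1 f2" "f \<in> u" "f1 \<in> weak_derivative {0<..} u"
    "f2 \<in> weak_derivative {0<..} (weak_derivative {0<..} u)"
    using C2_L2_representatives[OF e u] .
  note C = H2_carrier[OF e u(1)]
  have vm: "v \<in> borel_measurable (lebesgue_on {0<..})" "v2 \<in> borel_measurable (lebesgue_on {0<..})"
    using v by (auto simp: C2_L2_def L2_fun_measurable)
  have bv: "boundary_value {0<..} 0 u = f 0" "boundary_value {0<..} 0 (weak_derivative {0<..} u) = f1 0"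
    using f C by (auto intro!: boundary_value_eq e simp: C2_L2_def)
  show ?thesis
    unfolding bv LINT_ae_rep[OF conjunct1[OF C] f(2) vm(2)]
      LINT_ae_rep[OF conjunct2[OF conjunct2[OF C]] f(4) vm(1)]
    by (rule Green_halfline[OF f(1) v])
qed

lemma weak_Green_loop:
  assumes L: "L > 0"
    and u: "u \<in> sobolev_H2 {0<..<L}" "weak_derivative {0<..<L} (weak_derivative {0<..<L} u) \<in> sobolev_H1 {0<..<L}"
    and v: "C2_L2 {0<..<L} v v1 v2"
  shows "(LINT x|lebesgue_on {0<..<L}. ae_rep (weak_derivative {0<..<L} (weak_derivative {0<..<L} u)) x * v x)
      - (LINT x|lebesgue_on {0<..<L}. ae_rep u x * v2 x)
    = (boundary_value {0<..<L} L (weak_derivative {0<..<L} u) * v L - boundary_value {0<..<L} L u * v1 L)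
      - (boundary_value {0<..<L} 0 (weak_derivative {0<..<L} u) * v 0 - boundary_value {0<..<L} 0 u * v1 0)"
proof -
  note e = edge_loop[OF L]
  obtain f f1 f2 where f: "C2_L2 {0<..<L} f f1 f2" "f \<in> u" "f1 \<in> weak_derivative {0<..<L} u"
    "f2 \<in> weak_derivative {0<..<L} (weak_derivative {0<..<L} u)"
    using C2_L2_representatives[OF e u] .
  note C = H2_carrier[OF e u(1)]
  have vm: "v \<in> borel_measurable (lebesgue_on {0<..<L})" "v2 \<in> borel_measurable (lebesgue_on {0<..<L})"
    using v by (auto simp: C2_L2_def L2_fun_measurable)
  have bv: "boundary_value {0<..<L} a u = f a" "boundary_value {0<..<L} a (weak_derivative {0<..<L} u) = f1 a"
    if "a \<in> closure {0<..<L}" for a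
    using f C that by (auto intro!: boundary_value_eq e simp: C2_L2_def)
  have cl: "0 \<in> closure {0<..<L}" "L \<in> closure {0<..<L}" using L by simp_all
  show ?thesis
    unfolding bv[OF cl(1)] bv[OF cl(2)] LINT_ae_rep[OF conjunct1[OF C] f(2) vm(2)]
      LINT_ae_rep[OF conjunct2[OF conjunct2[OF C]] f(4) vm(1)]
    by (rule Green_loop[OF L f(1) v])
qed

text \<open>
  With \<open>f\<close> a representative of \<open>u\<close>, Green's identity for \<open>f\<close> and its conjugate reads
  \<open>(c - cnj c) \<parallel>u\<parallel>\<^sup>2 = 0\<close> when the boundary terms vanish, and \<open>c\<close> is not real.
\<close>

lemma Dirichlet_eigenfunction_zero:
  assumes e: "edge J" and u: "u \<in> sobolev_H2 J"
    and eig: "weak_derivative J (weak_derivative J u) = c \<odot>\<^bsub>L2_on J\<^esub> u" and c: "Im c \<noteq> 0"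
    and bdry: "\<And>f f1 f2. C2_L2 J f f1 f2 \<Longrightarrow> f \<in> u \<Longrightarrow>
      (LINT x|lebesgue_on J. f2 x * cnj (f x)) - (LINT x|lebesgue_on J. f x * cnj (f2 x)) = 0"
  shows "u = \<zero>\<^bsub>L2_on J\<^esub>"
proof -
  interpret V: complex_inner_space "L2_on J" by (rule complex_inner_space_L2)
  note C = H2_carrier[OF e u]
  have "\<zero>\<^bsub>L2_on J\<^esub> \<oplus>\<^bsub>L2_on J\<^esub> c \<odot>\<^bsub>L2_on J\<^esub> u \<in> sobolev_H1 J"
    by (rule H1_lincomb(1)[OF e conjunct1[OF H1_zero[OF e]] conjunct1[OF H2_H1[OF u]]])
  moreover have "\<zero>\<^bsub>L2_on J\<^esub> \<oplus>\<^bsub>L2_on J\<^esub> c \<odot>\<^bsub>L2_on J\<^esub> u = c \<odot>\<^bsub>L2_on J\<^esub> u"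
    using C by simp
  ultimately have "weak_derivative J (weak_derivative J u) \<in> sobolev_H1 J"
    unfolding eig by simp
  then obtain f f1 f2 where f: "C2_L2 J f f1 f2" "f \<in> u" "f1 \<in> weak_derivative J u"
    "f2 \<in> weak_derivative J (weak_derivative J u)"
    using C2_L2_representatives[OF e u] by metis
  have cl: "u = ae_class (lebesgue_on J) f" and f_L2: "f \<in> L2_fun (lebesgue_on J)"
    using L2_memD[OF conjunct1[OF C] f(2)] by auto
  have cl2: "c \<odot>\<^bsub>L2_on J\<^esub> u = ae_class (lebesgue_on J) f2" and f2_L2: "f2 \<in> L2_fun (lebesgue_on J)"
    using L2_memD[OF conjunct2[OF conjunct2[OF C]] f(4)] eig by auto
  have "(LINT x|lebesgue_on J. f2 x * cnj (f x)) = inner_prod (L2_on J) (c \<odot>\<^bsub>L2_on J\<^esub> u) u"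
    unfolding cl2 using cl by (simp add: L2_inner[OF f2_L2 f_L2])
  moreover have "(LINT x|lebesgue_on J. f x * cnj (f2 x)) = inner_prod (L2_on J) u (c \<odot>\<^bsub>L2_on J\<^esub> u)"
    unfolding cl2 using cl by (simp add: L2_inner[OF f_L2 f2_L2])
  ultimately have "(c - cnj c) * inner_prod (L2_on J) u u = 0"
    using bdry[OF f(1,2)] C by (simp add: left_diff_distrib)
  moreover have "c - cnj c \<noteq> 0" using c by (simp add: complex_eq_iff)
  ultimately show ?thesis using V.inner_definite C by auto
qed

lemma tadpole_domainD:
  assumes "u \<in> tadpole_domain L \<alpha>"
  shows "fst u \<in> sobolev_H2 halfline" "snd u \<in> sobolev_H2 (loop L)"
    "boundary_value (loop L) 0 (snd u) = boundary_value halfline 0 (fst u)"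
    "boundary_value (loop L) L (snd u) = boundary_value halfline 0 (fst u)"
    "boundary_value halfline 0 (weak_derivative halfline (fst u))
          + boundary_value (loop L) 0 (weak_derivative (loop L) (snd u))
          - boundary_value (loop L) L (weak_derivative (loop L) (snd u))
        = \<i> * complex_of_real \<alpha> * boundary_value halfline 0 (fst u)"
  using assms unfolding tadpole_domain_def by auto

text \<open>
  The equation \<open>w = (\<i>H - \<i>z) u\<close>, solved for the second derivatives.
\<close>

lemma tadpole_second_derivatives:
  assumes L: "L > 0" and u: "u \<in> tadpole_domain L \<alpha>"
    and w: "w = tadpole_iH L u \<ominus>\<^bsub>tadpole_L2 L\<^esub> (\<i> * z) \<odot>\<^bsub>tadpole_L2 L\<^esub> u"
  shows "weak_derivative halfline (weak_derivative halfline (fst u))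
      = \<i> \<odot>\<^bsub>L2_on halfline\<^esub> fst w \<oplus>\<^bsub>L2_on halfline\<^esub> (- z) \<odot>\<^bsub>L2_on halfline\<^esub> fst u"
    and "weak_derivative (loop L) (weak_derivative (loop L) (snd u))
      = \<i> \<odot>\<^bsub>L2_on (loop L)\<^esub> snd w \<oplus>\<^bsub>L2_on (loop L)\<^esub> (- z) \<odot>\<^bsub>L2_on (loop L)\<^esub> snd u"
proof -
  interpret V1: complex_inner_space "L2_on halfline" by (rule complex_inner_space_L2)
  interpret V2: complex_inner_space "L2_on (loop L)" by (rule complex_inner_space_L2)
  interpret unbounded_operator "tadpole_L2 L" "tadpole_domain L \<alpha>" "tadpole_iH L"
    by (rule unbounded_operator_tadpole[OF L])
  note C = H2_carrier[OF edge_halfline tadpole_domainD(1)[OF u]] H2_carrier[OF edge_loop[OF L] tadpole_domainD(2)[OF u]]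
  have uc: "u \<in> carrier (tadpole_L2 L)" and Tc: "tadpole_iH L u \<in> carrier (tadpole_L2 L)"
    using D_in[OF u] T_in[OF u] .
  then have wc: "w \<in> carrier (tadpole_L2 L)" unfolding w by simp
  have "w \<oplus>\<^bsub>tadpole_L2 L\<^esub> (\<i> * z) \<odot>\<^bsub>tadpole_L2 L\<^esub> u = tadpole_iH L u"
    unfolding w using uc Tc by (intro inner_eqI) auto
  then have "fst w \<oplus>\<^bsub>L2_on halfline\<^esub> (\<i> * z) \<odot>\<^bsub>L2_on halfline\<^esub> fst u = fst (tadpole_iH L u)"
    "snd w \<oplus>\<^bsub>L2_on (loop L)\<^esub> (\<i> * z) \<odot>\<^bsub>L2_on (loop L)\<^esub> snd u = snd (tadpole_iH L u)"
    by (metis tadpole_simps(4,6), metis tadpole_simps(5,7))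
  then have 1: "fst w \<oplus>\<^bsub>L2_on halfline\<^esub> (\<i> * z) \<odot>\<^bsub>L2_on halfline\<^esub> fst u
      = \<i> \<odot>\<^bsub>L2_on halfline\<^esub> (\<ominus>\<^bsub>L2_on halfline\<^esub> weak_derivative halfline (weak_derivative halfline (fst u)))"
    and 2: "snd w \<oplus>\<^bsub>L2_on (loop L)\<^esub> (\<i> * z) \<odot>\<^bsub>L2_on (loop L)\<^esub> snd u
      = \<i> \<odot>\<^bsub>L2_on (loop L)\<^esub> (\<ominus>\<^bsub>L2_on (loop L)\<^esub> weak_derivative (loop L) (weak_derivative (loop L) (snd u)))"
    by (simp_all add: tadpole_iH_def tadpole_H_def tadpole_simps)
  have w12: "fst w \<in> carrier (L2_on halfline)" "snd w \<in> carrier (L2_on (loop L))"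
    using wc by (auto simp: tadpole_simps)
  have alg: "a = \<i> * b + - z * d" if "b + \<i> * z * d = - (\<i> * a)" for a b d :: complex
  proof -
    have "\<i> * (b + \<i> * z * d) = \<i> * (- (\<i> * a))" using that by simp
    then show ?thesis by (simp add: algebra_simps)
  qed
  show "weak_derivative halfline (weak_derivative halfline (fst u))
      = \<i> \<odot>\<^bsub>L2_on halfline\<^esub> fst w \<oplus>\<^bsub>L2_on halfline\<^esub> (- z) \<odot>\<^bsub>L2_on halfline\<^esub> fst u"
  proof (rule V1.inner_eqI)
    fix y assume y: "y \<in> carrier (L2_on halfline)"
    show "inner_prod (L2_on halfline) (weak_derivative halfline (weak_derivative halfline (fst u))) y
      = inner_prod (L2_on halfline) (\<i> \<odot>\<^bsub>L2_on halfline\<^esub> fst w \<oplus>\<^bsub>L2_on halfline\<^esub> (- z) \<odot>\<^bsub>L2_on halfline\<^esub> fst u) y"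
    proof -
      have "inner_prod (L2_on halfline) (fst w) y + \<i> * z * inner_prod (L2_on halfline) (fst u) y
        = - (\<i> * inner_prod (L2_on halfline) (weak_derivative halfline (weak_derivative halfline (fst u))) y)"
        using arg_cong[OF 1, of "\<lambda>x. inner_prod (L2_on halfline) x y"] C w12 y by simp
      from alg[OF this] show ?thesis using C w12 y by simp
    qed
  qed (use C w12 in auto)
  show "weak_derivative (loop L) (weak_derivative (loop L) (snd u))
      = \<i> \<odot>\<^bsub>L2_on (loop L)\<^esub> snd w \<oplus>\<^bsub>L2_on (loop L)\<^esub> (- z) \<odot>\<^bsub>L2_on (loop L)\<^esub> snd u"
  proof (rule V2.inner_eqI)
    fix y assume y: "y \<in> carrier (L2_on (loop L))"
    show "inner_prod (L2_on (loop L)) (weak_derivative (loop L) (weak_derivative (loop L) (snd u))) y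
      = inner_prod (L2_on (loop L)) (\<i> \<odot>\<^bsub>L2_on (loop L)\<^esub> snd w \<oplus>\<^bsub>L2_on (loop L)\<^esub> (- z) \<odot>\<^bsub>L2_on (loop L)\<^esub> snd u) y"
    proof -
      have "inner_prod (L2_on (loop L)) (snd w) y + \<i> * z * inner_prod (L2_on (loop L)) (snd u) y
        = - (\<i> * inner_prod (L2_on (loop L)) (weak_derivative (loop L) (weak_derivative (loop L) (snd u))) y)"
        using arg_cong[OF 2, of "\<lambda>x. inner_prod (L2_on (loop L)) x y"] C w12 y by simp
      from alg[OF this] show ?thesis using C w12 y by simp
    qed
  qed (use C w12 in auto)
qed

definition vertex_value :: "tadpole_fun \<Rightarrow> complex" where
  "vertex_value u = boundary_value halfline 0 (fst u)"

lemma vertex_value_lincomb: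
  assumes "u \<in> tadpole_domain L \<alpha>" "v \<in> tadpole_domain L \<alpha>"
  shows "vertex_value (u \<oplus>\<^bsub>tadpole_L2 L\<^esub> c \<odot>\<^bsub>tadpole_L2 L\<^esub> v) = vertex_value u + c * vertex_value v"
proof -
  have "fst u \<in> sobolev_H1 halfline" "fst v \<in> sobolev_H1 halfline"
    using H2_H1 tadpole_domainD(1) assms by blast+
  then show ?thesis
    unfolding vertex_value_def tadpole_simps by (intro boundary_value_lincomb edge_halfline) simp_all
qed

text \<open>
  The vertex conditions reduce to Dirichlet conditions on both edges when the value at the vertex is
  zero, and the edges decouple.
\<close>

lemma eigenfunction_vertex_value:
  assumes L: "L > 0" and u: "u \<in> ker_power (tadpole_L2 L) (tadpole_domain L \<alpha>) (tadpole_iH L) (\<i> * z) 1"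
    and z: "Im z \<noteq> 0" and v: "vertex_value u = 0"
  shows "u = \<zero>\<^bsub>tadpole_L2 L\<^esub>"
proof -
  note cl = edge_halfline edge_loop[OF L]
  interpret V1: complex_inner_space "L2_on halfline" by (rule complex_inner_space_L2)
  interpret V2: complex_inner_space "L2_on (loop L)" by (rule complex_inner_space_L2)
  have uD: "u \<in> tadpole_domain L \<alpha>"
    and w: "\<zero>\<^bsub>tadpole_L2 L\<^esub> = tadpole_iH L u \<ominus>\<^bsub>tadpole_L2 L\<^esub> (\<i> * z) \<odot>\<^bsub>tadpole_L2 L\<^esub> u"
    using u by auto
  note D = tadpole_domainD[OF uD]
  note C = H2_carrier[OF cl(1) D(1)] H2_carrier[OF cl(2) D(2)]
  have eig1: "weak_derivative halfline (weak_derivative halfline (fst u)) = (- z) \<odot>\<^bsub>L2_on halfline\<^esub> fst u"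
    using tadpole_second_derivatives(1)[OF L uD w] C by (simp add: tadpole_simps V1.smult_r_null[simplified])
  have eig2: "weak_derivative (loop L) (weak_derivative (loop L) (snd u)) = (- z) \<odot>\<^bsub>L2_on (loop L)\<^esub> snd u"
    using tadpole_second_derivatives(2)[OF L uD w] C by (simp add: tadpole_simps V2.smult_r_null[simplified])
  have b: "boundary_value halfline 0 (fst u) = 0" "boundary_value (loop L) 0 (snd u) = 0"
    "boundary_value (loop L) L (snd u) = 0"
    using v D(3,4) by (simp_all add: vertex_value_def)
  have "fst u = \<zero>\<^bsub>L2_on halfline\<^esub>"
  proof (rule Dirichlet_eigenfunction_zero[OF cl(1) D(1) eig1])
    fix f f1 f2 assume f: "C2_L2 halfline f f1 f2" "f \<in> fst u"
    have "f 0 = 0"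
      using boundary_value_eq[OF cl(1), of "fst u" f 0] f C b by (simp add: C2_L2_def)
    then show "(LINT x|lebesgue_on halfline. f2 x * cnj (f x)) - (LINT x|lebesgue_on halfline. f x * cnj (f2 x)) = 0"
      using Green_halfline[OF f(1) C2_L2_cnj[OF f(1)]] by simp
  qed (use z in simp)
  moreover have "snd u = \<zero>\<^bsub>L2_on (loop L)\<^esub>"
  proof (rule Dirichlet_eigenfunction_zero[OF cl(2) D(2) eig2])
    fix f f1 f2 assume f: "C2_L2 (loop L) f f1 f2" "f \<in> snd u"
    have "f 0 = 0" "f L = 0"
      using boundary_value_eq[OF cl(2), of "snd u" f 0] boundary_value_eq[OF cl(2), of "snd u" f L] f C b L
      by (simp_all add: C2_L2_def)
    then show "(LINT x|lebesgue_on (loop L). f2 x * cnj (f x)) - (LINT x|lebesgue_on (loop L). f x * cnj (f2 x)) = 0"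
      using Green_loop[OF L f(1) C2_L2_cnj[OF f(1)]] by simp
  qed (use z in simp)
  ultimately show ?thesis by (simp add: prod_eq_iff tadpole_simps)
qed

section \<open>Green's identity with the solutions symmetric on the loop\<close>

lemma integrable_exp_halfline:
  assumes "a > 0" shows "integrable (lebesgue_on {0<..}) (\<lambda>x::real. exp (- a * x))"
proof -
  have "(\<lambda>x::real. exp (- a * x)) absolutely_integrable_on {0..}"
    using integrable_on_exp_minus_to_infinity[OF assms, of 0]
    by (intro nonnegative_absolutely_integrable_1) auto
  then have "(\<lambda>x::real. exp (- a * x)) absolutely_integrable_on {0<..}"
    by (rule set_integrable_subset) auto
  then show ?thesis by (simp add: set_integrable_def integrable_restrict_space)
qed

lemma cmod_exp_i: "cmod (exp (\<i> * k * of_real x)) = exp (- Im k * x)"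
  by (simp add: norm_exp_eq_Re)

lemma exp_i_deriv:
  "((\<lambda>x. c * exp (\<i> * k * of_real x)) has_vector_derivative (\<i> * k * (c * exp (\<i> * k * of_real x)))) (at x)"
proof -
  have "((\<lambda>z. c * exp (\<i> * k * z)) has_field_derivative (\<i> * k * (c * exp (\<i> * k * of_real x)))) (at (of_real x))"
    by (auto intro!: derivative_eq_intros)
  then show ?thesis by (rule has_vector_derivative_real_field)
qed

lemma C2_L2_exp_halfline:
  assumes k: "Im k > 0"
  shows "C2_L2 {0<..} (\<lambda>x. c * exp (\<i> * k * of_real x)) (\<lambda>x. \<i> * k * (c * exp (\<i> * k * of_real x)))
    (\<lambda>x. - k\<^sup>2 * (c * exp (\<i> * k * of_real x)))"
proof -
  have "(\<lambda>x. exp (\<i> * k * of_real x)) \<in> L2_fun (lebesgue_on {0<..})"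
    unfolding L2_fun_def
  proof (intro CollectI conjI)
    show "(\<lambda>x. exp (\<i> * k * of_real x)) \<in> borel_measurable (lebesgue_on {0<..})"
      by (intro continuous_imp_measurable_on_sets_lebesgue continuous_intros) auto
    have "(cmod (exp (\<i> * k * of_real x)))\<^sup>2 = exp (- (2 * Im k) * x)" for x
      unfolding cmod_exp_i power2_eq_square exp_add[symmetric] by simp
    then show "integrable (lebesgue_on {0<..}) (\<lambda>x. (cmod (exp (\<i> * k * of_real x)))\<^sup>2)"
      using integrable_exp_halfline[of "2 * Im k"] k by simp
  qed
  then have L2: "(\<lambda>x. a * exp (\<i> * k * of_real x)) \<in> L2_fun (lebesgue_on {0<..})" for a
    by (rule L2_fun_scale)
  have "((\<lambda>x. \<i> * k * (c * exp (\<i> * k * of_real x))) has_vector_derivative (- k\<^sup>2 * (c * exp (\<i> * k * of_real x)))) (at x)" for x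
    using exp_i_deriv[of "\<i> * k * c" k x] by (simp add: power2_eq_square algebra_simps)
  then show ?thesis
    unfolding C2_L2_def using exp_i_deriv[of c k] L2[of c] L2[of "\<i> * k * c"] L2[of "- k\<^sup>2 * c"]
    by (auto simp: mult.assoc intro!: continuous_intros)
qed

lemma continuous_loop_L2:
  fixes L :: real and f :: "real \<Rightarrow> complex"
  assumes "continuous_on {0..L} f" shows "f \<in> L2_fun (lebesgue_on {0<..<L})"
  unfolding L2_fun_def
proof (intro CollectI conjI)
  have "continuous_on {0<..<L} f" using assms by (rule continuous_on_subset) auto
  then show "f \<in> borel_measurable (lebesgue_on {0<..<L})"
    by (rule continuous_imp_measurable_on_sets_lebesgue) simp
  have "(\<lambda>x. (cmod (f x))\<^sup>2) absolutely_integrable_on {0..L}"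
    using assms by (intro absolutely_integrable_continuous_real continuous_intros)
  then have "(\<lambda>x. (cmod (f x))\<^sup>2) absolutely_integrable_on {0<..<L}"
    by (rule set_integrable_subset) auto
  then show "integrable (lebesgue_on {0<..<L}) (\<lambda>x. (cmod (f x))\<^sup>2)"
    by (simp add: set_integrable_def integrable_restrict_space)
qed

lemma C2_L2_exp_loop:
  assumes L: "L > 0"
  shows "C2_L2 {0<..<L} (\<lambda>x. exp (\<i> * k * of_real x) + q * exp (\<i> * (- k) * of_real x))
    (\<lambda>x. \<i> * k * (exp (\<i> * k * of_real x) - q * exp (\<i> * (- k) * of_real x)))
    (\<lambda>x. - k\<^sup>2 * (exp (\<i> * k * of_real x) + q * exp (\<i> * (- k) * of_real x)))"
proof -
  have "((\<lambda>x. exp (\<i> * k * of_real x) + q * exp (\<i> * (- k) * of_real x))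
      has_vector_derivative \<i> * k * (exp (\<i> * k * of_real x) - q * exp (\<i> * (- k) * of_real x))) (at x)" for x
    using has_vector_derivative_add[OF exp_i_deriv[of 1 k x] exp_i_deriv[of q "- k" x]]
    by (simp add: algebra_simps)
  moreover have "((\<lambda>x. \<i> * k * (exp (\<i> * k * of_real x) - q * exp (\<i> * (- k) * of_real x)))
      has_vector_derivative - k\<^sup>2 * (exp (\<i> * k * of_real x) + q * exp (\<i> * (- k) * of_real x))) (at x)" for x
    using has_vector_derivative_diff[OF exp_i_deriv[of "\<i> * k" k x] exp_i_deriv[of "\<i> * k * q" "- k" x]]
    by (simp add: power2_eq_square algebra_simps)
  ultimately show ?thesis
    unfolding C2_L2_def using L by (auto intro!: continuous_loop_L2 continuous_intros)
qed

text \<open>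
  The characteristic equation of the problem, cleared of its denominator.
\<close>

definition char_fun :: "real \<Rightarrow> real \<Rightarrow> complex \<Rightarrow> complex" where
  "char_fun L \<alpha> k = exp (\<i> * k * of_real L) * (k + of_real \<alpha>) - (3 * k - of_real \<alpha>)"

text \<open>
  The bilinear pairing with the solution of \<open>- v'' = k\<^sup>2 v\<close> that equals \<open>(1 + q) exp (\<i> k x)\<close> on the half
  line and \<open>exp (\<i> k x) + exp (\<i> k (L - x))\<close> on the loop, where \<open>q = exp (\<i> k L)\<close>.  Its value at the
  vertex is \<open>1 + q\<close> along all three ends.
\<close>

definition tadpole_pairing :: "real \<Rightarrow> complex \<Rightarrow> tadpole_fun \<Rightarrow> complex" where
  "tadpole_pairing L k u =
    (LINT x|lebesgue_on halfline. ae_rep (fst u) x * ((1 + exp (\<i> * k * of_real L)) * exp (\<i> * k * of_real x)))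
    + (LINT x|lebesgue_on (loop L). ae_rep (snd u) x
        * (exp (\<i> * k * of_real x) + exp (\<i> * k * of_real L) * exp (\<i> * (- k) * of_real x)))"

lemma LINT_smult:
  assumes q: "q \<in> carrier (L2_space M)" and h: "h \<in> L2_fun M"
  shows "(LINT x|M. ae_rep (c \<odot>\<^bsub>L2_space M\<^esub> q) x * h x) = c * (LINT x|M. ae_rep q x * h x)"
proof -
  interpret V: complex_inner_space "L2_space M" by (rule complex_inner_space_L2)
  have "(LINT x|M. ae_rep \<zero>\<^bsub>L2_space M\<^esub> x * h x) = 0"
    using LINT_ae_rep[OF L2_zero_in zero_mem_L2_zero L2_fun_measurable[OF h]] by simp
  then show ?thesis
    using LINT_lincomb[OF L2_zero_in q h, of c] q by simp
qed

lemma tadpole_pairing_zero: "tadpole_pairing L k \<zero>\<^bsub>tadpole_L2 L\<^esub> = 0" if "Im k > 0" "L > 0"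
proof -
  have "(LINT x|M. ae_rep \<zero>\<^bsub>L2_space M\<^esub> x * h x) = 0" if "h \<in> L2_fun M" for M :: "real measure" and h
    using LINT_ae_rep[OF L2_zero_in zero_mem_L2_zero L2_fun_measurable[OF that]] by simp
  then show ?thesis
    unfolding tadpole_pairing_def tadpole_simps
    using C2_L2_exp_halfline[OF that(1)] C2_L2_exp_loop[OF that(2)] by (simp add: C2_L2_def)
qed

text \<open>
  The unknown boundary derivatives of \<open>u\<close> occur only in the combination that the vertex condition
  expresses by the value at the vertex, because \<open>v\<^sub>k\<close> is continuous there.
\<close>

lemma tadpole_Green:
  assumes L: "L > 0" and k: "Im k > 0" and u: "u \<in> tadpole_domain L \<alpha>"
    and w: "w = tadpole_iH L u \<ominus>\<^bsub>tadpole_L2 L\<^esub> (\<i> * z) \<odot>\<^bsub>tadpole_L2 L\<^esub> u" "w \<in> tadpole_domain L \<alpha>"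
  shows "(k\<^sup>2 - z) * tadpole_pairing L k u
    = - \<i> * (tadpole_pairing L k w + char_fun L \<alpha> k * vertex_value u)"
proof -
  note e = edge_halfline edge_loop[OF L]
  interpret V1: complex_inner_space "L2_on halfline" by (rule complex_inner_space_L2)
  interpret V2: complex_inner_space "L2_on (loop L)" by (rule complex_inner_space_L2)
  define q where "q = exp (\<i> * k * of_real L)"
  define v where "v x = (1 + q) * exp (\<i> * k * of_real x)" for x :: real
  define y where "y x = exp (\<i> * k * of_real x) + q * exp (\<i> * (- k) * of_real x)" for x :: real
  have v: "C2_L2 halfline v (\<lambda>x. \<i> * k * v x) (\<lambda>x. - k\<^sup>2 * v x)"
    unfolding v_def by (rule C2_L2_exp_halfline[OF k])
  have y: "C2_L2 (loop L) y (\<lambda>x. \<i> * k * (exp (\<i> * k * of_real x) - q * exp (\<i> * (- k) * of_real x))) (\<lambda>x. - k\<^sup>2 * y x)"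
    unfolding y_def by (rule C2_L2_exp_loop[OF L])
  have L2: "v \<in> L2_fun (lebesgue_on halfline)" "y \<in> L2_fun (lebesgue_on (loop L))"
    using v y by (auto simp: C2_L2_def)
  note D = tadpole_domainD[OF u] and Dw = tadpole_domainD[OF w(2)]
  note C = H2_carrier[OF e(1) D(1)] H2_carrier[OF e(2) D(2)] H2_carrier[OF e(1) Dw(1)] H2_carrier[OF e(2) Dw(2)]
  note d2 = tadpole_second_derivatives[OF L u w(1)]
  define P where "P a = (LINT x|lebesgue_on halfline. ae_rep a x * v x)" for a
  define Q where "Q a = (LINT x|lebesgue_on (loop L). ae_rep a x * y x)" for a
  have pair: "tadpole_pairing L k a = P (fst a) + Q (snd a)" for a
    by (simp add: tadpole_pairing_def P_def Q_def v_def y_def q_def)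
  have H1: "weak_derivative halfline (weak_derivative halfline (fst u)) \<in> sobolev_H1 halfline"
    "weak_derivative (loop L) (weak_derivative (loop L) (snd u)) \<in> sobolev_H1 (loop L)"
  proof -
    have "\<i> \<odot>\<^bsub>L2_on J\<^esub> b \<in> sobolev_H1 J" if "edge J" "b \<in> sobolev_H1 J" for J b
    proof -
      interpret W: complex_inner_space "L2_on J" by (rule complex_inner_space_L2)
      have "\<zero>\<^bsub>L2_on J\<^esub> \<oplus>\<^bsub>L2_on J\<^esub> \<i> \<odot>\<^bsub>L2_on J\<^esub> b \<in> sobolev_H1 J"
        by (rule H1_lincomb(1)[OF that(1) conjunct1[OF H1_zero[OF that(1)]] that(2)])
      then show ?thesis using H1_carrier[OF that(2)] by simp
    qed
    then show "weak_derivative halfline (weak_derivative halfline (fst u)) \<in> sobolev_H1 halfline"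
      "weak_derivative (loop L) (weak_derivative (loop L) (snd u)) \<in> sobolev_H1 (loop L)"
      unfolding d2 using H2_H1 D(1,2) Dw(1,2) e by (blast intro: H1_lincomb(1))+
  qed
  have P2: "P (weak_derivative halfline (weak_derivative halfline (fst u))) = \<i> * P (fst w) + (- z) * P (fst u)"
    unfolding P_def d2(1) using C by (subst LINT_lincomb) (auto simp: LINT_smult L2)
  have Q2: "Q (weak_derivative (loop L) (weak_derivative (loop L) (snd u))) = \<i> * Q (snd w) + (- z) * Q (snd u)"
    unfolding Q_def d2(2) using C by (subst LINT_lincomb) (auto simp: LINT_smult L2)
  have scal: "(LINT x|M. a x * (- k\<^sup>2 * h x)) = - k\<^sup>2 * (LINT x|M. a x * h x)" for a h and M :: "real measure"
    unfolding integral_mult_right_zero[symmetric] by (simp add: mult_ac)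
  have G1: "P (weak_derivative halfline (weak_derivative halfline (fst u))) - (- k\<^sup>2 * P (fst u))
      = vertex_value u * (\<i> * k * (1 + q)) - boundary_value halfline 0 (weak_derivative halfline (fst u)) * (1 + q)"
    using weak_Green_halfline[OF D(1) H1(1) v]
    unfolding scal P_def[symmetric] vertex_value_def[symmetric] by (simp add: v_def)
  have qL: "q * exp (\<i> * (- k) * of_real L) = 1"
    unfolding q_def exp_add[symmetric] by simp
  have yL: "y 0 = 1 + q" "y L = 1 + q"
    using qL by (simp_all add: y_def q_def)
  have y1L: "\<i> * k * (exp (\<i> * k * of_real L) - q * exp (\<i> * (- k) * of_real L)) = \<i> * k * (q - 1)"
    unfolding qL by (simp add: q_def)
  have G2: "Q (weak_derivative (loop L) (weak_derivative (loop L) (snd u))) - (- k\<^sup>2 * Q (snd u))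
      = (boundary_value (loop L) L (weak_derivative (loop L) (snd u)) * (1 + q) - vertex_value u * (\<i> * k * (q - 1)))
        - (boundary_value (loop L) 0 (weak_derivative (loop L) (snd u)) * (1 + q) - vertex_value u * (\<i> * k * (1 - q)))"
    using weak_Green_loop[OF L D(2) H1(2) y]
    unfolding scal Q_def[symmetric] yL y1L D(3,4) vertex_value_def[symmetric] by simp
  define d where "d = vertex_value u"
  \<comment> \<open>the vertex condition, solved for the derivative on the half line\<close>
  have jump: "boundary_value halfline 0 (weak_derivative halfline (fst u))
      = \<i> * of_real \<alpha> * d - boundary_value (loop L) 0 (weak_derivative (loop L) (snd u))
        + boundary_value (loop L) L (weak_derivative (loop L) (snd u))"
    using D(5) unfolding d_def vertex_value_def by (simp add: algebra_simps)
  have "(k\<^sup>2 - z) * tadpole_pairing L k u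
      = ((\<i> * P (fst w) + (- z) * P (fst u)) - (- k\<^sup>2 * P (fst u)))
        + ((\<i> * Q (snd w) + (- z) * Q (snd u)) - (- k\<^sup>2 * Q (snd u))) - \<i> * tadpole_pairing L k w"
    unfolding pair by (simp add: algebra_simps)
  also have "\<dots> = - \<i> * (tadpole_pairing L k w + char_fun L \<alpha> k * d)"
    unfolding G1[unfolded P2] G2[unfolded Q2] char_fun_def q_def[symmetric] jump d_def[symmetric]
    by (simp add: algebra_simps)
  finally show ?thesis unfolding d_def .
qed

lemma norm_LINT_le:
  fixes f :: "'a \<Rightarrow> complex"
  assumes "integrable M f" "integrable M g" "\<And>x. x \<in> space M \<Longrightarrow> norm (f x) \<le> g x"
  shows "norm (LINT x|M. f x) \<le> (LINT x|M. g x)"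
proof -
  have "norm (LINT x|M. f x) \<le> (LINT x|M. norm (f x))" by (rule Bochner_Integration.integral_norm_bound)
  also have "\<dots> \<le> (LINT x|M. g x)"
    using assms by (intro Bochner_Integration.integral_mono integrable_norm) auto
  finally show ?thesis .
qed

text \<open>
  For \<open>Im k \<ge> \<eta>\<close> the function \<open>v\<^sub>k\<close> is dominated by \<open>2 exp (- \<eta> x)\<close> on the half line and by \<open>2\<close> on the
  loop.
\<close>

lemma tadpole_pairing_bounded:
  assumes L: "L > 0" and \<eta>: "\<eta> > 0" and u: "u \<in> carrier (tadpole_L2 L)"
  shows "\<exists>C. \<forall>k. \<eta> \<le> Im k \<longrightarrow> cmod (tadpole_pairing L k u) \<le> C"
proof -
  have uc: "fst u \<in> carrier (L2_on halfline)" "snd u \<in> carrier (L2_on (loop L))"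
    using u by (auto simp: tadpole_simps)
  have uL: "ae_rep (fst u) \<in> L2_fun (lebesgue_on halfline)" "ae_rep (snd u) \<in> L2_fun (lebesgue_on (loop L))"
    using L2_memD(1)[OF uc(1) ae_rep_in[OF uc(1)]] L2_memD(1)[OF uc(2) ae_rep_in[OF uc(2)]] .
  have "(\<lambda>x. 2 * exp (\<i> * (\<i> * of_real \<eta>) * of_real x)) \<in> L2_fun (lebesgue_on halfline)"
    using C2_L2_exp_halfline[of "\<i> * of_real \<eta>" 2] \<eta> by (simp add: C2_L2_def)
  from integrable_norm[OF integrable_mult_L2[OF uL(1) this]]
  have i1: "integrable (lebesgue_on halfline) (\<lambda>x. cmod (ae_rep (fst u) x) * (2 * exp (- \<eta> * x)))"
    by (simp add: norm_mult)
  have "(\<lambda>x. 2) \<in> L2_fun (lebesgue_on (loop L))" by (intro continuous_loop_L2 continuous_intros)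
  from integrable_norm[OF integrable_mult_L2[OF uL(2) this]]
  have i2: "integrable (lebesgue_on (loop L)) (\<lambda>x. cmod (ae_rep (snd u) x) * 2)"
    by (simp add: norm_mult)
  define C where "C = (LINT x|lebesgue_on halfline. cmod (ae_rep (fst u) x) * (2 * exp (- \<eta> * x)))
    + (LINT x|lebesgue_on (loop L). cmod (ae_rep (snd u) x) * 2)"
  have "cmod (tadpole_pairing L k u) \<le> C" if k: "\<eta> \<le> Im k" for k
  proof -
    define q where "q = exp (\<i> * k * of_real L)"
    have dec: "cmod (exp (\<i> * k * of_real x)) \<le> exp (- \<eta> * x)" if "0 \<le> x" for x
      unfolding cmod_exp_i using k that by (simp add: mult_right_mono)
    have dec1: "cmod (exp (\<i> * k * of_real x)) \<le> 1" if "0 \<le> x" for x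
      unfolding cmod_exp_i using k \<eta> that by simp
    have q1: "cmod q \<le> 1" unfolding q_def using L by (intro dec1) simp
    then have q2: "cmod (1 + q) \<le> 2" using norm_triangle_ineq[of 1 q] by simp
    have "cmod (LINT x|lebesgue_on halfline. ae_rep (fst u) x * ((1 + q) * exp (\<i> * k * of_real x)))
        \<le> (LINT x|lebesgue_on halfline. cmod (ae_rep (fst u) x) * (2 * exp (- \<eta> * x)))"
    proof (rule norm_LINT_le)
      show "integrable (lebesgue_on halfline) (\<lambda>x. ae_rep (fst u) x * ((1 + q) * exp (\<i> * k * of_real x)))"
        using C2_L2_exp_halfline[of k "1 + q"] k \<eta> by (intro integrable_mult_L2 uL(1)) (simp add: C2_L2_def)
      show "norm (ae_rep (fst u) x * ((1 + q) * exp (\<i> * k * of_real x))) \<le> cmod (ae_rep (fst u) x) * (2 * exp (- \<eta> * x))"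
        if "x \<in> space (lebesgue_on halfline)" for x
        using dec[of x] q2 that unfolding norm_mult by (intro mult_left_mono mult_mono) auto
    qed (rule i1)
    moreover have "cmod (LINT x|lebesgue_on (loop L). ae_rep (snd u) x
          * (exp (\<i> * k * of_real x) + q * exp (\<i> * (- k) * of_real x)))
        \<le> (LINT x|lebesgue_on (loop L). cmod (ae_rep (snd u) x) * 2)"
    proof (rule norm_LINT_le)
      show "integrable (lebesgue_on (loop L)) (\<lambda>x. ae_rep (snd u) x
          * (exp (\<i> * k * of_real x) + q * exp (\<i> * (- k) * of_real x)))"
        using C2_L2_exp_loop[OF L, of k q] by (intro integrable_mult_L2 uL(2)) (simp add: C2_L2_def)
      show "norm (ae_rep (snd u) x * (exp (\<i> * k * of_real x) + q * exp (\<i> * (- k) * of_real x)))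
          \<le> cmod (ae_rep (snd u) x) * 2"
        if x: "x \<in> space (lebesgue_on (loop L))" for x
      proof -
        have "q * exp (\<i> * (- k) * of_real x) = exp (\<i> * k * of_real (L - x))"
          unfolding q_def exp_add[symmetric] by (simp add: algebra_simps)
        then have "cmod (exp (\<i> * k * of_real x) + q * exp (\<i> * (- k) * of_real x)) \<le> 1 + 1"
          using dec1[of x] dec1[of "L - x"] x by (intro norm_triangle_le add_mono) auto
        then show ?thesis unfolding norm_mult by (intro mult_left_mono) auto
      qed
    qed (rule i2)
    ultimately show ?thesis
      unfolding tadpole_pairing_def C_def q_def by (intro norm_triangle_le add_mono)
  qed
  then show ?thesis by blast
qed

section \<open>Zeros of the characteristic function\<close>

lemma char_fun_holomorphic: "char_fun L \<alpha> holomorphic_on A"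
  unfolding char_fun_def[abs_def] by (intro holomorphic_intros)

lemma char_fun_not_constant: "\<alpha> > 0 \<Longrightarrow> char_fun L \<alpha> k = 0 \<Longrightarrow> \<not> char_fun L \<alpha> constant_on UNIV"
  unfolding constant_on_def
proof
  assume a: "\<alpha> > 0" "char_fun L \<alpha> k = 0" and "\<exists>y. \<forall>x\<in>UNIV. char_fun L \<alpha> x = y"
  then obtain y where "\<And>x. char_fun L \<alpha> x = y" by auto
  then have "char_fun L \<alpha> 0 = 0" using a(2) by simp
  then have "complex_of_real (2 * \<alpha>) = 0" by (simp add: char_fun_def)
  then show False using a by (simp only: of_real_eq_0_iff)
qed

lemma char_fun_eq_zero_iff:
  assumes \<alpha>: "\<alpha> > 0" and k: "Re k > 0"
  shows "char_fun L \<alpha> k = 0 \<longleftrightarrow> exp (\<i> * k * of_real L) = 3 - 4 * of_real \<alpha> / (k + of_real \<alpha>)"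
proof -
  have nz: "k + of_real \<alpha> \<noteq> 0" using \<alpha> k by (auto simp: complex_eq_iff)
  have "3 - 4 * of_real \<alpha> / (k + of_real \<alpha>) = (3 * k - of_real \<alpha>) / (k + of_real \<alpha>)"
    using nz by (simp add: field_simps)
  note eq = this
  show ?thesis
    unfolding char_fun_def eq using nz by (simp add: eq_divide_eq)
qed

text \<open>
  Since \<open>\<bar>exp (\<i> k L)\<bar> < 1\<close> for \<open>Im k > 0\<close>, the characteristic equation confines \<open>k\<close> to the disc of radius
  \<open>2 \<alpha>\<close> around \<open>- \<alpha>\<close>.
\<close>

lemma finite_Sigma_p_minus:
  assumes L: "L > 0" and \<alpha>: "\<alpha> > 0"
  shows "finite (Sigma_p_minus L \<alpha>)"
proof -
  define Z where "Z = {k \<in> cball (- of_real \<alpha>) (2 * \<alpha>). char_fun L \<alpha> k = 0}"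
  have "finite Z"
  proof (cases "Z = {}")
    case False
    then obtain k where "char_fun L \<alpha> k = 0" by (auto simp: Z_def)
    then show ?thesis
      unfolding Z_def using \<alpha>
      by (intro holomorphic_compact_finite_zeros[of _ UNIV] char_fun_holomorphic char_fun_not_constant) auto
  qed simp
  moreover have "Sigma_p_minus L \<alpha> \<subseteq> (\<lambda>k. k\<^sup>2) ` Z"
  proof
    fix z assume "z \<in> Sigma_p_minus L \<alpha>"
    then obtain k where k: "z = k\<^sup>2" "Re k > 0" "Im k > 0"
      "exp (\<i> * k * of_real L) = 3 - 4 * of_real \<alpha> / (k + of_real \<alpha>)"
      by (auto simp: Sigma_p_minus_def)
    have nz: "k + of_real \<alpha> \<noteq> 0" using \<alpha> k by (auto simp: complex_eq_iff)
    have "cmod (exp (\<i> * k * of_real L)) < 1"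
      unfolding cmod_exp_i using k(3) L by simp
    then have "cmod (3 - 4 * of_real \<alpha> / (k + of_real \<alpha>)) < 1" using k(4) by simp
    moreover have "3 \<le> cmod (3 - 4 * of_real \<alpha> / (k + of_real \<alpha>)) + cmod (4 * of_real \<alpha> / (k + of_real \<alpha>))"
      using norm_triangle_ineq[of "3 - 4 * of_real \<alpha> / (k + of_real \<alpha>)" "4 * of_real \<alpha> / (k + of_real \<alpha>)"] by simp
    ultimately have "2 < cmod (4 * of_real \<alpha> / (k + of_real \<alpha>))" by linarith
    then have "2 < 4 * \<alpha> / cmod (k + of_real \<alpha>)"
      using \<alpha> by (simp add: norm_divide norm_mult)
    then have "2 * cmod (k + of_real \<alpha>) < 4 * \<alpha>"
      using nz by (simp add: less_divide_eq)
    moreover have "dist (- of_real \<alpha>) k = cmod (k + of_real \<alpha>)"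
      by (simp add: dist_norm norm_minus_commute add.commute flip: norm_minus_cancel[of "- of_real \<alpha> - k"])
    ultimately have "k \<in> Z"
      using char_fun_eq_zero_iff[OF \<alpha> k(2)] k(4) by (simp add: Z_def)
    then show "z \<in> (\<lambda>k. k\<^sup>2) ` Z" using k(1) by blast
  qed
  ultimately show ?thesis by (meson finite_imageI finite_subset)
qed

text \<open>
  Induction along the Jordan chain with \<open>tadpole_Green\<close>.  The chain ends in an eigenvector, whose value
  at the vertex is not zero; up to a power of \<open>- \<i>\<close> this value is \<open>P 0\<close>.
\<close>

lemma root_vector_vanishing_order:
  assumes L: "L > 0" and z: "Im z \<noteq> 0"
    and u: "u \<in> ker_power (tadpole_L2 L) (tadpole_domain L \<alpha>) (tadpole_iH L) (\<i> * z) (Suc n)"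
      "u \<notin> ker_power (tadpole_L2 L) (tadpole_domain L \<alpha>) (tadpole_iH L) (\<i> * z) n"
  shows "\<exists>P. isCont P 0 \<and> P 0 \<noteq> 0
    \<and> (\<forall>k. Im k > 0 \<longrightarrow> (k\<^sup>2 - z) ^ Suc n * tadpole_pairing L k u = char_fun L \<alpha> k * P (k\<^sup>2 - z))"
  using u
proof (induction n arbitrary: u)
  interpret unbounded_operator "tadpole_L2 L" "tadpole_domain L \<alpha>" "tadpole_iH L"
    by (rule unbounded_operator_tadpole[OF L])
  case 0
  have uD: "u \<in> tadpole_domain L \<alpha>" using 0 ker_subset by blast
  have w: "\<zero>\<^bsub>tadpole_L2 L\<^esub> = tadpole_iH L u \<ominus>\<^bsub>tadpole_L2 L\<^esub> (\<i> * z) \<odot>\<^bsub>tadpole_L2 L\<^esub> u"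
    using 0(1) by (simp add: ker_Suc shift_def)
  have "u \<noteq> \<zero>\<^bsub>tadpole_L2 L\<^esub>" using 0(2) by simp
  then have v: "vertex_value u \<noteq> 0"
    using eigenfunction_vertex_value[OF L _ z] 0(1) by (metis One_nat_def)
  show ?case
  proof (intro exI[of _ "\<lambda>_. - \<i> * vertex_value u"] conjI allI impI)
    fix k assume k: "Im k > 0"
    show "(k\<^sup>2 - z) ^ Suc 0 * tadpole_pairing L k u = char_fun L \<alpha> k * (- \<i> * vertex_value u)"
      using tadpole_Green[OF L k uD w subspace_0[OF domain_subspace]] tadpole_pairing_zero[OF k L] by simp
  qed (use v in auto)
next
  interpret unbounded_operator "tadpole_L2 L" "tadpole_domain L \<alpha>" "tadpole_iH L"
    by (rule unbounded_operator_tadpole[OF L])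
  case (Suc n)
  define w where "w = shift (\<i> * z) u"
  have uD: "u \<in> tadpole_domain L \<alpha>" using Suc.prems ker_subset by blast
  have w: "w \<in> ker (\<i> * z) (Suc n)" "w \<notin> ker (\<i> * z) n"
    using Suc.prems uD by (auto simp: w_def ker_Suc[of _ "Suc n"] ker_Suc[of _ n])
  then have wD: "w \<in> tadpole_domain L \<alpha>" using ker_subset by blast
  obtain P where P: "isCont P 0" "P 0 \<noteq> 0"
    "\<And>k. Im k > 0 \<Longrightarrow> (k\<^sup>2 - z) ^ Suc n * tadpole_pairing L k w = char_fun L \<alpha> k * P (k\<^sup>2 - z)"
    using Suc.IH[OF w] by blast
  show ?case
  proof (intro exI[of _ "\<lambda>s. - \<i> * (P s + s ^ Suc n * vertex_value u)"] conjI allI impI)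
    fix k assume k: "Im k > 0"
    have "(k\<^sup>2 - z) ^ Suc (Suc n) * tadpole_pairing L k u
        = (k\<^sup>2 - z) ^ Suc n * ((k\<^sup>2 - z) * tadpole_pairing L k u)"
      by (simp add: mult_ac)
    also have "\<dots> = - \<i> * ((k\<^sup>2 - z) ^ Suc n * tadpole_pairing L k w)
        - \<i> * (char_fun L \<alpha> k * ((k\<^sup>2 - z) ^ Suc n * vertex_value u))"
      unfolding tadpole_Green[OF L k uD w_def[unfolded shift_def] wD] by (simp add: algebra_simps)
    also have "\<dots> = char_fun L \<alpha> k * (- \<i> * (P (k\<^sup>2 - z) + (k\<^sup>2 - z) ^ Suc n * vertex_value u))"
      unfolding P(3)[OF k] by (simp add: algebra_simps)
    finally show "(k\<^sup>2 - z) ^ Suc (Suc n) * tadpole_pairing L k u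
      = char_fun L \<alpha> k * (- \<i> * (P (k\<^sup>2 - z) + (k\<^sup>2 - z) ^ Suc n * vertex_value u))" .
  qed (use P in \<open>auto intro!: continuous_intros\<close>)
qed

text \<open>
  Let \<open>m\<close> be the order of the zero \<open>k0\<close> of the characteristic function.  A chain of length \<open>m + 1\<close>
  would give, after division by \<open>(k - k0)\<^sup>m\<close>, an identity whose left side tends to a nonzero number
  as \<open>k\<close> tends to \<open>k0\<close>, while its right side tends to \<open>0\<close>.
\<close>

lemma root_space_bounded_length:
  assumes L: "L > 0" and \<alpha>: "\<alpha> > 0" and k0: "Re k0 > 0" "Im k0 > 0" "char_fun L \<alpha> k0 = 0"
  shows "\<exists>m. root_space (tadpole_L2 L) (tadpole_domain L \<alpha>) (tadpole_iH L) (\<i> * k0\<^sup>2)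
    \<subseteq> ker_power (tadpole_L2 L) (tadpole_domain L \<alpha>) (tadpole_iH L) (\<i> * k0\<^sup>2) m"
proof -
  interpret unbounded_operator "tadpole_L2 L" "tadpole_domain L \<alpha>" "tadpole_iH L"
    by (rule unbounded_operator_tadpole[OF L])
  have z: "Im (k0\<^sup>2) \<noteq> 0" using k0 by (simp add: Im_power2)
  obtain g r m where g: "0 < r" "g holomorphic_on ball k0 r"
    "\<And>k. k \<in> ball k0 r \<Longrightarrow> char_fun L \<alpha> k = (k - k0) ^ m * g k"
    "\<And>k. k \<in> ball k0 r \<Longrightarrow> g k \<noteq> 0"
    using holomorphic_factor_zero_nonconstant[OF char_fun_holomorphic open_UNIV connected_UNIV UNIV_I k0(3)
        char_fun_not_constant[OF \<alpha> k0(3)]] by metis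
  have stop: "ker (\<i> * k0\<^sup>2) (Suc m) \<subseteq> ker (\<i> * k0\<^sup>2) m"
  proof (rule ccontr)
    assume "\<not> ker (\<i> * k0\<^sup>2) (Suc m) \<subseteq> ker (\<i> * k0\<^sup>2) m"
    then obtain u where u: "u \<in> ker (\<i> * k0\<^sup>2) (Suc m)" "u \<notin> ker (\<i> * k0\<^sup>2) m" by blast
    obtain P where P: "isCont P 0" "P 0 \<noteq> 0"
      "\<And>k. Im k > 0 \<Longrightarrow> (k\<^sup>2 - k0\<^sup>2) ^ Suc m * tadpole_pairing L k u = char_fun L \<alpha> k * P (k\<^sup>2 - k0\<^sup>2)"
      using root_vector_vanishing_order[OF L z u] by blast
    define \<eta> where "\<eta> = Im k0 / 2"
    have \<eta>: "\<eta> > 0" using k0 by (simp add: \<eta>_def)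
    have "u \<in> carrier (tadpole_L2 L)" using u ker_subset D_in by blast
    from tadpole_pairing_bounded[OF L \<eta> this]
    obtain C where C: "\<And>k. \<eta> \<le> Im k \<Longrightarrow> cmod (tadpole_pairing L k u) \<le> C" by blast
    have ev: "\<forall>\<^sub>F k in at k0. k \<in> ball k0 r \<and> k \<noteq> k0 \<and> \<eta> < Im k"
    proof (intro eventually_conj)
      show "\<forall>\<^sub>F k in at k0. k \<in> ball k0 r"
        using g(1) by (intro eventually_at_in_open') auto
      show "\<forall>\<^sub>F k in at k0. k \<noteq> k0" by (simp add: eventually_at_filter)
      have "((\<lambda>k. Im k) \<longlongrightarrow> Im k0) (at k0)" by (intro tendsto_intros)
      then show "\<forall>\<^sub>F k in at k0. \<eta> < Im k"
        using k0(2) by (intro order_tendstoD) (auto simp: \<eta>_def)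
    qed
    have eq: "g k * P (k\<^sup>2 - k0\<^sup>2) = (k - k0) * (k + k0) ^ Suc m * tadpole_pairing L k u"
      if k: "k \<in> ball k0 r" "k \<noteq> k0" "\<eta> < Im k" for k
    proof -
      have s: "k\<^sup>2 - k0\<^sup>2 = (k - k0) * (k + k0)" by (simp add: power2_eq_square algebra_simps)
      have "(k - k0) ^ m * (g k * P (k\<^sup>2 - k0\<^sup>2)) = (k\<^sup>2 - k0\<^sup>2) ^ Suc m * tadpole_pairing L k u"
        using P(3)[of k] k \<eta> g(3)[OF k(1)] by simp
      also have "\<dots> = (k - k0) ^ m * ((k - k0) * (k + k0) ^ Suc m * tadpole_pairing L k u)"
        unfolding s power_mult_distrib by (simp add: mult_ac)
      finally show ?thesis using k(2) by simp
    qed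
    have "((\<lambda>k. g k * P (k\<^sup>2 - k0\<^sup>2)) \<longlongrightarrow> 0) (at k0)"
    proof (rule Lim_null_comparison)
      show "\<forall>\<^sub>F k in at k0. norm (g k * P (k\<^sup>2 - k0\<^sup>2)) \<le> cmod ((k - k0) * (k + k0) ^ Suc m) * C"
        using ev
      proof eventually_elim
        case (elim k)
        then show ?case
          using eq[of k] C[of k] by (simp add: norm_mult mult_left_mono)
      qed
      have "((\<lambda>k. cmod ((k - k0) * (k + k0) ^ Suc m) * C) \<longlongrightarrow> cmod ((k0 - k0) * (k0 + k0) ^ Suc m) * C) (at k0)"
        by (intro tendsto_intros)
      then show "((\<lambda>k. cmod ((k - k0) * (k + k0) ^ Suc m) * C) \<longlongrightarrow> 0) (at k0)" by simp
    qed
    moreover have "((\<lambda>k. g k * P (k\<^sup>2 - k0\<^sup>2)) \<longlongrightarrow> g k0 * P 0) (at k0)"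
    proof (rule tendsto_mult)
      have "isCont g k0"
        using g(1,2) holomorphic_on_imp_continuous_on continuous_on_interior[of "ball k0 r" g k0] by simp
      then show "(g \<longlongrightarrow> g k0) (at k0)" by (simp add: isCont_def)
      have "((\<lambda>k. k\<^sup>2 - k0\<^sup>2) \<longlongrightarrow> k0\<^sup>2 - k0\<^sup>2) (at k0)" by (intro tendsto_intros)
      then have "((\<lambda>k. k\<^sup>2 - k0\<^sup>2) \<longlongrightarrow> 0) (at k0)" by simp
      then show "((\<lambda>k. P (k\<^sup>2 - k0\<^sup>2)) \<longlongrightarrow> P 0) (at k0)"
        by (rule isCont_tendsto_compose[OF P(1)])
    qed
    ultimately have "g k0 * P 0 = 0" by (intro tendsto_unique[of "at k0"]) auto
    then show False using P(2) g(1) g(4)[of k0] by simp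
  qed
  have "ker (\<i> * k0\<^sup>2) n \<subseteq> ker (\<i> * k0\<^sup>2) m" for n
  proof (induction n)
    case (Suc n)
    then have "ker (\<i> * k0\<^sup>2) (Suc n) \<subseteq> ker (\<i> * k0\<^sup>2) (Suc m)"
      unfolding ker_Suc by blast
    then show ?case using stop by blast
  qed (use ker_mono[of 0 m] in simp)
  then show ?thesis unfolding root_space_def by blast
qed

theorem theorem3p1:
  fixes L \<alpha> :: real
    and I :: "'i set"
    and \<Psi> :: "'i \<Rightarrow> tadpole_fun"
  assumes "L > 0" and "\<alpha> > 0"
    and "generalized_eigenfunctions (tadpole_L2 L) (tadpole_domain L \<alpha>) (tadpole_iH L)
           (i_Sigma_p_minus L \<alpha>) I \<Psi>"
  shows "riesz_basis (H_p_minus L \<alpha>) I \<Psi>"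
proof -
  have root: "\<exists>k. \<mu> = \<i> * k\<^sup>2 \<and> Re k > 0 \<and> Im k > 0 \<and> char_fun L \<alpha> k = 0" if "\<mu> \<in> i_Sigma_p_minus L \<alpha>" for \<mu>
    using that char_fun_eq_zero_iff[OF assms(2)] by (auto simp: i_Sigma_p_minus_def Sigma_p_minus_def)
  interpret unbounded_operator "tadpole_L2 L" "tadpole_domain L \<alpha>" "tadpole_iH L"
    by (rule unbounded_operator_tadpole[OF assms(1)])
  show ?thesis
    unfolding H_p_minus_def
  proof (rule riesz_basis_generalized_eigenfunctions[where \<delta> = vertex_value])
    show "unbounded_operator (tadpole_L2 L) (tadpole_domain L \<alpha>) (tadpole_iH L)"
      by (rule unbounded_operator_tadpole[OF assms(1)])
    show "finite (i_Sigma_p_minus L \<alpha>)"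
      unfolding i_Sigma_p_minus_def by (intro finite_imageI finite_Sigma_p_minus assms)
    show "vertex_value (x \<oplus>\<^bsub>tadpole_L2 L\<^esub> y) = vertex_value x + vertex_value y"
      if "x \<in> tadpole_domain L \<alpha>" "y \<in> tadpole_domain L \<alpha>" for x y
      using vertex_value_lincomb[OF that, of 1] D_in[OF that(2)] by simp
    show "vertex_value (c \<odot>\<^bsub>tadpole_L2 L\<^esub> x) = c * vertex_value x" if x: "x \<in> tadpole_domain L \<alpha>" for c x
    proof -
      have "vertex_value \<zero>\<^bsub>tadpole_L2 L\<^esub> = 0"
        unfolding vertex_value_def tadpole_simps by (rule boundary_value_zero) simp_all
      then show ?thesis
        using vertex_value_lincomb[OF subspace_0[OF domain_subspace] x, of c] D_in[OF x] by simp
    qed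
    show "x = \<zero>\<^bsub>tadpole_L2 L\<^esub>"
      if "\<mu> \<in> i_Sigma_p_minus L \<alpha>"
        "x \<in> ker_power (tadpole_L2 L) (tadpole_domain L \<alpha>) (tadpole_iH L) \<mu> 1" "vertex_value x = 0" for \<mu> x
    proof -
      note x = that
      obtain k where k: "\<mu> = \<i> * k\<^sup>2" "Re k > 0" "Im k > 0" using root[OF x(1)] by blast
      then have "Im (k\<^sup>2) \<noteq> 0" by (simp add: Im_power2)
      then show ?thesis using eigenfunction_vertex_value[OF assms(1)] x(2,3) unfolding k(1) by blast
    qed
    show "\<exists>m. root_space (tadpole_L2 L) (tadpole_domain L \<alpha>) (tadpole_iH L) \<mu>
        \<subseteq> ker_power (tadpole_L2 L) (tadpole_domain L \<alpha>) (tadpole_iH L) \<mu> m"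
      if "\<mu> \<in> i_Sigma_p_minus L \<alpha>" for \<mu>
      using root[OF that] root_space_bounded_length[OF assms(1,2)] by blast
  qed (rule assms(3))
qed

end
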